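(* Let $n=p_1^{\alpha}p_2^{\beta}$, where $p_1\neq p_2$ are primes and $\alpha,\beta\in\mathbb N$ are positive integers, and suppose $\gcd(n,6)=1$. Let $G$ be a finite cyclic group of order $n$, and let $S=(g)(x_2g)(x_3g)(x_4g)$ be a minimal zero-sum sequence over $G$ such that $\operatorname{ord}(g)=n$ and $1\le x_2,x_3,x_4\le n-1$ are integers. Then $\operatorname{ind}(S)=1$.
   Context: $G$ is an additively written finite cyclic group of order $n$. A sequence over $G$ is a finite unordered sequence (multiset) of elements of $G$, repetition allowed, written multiplicatively. A sequence is zero-sum if its terms sum to $0$; it is a minimal zero-sum sequence if it is zero-sum and no proper nontrivial subsequence has sum zero. For a generator $h$ of $G$ and a sequence $S=(m_1h)\cdot\ldots\cdot(m_lh)$ with integers $1\le m_1,\dots,m_l\le n$, put $\|S\|_h=\frac{m_1+\cdots+m_l}{n}$. The index of $S$ is $\operatorname{ind}(S)=\min\{\|S\|_h : h\in G,\ \langle h\rangle=G\}$. *)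

theory Defs
  imports "HOL-Algebra.Elementary_Groups" "HOL-Algebra.Multiplicative_Group"
    "HOL-Computational_Algebra.Primes" "HOL-Library.Multiset"
begin

text \<open>
  The groups of HOL-Algebra are written multiplicatively: the product \<open>a \<otimes> b\<close>, the unit
  \<open>\<one>\<close> and the power \<open>a [^] m\<close> play the roles of \<open>a + b\<close>, \<open>0\<close> and \<open>m a\<close> in
  an additively written group. A sequence over \<open>G\<close> is a multiset of elements of \<open>carrier G\<close>.
\<close>

text \<open>The sum of the terms of \<open>S\<close>, that is, the sum of \<open>v\<^sub>g(S) g\<close> over the distinct
  terms \<open>g\<close> of \<open>S\<close>, where \<open>v\<^sub>g(S)\<close> is the multiplicity of \<open>g\<close> in \<open>S\<close>.\<close>

definition seq_sum :: "('a, 'b) monoid_scheme \<Rightarrow> 'a multiset \<Rightarrow> 'a" where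
  "seq_sum G S = finprod G (\<lambda>g. g [^]\<^bsub>G\<^esub> count S g) (set_mset S)"

definition zero_sum :: "('a, 'b) monoid_scheme \<Rightarrow> 'a multiset \<Rightarrow> bool" where
  "zero_sum G S \<longleftrightarrow> set_mset S \<subseteq> carrier G \<and> seq_sum G S = \<one>\<^bsub>G\<^esub>"

definition minimal_zero_sum :: "('a, 'b) monoid_scheme \<Rightarrow> 'a multiset \<Rightarrow> bool" where
  "minimal_zero_sum G S \<longleftrightarrow>
     zero_sum G S \<and> (\<forall>T. T \<subset># S \<and> T \<noteq> {#} \<longrightarrow> \<not> zero_sum G T)"

definition generators :: "('a, 'b) monoid_scheme \<Rightarrow> 'a set" where
  "generators G = {h \<in> carrier G. generate G {h} = carrier G}"

text \<open>The coefficient \<open>m\<close> in the representation \<open>x = m h\<close> with \<open>1 \<le> m \<le> n\<close>,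
  \<open>n\<close> the order of \<open>G\<close>; the range starts at \<open>1\<close>, so the neutral element has
  coefficient \<open>n\<close>. It is only meaningful for a generator \<open>h\<close> of a finite group.\<close>

definition seq_coeff :: "('a, 'b) monoid_scheme \<Rightarrow> 'a \<Rightarrow> 'a \<Rightarrow> nat" where
  "seq_coeff G h x = (THE m. 1 \<le> m \<and> m \<le> order G \<and> x = h [^]\<^bsub>G\<^esub> m)"

definition seq_norm :: "('a, 'b) monoid_scheme \<Rightarrow> 'a \<Rightarrow> 'a multiset \<Rightarrow> real" where
  "seq_norm G h S = real (\<Sum>x\<in>#S. seq_coeff G h x) / real (order G)"

definition seq_index :: "('a, 'b) monoid_scheme \<Rightarrow> 'a multiset \<Rightarrow> real" where
  "seq_index G S = Min ((\<lambda>h. seq_norm G h S) ` generators G)"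

lemma (in group) seq_coeff_ex1:
  assumes fin: "finite (carrier G)" and h: "h \<in> generators G" and x: "x \<in> carrier G"
  shows "\<exists>!m. 1 \<le> m \<and> m \<le> order G \<and> x = h [^] m"
proof -
  have hG: "h \<in> carrier G" and gen: "generate G {h} = carrier G"
    using h by (auto simp: generators_def)
  have oh: "ord h = order G"
    using generate_pow_card[OF hG] gen by (simp add: order_def)
  have bij: "bij_betw (\<lambda>m. h [^] m) {1..ord h} (carrier G)"
  proof -
    have inj: "inj_on (\<lambda>m. h [^] m) {1..ord h}"
      by (rule ord_inj'[OF hG])
    have sub: "(\<lambda>m. h [^] m) ` {1..ord h} \<subseteq> carrier G"
      using hG by auto
    have "card ((\<lambda>m. h [^] m) ` {1..ord h}) = card (carrier G)"
      using card_image[OF inj] oh by (simp add: order_def)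
    with sub fin have "(\<lambda>m. h [^] m) ` {1..ord h} = carrier G"
      by (intro card_subset_eq) auto
    with inj show ?thesis by (simp add: bij_betw_def)
  qed
  then show ?thesis
    using x oh unfolding bij_betw_def inj_on_def
    by (smt (verit, best) atLeastAtMost_iff imageE)
qed

lemma (in comm_group) seq_sum_empty: "seq_sum G {#} = \<one>"
  by (simp add: seq_sum_def)

lemma (in comm_group) seq_sum_add_mset:
  assumes a: "a \<in> carrier G" and S: "set_mset S \<subseteq> carrier G"
  shows "seq_sum G (add_mset a S) = a \<otimes> seq_sum G S"
proof -
  let ?B = "set_mset S - {a}"
  let ?P = "finprod G (\<lambda>g. g [^] count S g) ?B"
  have B: "(\<lambda>g. g [^] count S g) \<in> ?B \<rightarrow> carrier G"
    using S by auto
  have P: "?P \<in> carrier G"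
    by (rule finprod_closed[OF B])
  have "seq_sum G (add_mset a S) = finprod G (\<lambda>g. g [^] count (add_mset a S) g) (insert a ?B)"
    by (simp add: seq_sum_def)
  also have "\<dots> = a [^] Suc (count S a) \<otimes> finprod G (\<lambda>g. g [^] count (add_mset a S) g) ?B"
    by (subst finprod_insert) (use a S in \<open>auto simp del: nat_pow_Suc\<close>)
  also have "finprod G (\<lambda>g. g [^] count (add_mset a S) g) ?B = ?P"
    using S by (intro finprod_cong') auto
  also have "a [^] Suc (count S a) \<otimes> ?P = a \<otimes> (a [^] count S a \<otimes> ?P)"
    using m_assoc[OF a nat_pow_closed[OF a] P] nat_pow_Suc2[OF a] by simp
  also have "a [^] count S a \<otimes> ?P = seq_sum G S"
  proof (cases "a \<in># S")
    case True
    then have eq: "insert a ?B = set_mset S"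
      by auto
    have "seq_sum G S = finprod G (\<lambda>g. g [^] count S g) (insert a ?B)"
      by (simp only: eq seq_sum_def)
    also have "\<dots> = a [^] count S a \<otimes> ?P"
      by (subst finprod_insert) (use a B in auto)
    finally show ?thesis ..
  next
    case False
    then have "count S a = 0" and "?B = set_mset S"
      by (simp_all add: count_eq_zero_iff)
    with P show ?thesis by (simp add: seq_sum_def)
  qed
  finally show ?thesis .
qed

end

theory Submission
  imports Defs "HOL-Number_Theory.Number_Theory" "HOL-Computational_Algebra.Squarefree"
begin

text \<open>
  Write \<open>S\<close> as \<open>a\<^sub>0 g, \<dots>, a\<^sub>3 g\<close> with \<open>a\<^sub>0 = 1\<close>. If the index is not \<open>1\<close>, then the
  residues of \<open>t a\<^sub>k\<close> modulo \<open>n\<close> add up to \<open>2n\<close> for every unit \<open>t\<close> (the sums for \<open>t\<close> and \<open>-t\<close>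
  add up to \<open>4n\<close>), so by the Fourier series of the sawtooth function \<open>\<Sum>\<^sub>m H(tm)/m = 0\<close> for
  \<open>H(m) = \<Sum>\<^sub>k sin(2\<pi> a\<^sub>k m/n)\<close>. The nonvanishing of \<open>L(1, \<chi>)\<close>, in a form that avoids characters,
  turns this into the vanishing on the units of the function \<open>K\<close> obtained from \<open>H\<close> by removing the
  Euler factors at the two primes. Hence the finite Fourier transform of \<open>K\<close> has vanishing mixed
  differences along the subgroups of order \<open>p\<close> and \<open>q\<close>; on units it counts the \<open>a\<^sub>k\<close> minus the
  \<open>-a\<^sub>k\<close>. So on the unit part of a coset of the subgroup of order \<open>pq\<close>, a \<open>p \<times> q\<close> grid, this signed
  count is a function of the row plus a function of the column, which four terms are too few for:
  an empty row would put all \<open>a\<^sub>k\<close> into one residue class modulo \<open>p\<close>, so that \<open>p\<close> divides \<open>4\<close>, and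
  a row class occupied by only one \<open>\<plusminus>a\<^sub>k\<close> violates the rectangle identity, so \<open>p - 1 \<le> 4\<close> and
  likewise \<open>q - 1 \<le> 4\<close>.
\<close>

section \<open>The Moebius and von Mangoldt functions\<close>

text \<open>One vanishing series says little about a combination of characters; it is the vanishing
  for all units \<open>t\<close> that separates them. The nonvanishing theorem is therefore stated
  for functions all of whose scalings \<open>m -> t m\<close> have series 0: a nonzero one is shown
  to be a multiple of a real character, and real characters are treated with a Lambert series. That
  theorem concerns functions supported on the units, and \<open>H\<close> need not be one. Passing
  to \<open>K\<close> repairs this, but nothing is learnt about \<open>K\<close> at multiples of
  \<open>p\<close> or \<open>q\<close>; hence only a mixed difference of the count is controlled,
  not the count itself. Rows of the grid represent the residues modulo \<open>p\<close> only if
  \<open>p\<close> does not divide \<open>n/p\<close>. Higher exponents are excluded beforehand: all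
  \<open>p\<close> rows of the coset of 1 would then lie in one class modulo \<open>p\<close>, and
  each would need a term of its own. The condition \<open>gcd n 6 = 1\<close> gives
  \<open>p, q >= 5\<close>, so 2 and 3 are invertible, and the two final bounds leave only
  \<open>p = q = 5\<close>, against \<open>p \<noteq> q\<close>.\<close>

definition moebius_mu :: "nat \<Rightarrow> real" where
  "moebius_mu d = (if squarefree d then (- 1) ^ card (prime_factors d) else 0)"

lemma abs_moebius_mu_le: "\<bar>moebius_mu d\<bar> \<le> 1"
  by (simp add: moebius_mu_def power_abs)

lemma moebius_mu_prime_mult:
  fixes p d :: nat
  assumes p: "prime p" and nd: "\<not> p dvd d" and d: "d > 0"
  shows "moebius_mu (p * d) = - moebius_mu d"
proof -
  have cop: "coprime p d" using p nd by (simp add: prime_imp_coprime)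
  have "prime_factors (p * d) = insert p (prime_factors d)"
    using p d by (simp add: prime_factorization_mult prime_factorization_prime)
  moreover have "p \<notin> prime_factors d" using nd by auto
  ultimately have "card (prime_factors (p * d)) = Suc (card (prime_factors d))" by simp
  moreover have "squarefree (p * d) \<longleftrightarrow> squarefree d"
    using squarefree_mult_coprime[OF cop] squarefree_prime[OF p] squarefree_multD(2) by auto
  ultimately show ?thesis by (simp add: moebius_mu_def)
qed

text \<open>Fix a prime \<open>p\<close> dividing \<open>m > 1\<close>. Multiplication by
  \<open>p\<close> matches the squarefree divisors prime to \<open>p\<close> (\<open>?A\<close>)
  with the other squarefree ones (\<open>?B\<close>) and flips the sign of
  \<open>moebius_mu\<close>.\<close>

lemma sum_divisors_moebius_mu:
  fixes m :: nat
  assumes "m > 0"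
  shows "(\<Sum>d | d dvd m. moebius_mu d) = (if m = 1 then 1 else 0)"
proof (cases "m = 1")
  case True
  then show ?thesis by (simp add: moebius_mu_def)
next
  case False
  then obtain p where p: "prime p" "p dvd m" using prime_factor_nat by blast
  have fin: "finite {d. d dvd m}" using assms by simp
  let ?A = "{d. d dvd m \<and> \<not> p dvd d \<and> squarefree d}"
  let ?B = "{d. d dvd m \<and> p dvd d \<and> squarefree d}"
  have finA: "finite ?A" and finB: "finite ?B" using fin by (auto intro: finite_subset)
  have "bij_betw (\<lambda>d. p * d) ?A ?B"
  proof (rule bij_betwI[where g = "\<lambda>d. d div p"])
    show "(\<lambda>d. p * d) \<in> ?A \<rightarrow> ?B"
    proof
      fix d assume d: "d \<in> ?A"
      then have cop: "coprime p d" using p by (simp add: prime_imp_coprime)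
      then have "p * d dvd m" using p d by (simp add: divides_mult)
      then show "p * d \<in> ?B"
        using d p squarefree_mult_coprime[OF cop] squarefree_prime[of p] by simp
    qed
    show "(\<lambda>d. d div p) \<in> ?B \<rightarrow> ?A"
    proof
      fix d assume d: "d \<in> ?B"
      then obtain e where e: "d = p * e" by blast
      have "\<not> p dvd e"
      proof
        assume "p dvd e"
        then have "p ^ 2 dvd d" using e by (simp add: power2_eq_square)
        then show False using d p squarefreeD[of d p] by auto
      qed
      moreover have "squarefree e" using d e squarefree_multD(2) by blast
      moreover have "e dvd m" using d e dvd_mult_right by blast
      ultimately show "d div p \<in> ?A" using e p by (simp add: prime_gt_0_nat)
    qed
  qed (use p in \<open>auto simp: prime_gt_0_nat\<close>)
  then have "(\<Sum>d\<in>?B. moebius_mu d) = (\<Sum>d\<in>?A. moebius_mu (p * d))"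
    by (rule sum.reindex_bij_betw[symmetric])
  also have "\<dots> = (\<Sum>d\<in>?A. - moebius_mu d)"
    by (rule sum.cong) (use p assms in \<open>auto intro!: moebius_mu_prime_mult dest: dvd_pos_nat\<close>)
  finally have AB: "(\<Sum>d\<in>?A. moebius_mu d) + (\<Sum>d\<in>?B. moebius_mu d) = 0"
    by (simp add: sum_negf)
  have "(\<Sum>d | d dvd m. moebius_mu d) = (\<Sum>d\<in>?A \<union> ?B. moebius_mu d)"
    by (rule sum.mono_neutral_right) (use fin in \<open>auto simp: moebius_mu_def\<close>)
  also have "\<dots> = 0"
    using AB finA finB by (subst sum.union_disjoint) auto
  finally show ?thesis using False by simp
qed

text \<open>Both sides run over the pairs with \<open>d * e dvd m\<close>.\<close>

lemma sum_divisors_swap: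
  fixes m :: nat and f g :: "nat \<Rightarrow> real"
  assumes m: "m > 0"
  shows "(\<Sum>d | d dvd m. f d * (\<Sum>e | e dvd m div d. g e)) =
         (\<Sum>e | e dvd m. g e * (\<Sum>d | d dvd m div e. f d))"
proof -
  have eq: "(\<Sum>d | d dvd m. f d * (\<Sum>e | e dvd m div d. g e)) =
      (\<Sum>(d, e)\<in>{(d, e). d * e dvd m}. f d * g e)" for f g :: "nat \<Rightarrow> real"
  proof -
    have "(\<Sum>d | d dvd m. f d * (\<Sum>e | e dvd m div d. g e)) =
        (\<Sum>(d, e)\<in>Sigma {d. d dvd m} (\<lambda>d. {e. e dvd m div d}). f d * g e)"
      unfolding sum_distrib_left
      by (rule sum.Sigma) (use m in \<open>auto simp: dvd_div_eq_0_iff\<close>)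
    also have "Sigma {d. d dvd m} (\<lambda>d. {e. e dvd m div d}) = {(d, e). d * e dvd m}"
    proof -
      have "e dvd m div d \<longleftrightarrow> d * e dvd m" if "d dvd m" for d e
        using that m by (subst dvd_div_iff_mult) (auto simp: mult.commute)
      then show ?thesis by (auto dest: dvd_mult_left)
    qed
    finally show ?thesis .
  qed
  have "(\<Sum>(d, e)\<in>{(d, e). d * e dvd m}. f d * g e) =
      (\<Sum>(e, d)\<in>{(e, d). e * d dvd m}. g e * f d)"
    by (rule sum.reindex_bij_witness[where i = prod.swap and j = prod.swap])
       (auto simp: mult.commute)
  then show ?thesis by (simp add: eq)
qed

text \<open>Split \<open>ln (x / d)\<close> as \<open>ln (m / d) + ln (x / m)\<close>. The first
  part is the Moebius inversion of \<open>ln\<close> as the divisor sum of \<open>mangoldt\<close>;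
  the second is constant in \<open>d\<close> and survives only for \<open>m = 1\<close>.\<close>

lemma sum_divisors_moebius_mu_ln:
  fixes m :: nat and x :: real
  assumes m: "m > 0" and x: "x > 0"
  shows "(\<Sum>d | d dvd m. moebius_mu d * ln (x / d)) = mangoldt m + (if m = 1 then ln x else 0)"
proof -
  have pos: "d > 0 \<and> m div d > 0 \<and> ln (x / d) = ln (real (m div d)) + ln (x / m)" if "d dvd m" for d
  proof -
    from that obtain e where e: "m = d * e" by blast
    then have "d > 0" "e > 0" using m by auto
    then show ?thesis using e x by (simp add: ln_div ln_mult)
  qed
  have "(\<Sum>d | d dvd m. moebius_mu d * ln (x / d)) =
      (\<Sum>d | d dvd m. moebius_mu d * (\<Sum>e | e dvd m div d. mangoldt e) + moebius_mu d * ln (x / m))"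
  proof (rule sum.cong)
    fix d assume "d \<in> {d. d dvd m}"
    then have d: "d dvd m" by simp
    have "(\<Sum>e | e dvd m div d. mangoldt e) = ln (real (m div d))"
      using pos[OF d] mangoldt_sum[of "m div d", where 'a = real] by simp
    then show "moebius_mu d * ln (x / d) =
        moebius_mu d * (\<Sum>e | e dvd m div d. mangoldt e) + moebius_mu d * ln (x / m)"
      using pos[OF d] by (simp only: distrib_left)
  qed simp
  also have "\<dots> = (\<Sum>e | e dvd m. mangoldt e * (\<Sum>d | d dvd m div e. moebius_mu d))
      + (\<Sum>d | d dvd m. moebius_mu d) * ln (x / m)"
    using sum_divisors_swap[OF m, of moebius_mu mangoldt]
    by (simp add: sum.distrib sum_distrib_right)
  also have "(\<Sum>e | e dvd m. mangoldt e * (\<Sum>d | d dvd m div e. moebius_mu d)) =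
      (\<Sum>e | e dvd m. if e = m then mangoldt m else 0)"
  proof (rule sum.cong)
    fix e assume "e \<in> {e. e dvd m}"
    then obtain k where k: "m = e * k" by auto
    then have "e > 0" "k > 0" using m by auto
    then show "mangoldt e * (\<Sum>d | d dvd m div e. moebius_mu d) = (if e = m then mangoldt m else 0)"
      using k sum_divisors_moebius_mu[of k] by auto
  qed simp
  also have "\<dots> = mangoldt m" using m by (simp add: sum.delta)
  finally show ?thesis using sum_divisors_moebius_mu[OF m] by auto
qed

lemma sum_sum_divisors:
  fixes F :: "nat \<Rightarrow> nat \<Rightarrow> real"
  shows "(\<Sum>m=1..N. \<Sum>d | d dvd m. F d (m div d)) = (\<Sum>d=1..N. \<Sum>e=1..N div d. F d e)"
proof -
  have le: "b \<le> N" if "b * k \<le> N" "0 < k" for b k :: nat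
  proof -
    have "b * 1 \<le> b * k" using that by (intro mult_le_mono2) simp
    then show ?thesis using that by linarith
  qed
  have "(\<Sum>m=1..N. \<Sum>d | d dvd m. F d (m div d)) =
      (\<Sum>(m, d)\<in>Sigma {1..N} (\<lambda>m. {d. d dvd m}). F d (m div d))"
    by (rule sum.Sigma) auto
  also have "\<dots> = (\<Sum>(d, e)\<in>Sigma {1..N} (\<lambda>d. {1..N div d}). F d e)"
    by (rule sum.reindex_bij_witness[where i = "\<lambda>(d, e). (d * e, d)" and j = "\<lambda>(m, d). (d, m div d)"])
       (auto simp: less_eq_div_iff_mult_less_eq mult.commute Suc_le_eq elim!: dvdE intro: le)
  also have "\<dots> = (\<Sum>d=1..N. \<Sum>e=1..N div d. F d e)"
    by (rule sum.Sigma[symmetric]) auto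
  finally show ?thesis .
qed

section \<open>Chebyshev and Mertens bounds for the von Mangoldt function\<close>

lemma ln_fact_eq_sum_mangoldt:
  "ln (fact N) = (\<Sum>d=1..N. mangoldt d * real (N div d))"
proof -
  have "ln (fact N :: real) = (\<Sum>m=1..N. ln (real m))"
    by (subst fact_prod, subst of_nat_prod, subst ln_prod) auto
  also have "\<dots> = (\<Sum>m=1..N. \<Sum>d | d dvd m. mangoldt d)"
    by (rule sum.cong) (auto simp: mangoldt_sum)
  also have "\<dots> = (\<Sum>d=1..N. mangoldt d * real (N div d))"
    using sum_sum_divisors[of "\<lambda>d e. mangoldt d" N] by (simp add: mult.commute)
  finally show ?thesis .
qed

text \<open>\<open>N ^ N / fact N\<close> is a single term of the exponential series at
  \<open>N\<close>.\<close>

lemma ln_fact_lower: "real N * ln N - N \<le> ln (fact N)"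
proof (cases "N = 0")
  case False
  have "(\<lambda>k. real N ^ k /\<^sub>R fact k) sums exp (real N)" by (rule exp_converges)
  then have "real N ^ N /\<^sub>R fact N \<le> exp (real N)"
    using sum_le_suminf[of "\<lambda>k. real N ^ k /\<^sub>R fact k" "{N}"] by (simp add: sums_iff)
  then have "real N ^ N \<le> exp (real N) * fact N" by (simp add: field_simps)
  then have "ln (real N ^ N) \<le> ln (exp (real N) * fact N)"
    using False by (subst ln_le_cancel_iff) auto
  then show ?thesis using False by (simp add: ln_mult ln_realpow)
qed simp

text \<open>The binomial coefficient at \<open>N div 2\<close> is at most \<open>2 ^ N\<close>. The
  factor \<open>N div 2 + 1\<close> pays for odd \<open>N\<close>, where the larger half is
  \<open>N div 2 + 1\<close>.\<close>

lemma fact_le_2_power_fact_half: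
  "(fact N :: nat) \<le> 2 ^ N * (N div 2 + 1) * (fact (N div 2))\<^sup>2"
proof -
  let ?h = "N div 2"
  have "fact N = fact ?h * fact (N - ?h) * (N choose ?h)"
    using binomial_fact_lemma[of ?h N] by simp
  also have "\<dots> \<le> fact ?h * (fact ?h * (?h + 1)) * 2 ^ N"
  proof -
    have "fact (N - ?h) \<le> (fact ?h * (?h + 1) :: nat)"
    proof (cases "even N")
      case True
      then have "N - ?h = ?h" by auto
      then show ?thesis by simp
    next
      case False
      then have "N - ?h = Suc ?h" by presburger
      then show ?thesis by simp
    qed
    moreover have "N choose ?h \<le> 2 ^ N" by (rule binomial_le_pow2)
    ultimately show ?thesis by (intro mult_mono) auto
  qed
  finally show ?thesis by (simp add: power2_eq_square algebra_simps)
qed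

text \<open>Chebyshev's argument. With \<open>h = N div 2\<close>, the weight
  \<open>N div d - 2 * (h div d)\<close> is never negative and is at least 1 for
  \<open>h < d \<le> N\<close>, while the weighted sum is
  \<open>ln (fact N) - 2 * ln (fact h)\<close>, at most \<open>2 N\<close>. Repeated halving gives
  \<open>2 N + N + N / 2 + ... = 4 N\<close>.\<close>

lemma sum_mangoldt_le: "(\<Sum>d=1..N. mangoldt d) \<le> 4 * real N"
proof (induction N rule: less_induct)
  case (less N)
  show ?case
  proof (cases "N = 0")
    case False
    let ?h = "N div 2"
    have sub: "{1..?h} \<subseteq> {1..N}" by auto
    have "(\<Sum>d=1..N. mangoldt d) - (\<Sum>d=1..?h. mangoldt d) = (\<Sum>d\<in>{1..N}-{1..?h}. mangoldt d :: real)"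
      using sum_diff[OF _ sub, of "mangoldt :: nat \<Rightarrow> real"] by simp
    also have "\<dots> \<le> (\<Sum>d\<in>{1..N}-{1..?h}. mangoldt d * (real (N div d) - 2 * real (?h div d)))"
    proof (rule sum_mono)
      fix d assume "d \<in> {1..N}-{1..?h}"
      then have "?h < d" "d \<le> N" by auto
      then have "?h div d = 0" "N div d \<ge> 1" by (auto simp: less_eq_div_iff_mult_less_eq)
      then show "mangoldt d \<le> mangoldt d * (real (N div d) - 2 * real (?h div d))"
        using mult_left_mono[of 1 "real (N div d)" "mangoldt d"] mangoldt_nonneg[of d] by simp
    qed
    also have "\<dots> \<le> (\<Sum>d\<in>{1..N}. mangoldt d * (real (N div d) - 2 * real (?h div d)))"
    proof (rule sum_mono2)
      fix d assume "d \<in> {1..N} - ({1..N}-{1..?h})"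
      have "2 * (?h div d) \<le> N div d"
      proof (cases "d = 0")
        case False
        have "2 * (?h div d) * d \<le> 2 * ?h" using div_times_less_eq_dividend[of ?h d] by simp
        also have "\<dots> \<le> N" by simp
        finally show ?thesis using False by (simp add: less_eq_div_iff_mult_less_eq)
      qed simp
      then have "2 * real (?h div d) \<le> real (N div d)" by linarith
      then show "0 \<le> mangoldt d * (real (N div d) - 2 * real (?h div d))"
        using mangoldt_nonneg[of d] by simp
    qed auto
    also have "\<dots> = ln (fact N) - 2 * (\<Sum>d=1..N. mangoldt d * real (?h div d))"
      by (simp add: ln_fact_eq_sum_mangoldt sum_subtractf right_diff_distrib sum_distrib_left
          algebra_simps)
    also have "(\<Sum>d=1..N. mangoldt d * real (?h div d)) = (\<Sum>d=1..?h. mangoldt d * real (?h div d))"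
      by (rule sum.mono_neutral_right) auto
    also have "\<dots> = ln (fact ?h)" by (simp add: ln_fact_eq_sum_mangoldt)
    also have "ln (fact N) - 2 * ln (fact ?h) \<le> (2 * real N :: real)"
    proof -
      have "real (fact N) \<le> real (2 ^ N * (?h + 1) * (fact ?h)\<^sup>2)"
        using fact_le_2_power_fact_half[of N] of_nat_le_iff by blast
      then have "(fact N :: real) \<le> 2 ^ N * (real ?h + 1) * (fact ?h)\<^sup>2"
        by (simp add: algebra_simps)
      then have "ln (fact N :: real) \<le> ln (2 ^ N * (real ?h + 1) * (fact ?h)\<^sup>2)"
        by (subst ln_le_cancel_iff) (auto intro!: mult_pos_pos)
      also have "\<dots> = real N * ln 2 + ln (real ?h + 1) + 2 * ln (fact ?h)"
        by (simp add: ln_mult ln_realpow add_pos_nonneg)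
      finally have "ln (fact N :: real) \<le> real N * ln 2 + ln (real ?h + 1) + 2 * ln (fact ?h)" .
      moreover have "ln (real ?h + 1) \<le> real ?h" using ln_add_one_self_le_self[of "real ?h"]
        by (simp add: add.commute)
      moreover have "real N * ln 2 \<le> real N" using ln_2_less_1 by (simp add: mult_left_le)
      moreover have "real ?h \<le> real N" by simp
      ultimately show ?thesis by linarith
    qed
    finally have "(\<Sum>d=1..N. mangoldt d :: real) \<le> (\<Sum>d=1..?h. mangoldt d) + 2 * real N" by simp
    moreover have "(\<Sum>d=1..?h. mangoldt d :: real) \<le> 4 * real ?h"
      using False by (intro less.IH) auto
    moreover have "4 * real ?h \<le> 2 * real N" by linarith
    ultimately show ?thesis by linarith
  qed simp
qed

text \<open>Mertens' upper bound: replacing \<open>N / d\<close> by \<open>N div d + 1\<close> turns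
  \<open>N\<close> times the sum into \<open>ln (fact N)\<close> plus Chebyshev's sum, which
  supplies the constant 4.\<close>

lemma sum_mangoldt_over_le:
  assumes N: "N \<ge> 1"
  shows "(\<Sum>d=1..N. mangoldt d / real d) \<le> ln N + 4"
proof -
  have "N * (\<Sum>d=1..N. mangoldt d / real d) = (\<Sum>d=1..N. mangoldt d * (real N / real d))"
    by (simp add: sum_distrib_left mult.commute)
  also have "\<dots> \<le> (\<Sum>d=1..N. mangoldt d * (real (N div d) + 1))"
  proof (intro sum_mono mult_left_mono mangoldt_nonneg)
    fix d show "real N / real d \<le> real (N div d) + 1"
      by (metis floor_divide_of_nat_eq real_of_int_floor_add_one_ge of_int_of_nat_eq)
  qed
  also have "\<dots> = ln (fact N) + (\<Sum>d=1..N. mangoldt d)"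
    by (simp add: ln_fact_eq_sum_mangoldt distrib_left sum.distrib)
  also have "\<dots> \<le> N * ln N + 4 * N"
  proof -
    have "(fact N :: real) \<le> real N ^ N" using fact_le_power[of N] by simp
    then have "ln (fact N :: real) \<le> ln (real N ^ N)" using N by (subst ln_le_cancel_iff) auto
    then show ?thesis using sum_mangoldt_le[of N] N by (simp add: ln_realpow)
  qed
  also have "\<dots> = N * (ln N + 4)" by (simp add: distrib_left)
  finally show ?thesis using N by simp
qed

section \<open>Dirichlet series of periodic functions at 1\<close>

lemma summation_by_parts:
  fixes f a :: "nat \<Rightarrow> real"
  assumes "M \<le> N"
  shows "(\<Sum>m=M..<N. f m * a m) = (\<Sum>k<N. f k) * a N - (\<Sum>k<M. f k) * a M
    + (\<Sum>m=M..<N. (\<Sum>k<Suc m. f k) * (a m - a (Suc m)))"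
  using assms
proof (induction N rule: dec_induct)
  case (step N)
  then show ?case by (simp add: algebra_simps)
qed simp

text \<open>Dirichlet's test: summation by parts leaves two boundary terms and a telescoping sum, in
  total \<open>C a N + C a M + C (a M - a N)\<close>.\<close>

lemma abs_sum_mult_decreasing_le:
  fixes f a :: "nat \<Rightarrow> real"
  assumes C: "\<And>N. \<bar>\<Sum>k<N. f k\<bar> \<le> C" and MN: "M \<le> N"
    and dec: "\<And>m. M \<le> m \<Longrightarrow> a (Suc m) \<le> a m" and nonneg: "\<And>m. M \<le> m \<Longrightarrow> 0 \<le> a m"
  shows "\<bar>\<Sum>m=M..<N. f m * a m\<bar> \<le> 2 * C * a M"
proof -
  have "\<bar>\<Sum>m=M..<N. (\<Sum>k<Suc m. f k) * (a m - a (Suc m))\<bar> \<le> (\<Sum>m=M..<N. C * (a m - a (Suc m)))"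
    by (rule order_trans[OF sum_abs], rule sum_mono)
       (use C dec in \<open>auto simp: abs_mult simp del: sum.lessThan_Suc intro!: mult_mono order_trans[OF abs_ge_zero C]\<close>)
  also have "\<dots> = C * (a M - a N)"
    using MN sum_Suc_diff'[of M N "\<lambda>m. - a m"] by (simp add: sum_distrib_left[symmetric])
  finally have 1: "\<bar>\<Sum>m=M..<N. (\<Sum>k<Suc m. f k) * (a m - a (Suc m))\<bar> \<le> C * (a M - a N)" .
  have 2: "\<bar>(\<Sum>k<N. f k) * a N\<bar> \<le> C * a N" "\<bar>(\<Sum>k<M. f k) * a M\<bar> \<le> C * a M"
    using C nonneg MN by (auto simp: abs_mult intro!: mult_right_mono)
  have "\<bar>\<Sum>m=M..<N. f m * a m\<bar> \<le> C * a N + C * a M + C * (a M - a N)"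
    using summation_by_parts[OF MN, of f a] 1 2 by linarith
  then show ?thesis by (simp add: algebra_simps)
qed

lemma sum_lessThan_add:
  fixes f :: "nat \<Rightarrow> real"
  shows "(\<Sum>k<n + j. f k) = (\<Sum>k<n. f k) + (\<Sum>k<j. f (k + n))"
  by (induction j) (simp_all add: add.commute)

lemma periodic_mod:
  fixes f :: "nat \<Rightarrow> 'a"
  assumes "\<And>m. f (m + n) = f m"
  shows "f (m mod n) = f m"
proof -
  have "f (k + j * n) = f k" for k j
  proof (induction j)
    case (Suc j)
    then show ?case using assms[of "k + j * n"] by (simp add: algebra_simps)
  qed simp
  from this[of "m mod n" "m div n"] show ?thesis by simp
qed

lemma periodic_bounded:
  fixes f :: "nat \<Rightarrow> real"
  assumes per: "\<And>m. f (m + n) = f m" and n: "n > 0"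
  shows "\<bar>f m\<bar> \<le> (\<Sum>k<n. \<bar>f k\<bar>)"
proof -
  have "\<bar>f (m mod n)\<bar> \<le> (\<Sum>k<n. \<bar>f k\<bar>)"
    by (rule member_le_sum) (use n in auto)
  then show ?thesis using periodic_mod[of f n m] per by simp
qed

text \<open>Complete periods cancel, so fewer than \<open>n\<close> terms remain.\<close>

lemma abs_sum_periodic_le:
  fixes f :: "nat \<Rightarrow> real"
  assumes per: "\<And>m. f (m + n) = f m" and n: "n > 0" and zero: "(\<Sum>k<n. f k) = 0"
    and B: "\<And>m. \<bar>f m\<bar> \<le> B"
  shows "\<bar>\<Sum>k<N. f k\<bar> \<le> n * B"
proof (induction N rule: less_induct)
  case (less N)
  have B0: "B \<ge> 0" using B[of 0] by linarith
  show ?case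
  proof (cases "N < n")
    case True
    have "\<bar>\<Sum>k<N. f k\<bar> \<le> (\<Sum>k<N. B)" by (rule order_trans[OF sum_abs], rule sum_mono) (rule B)
    also have "\<dots> \<le> n * B" using True B0 by (simp add: mult_right_mono)
    finally show ?thesis .
  next
    case False
    then have "(\<Sum>k<N. f k) = (\<Sum>k<N - n. f k)"
      using sum_lessThan_add[of f n "N - n"] zero per by simp
    then show ?thesis using less[of "N - n"] False n by simp
  qed
qed

text \<open>Real functions on the unit group of the integers modulo \<open>n\<close>, extended by 0
  as Dirichlet characters are.\<close>

definition unit_periodic :: "nat \<Rightarrow> (nat \<Rightarrow> real) \<Rightarrow> bool" where
  "unit_periodic n f \<longleftrightarrow> (\<forall>m. f (m + n) = f m) \<and> (\<forall>m. \<not> coprime m n \<longrightarrow> f m = 0)"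

text \<open>The term at \<open>0\<close> is \<open>f 0 / 0 = 0\<close>.\<close>

definition dirichlet_one :: "(nat \<Rightarrow> real) \<Rightarrow> real" where
  "dirichlet_one f = (\<Sum>m. f m / real m)"

lemma
  fixes f :: "nat \<Rightarrow> real"
  assumes C: "\<And>N. \<bar>\<Sum>k<N. f k\<bar> \<le> C"
  shows summable_dirichlet_one: "summable (\<lambda>m. f m / real m)"
    and dirichlet_one_tail: "N \<ge> 1 \<Longrightarrow> \<bar>(\<Sum>m<N. f m / real m) - dirichlet_one f\<bar> \<le> 2 * C / real N"
proof -
  have C0: "C \<ge> 0" using C[of 0] by simp
  have tail: "\<bar>\<Sum>m=M..<N. f m / real m\<bar> \<le> 2 * C / real M" if "M \<ge> 1" "M \<le> N" for M N
    using abs_sum_mult_decreasing_le[OF C that(2), of "\<lambda>m. 1 / real m"] that(1)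
    by (simp add: frac_le)
  show sm: "summable (\<lambda>m. f m / real m)"
    unfolding summable_Cauchy
  proof (intro allI impI)
    fix e :: real assume e: "e > 0"
    obtain K :: nat where K: "real K > 2 * C / e" using reals_Archimedean2 by blast
    show "\<exists>N. \<forall>m\<ge>N. \<forall>n. norm (\<Sum>m=m..<n. f m / real m) < e"
    proof (intro exI[of _ "Suc K"] allI impI)
      fix m n assume m: "Suc K \<le> m"
      have "2 * C / e < real m" using K m by linarith
      then have lt: "2 * C / real m < e" using e m by (simp add: field_simps)
      show "norm (\<Sum>m=m..<n. f m / real m) < e"
      proof (cases "m \<le> n")
        case True
        then show ?thesis using tail[of m n] m lt by simp
      qed (use e in simp)
    qed
  qed
  assume N: "N \<ge> 1"
  have "(\<lambda>K. (\<Sum>m<N. f m / real m) - (\<Sum>m<K. f m / real m)) \<longlonglongrightarrow>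
      (\<Sum>m<N. f m / real m) - dirichlet_one f"
    unfolding dirichlet_one_def by (intro tendsto_intros summable_LIMSEQ sm)
  then have "(\<lambda>K. \<bar>(\<Sum>m<N. f m / real m) - (\<Sum>m<K. f m / real m)\<bar>) \<longlonglongrightarrow>
      \<bar>(\<Sum>m<N. f m / real m) - dirichlet_one f\<bar>"
    by (rule tendsto_rabs)
  then show "\<bar>(\<Sum>m<N. f m / real m) - dirichlet_one f\<bar> \<le> 2 * C / real N"
  proof (rule LIMSEQ_le_const2)
    show "\<exists>K0. \<forall>K\<ge>K0. \<bar>(\<Sum>m<N. f m / real m) - (\<Sum>m<K. f m / real m)\<bar> \<le> 2 * C / real N"
    proof (intro exI[of _ N] allI impI)
      fix K assume "N \<le> K"
      then have "(\<Sum>m<K. f m / real m) = (\<Sum>m<N. f m / real m) + (\<Sum>m=N..<K. f m / real m)"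
        by (simp add: lessThan_atLeast0 sum.atLeastLessThan_concat)
      then show "\<bar>(\<Sum>m<N. f m / real m) - (\<Sum>m<K. f m / real m)\<bar> \<le> 2 * C / real N"
        using tail[OF N \<open>N \<le> K\<close>] by simp
    qed
  qed
qed

lemma sum_atLeast1_eq_lessThan:
  fixes f :: "nat \<Rightarrow> real"
  assumes "f 0 = 0"
  shows "(\<Sum>m=1..N. f m) = (\<Sum>m<Suc N. f m)"
  using assms by (simp add: lessThan_Suc_atMost atLeast0AtMost[symmetric] sum.atLeast_Suc_atMost)

text \<open>The first omitted index \<open>Suc (N div d)\<close> exceeds \<open>N / d\<close>, so
  the tail bound becomes linear in \<open>d\<close>. A factor \<open>1 / d\<close> cancels this
  growth when the estimate is summed over \<open>d\<close>.\<close>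

lemma dirichlet_one_partial_sum:
  fixes f :: "nat \<Rightarrow> real"
  assumes C: "\<And>N. \<bar>\<Sum>k<N. f k\<bar> \<le> C" and d: "1 \<le> d" "d \<le> N"
  shows "\<bar>(\<Sum>e=1..N div d. f e / real e) - dirichlet_one f\<bar> \<le> 2 * C * real d / real N"
proof -
  have C0: "C \<ge> 0" using C[of 0] by simp
  have "N < Suc (N div d) * d" using d dividend_less_div_times[of d N] by simp
  then have lt: "real N < real (Suc (N div d)) * real d" by (metis of_nat_less_iff of_nat_mult)
  have "(\<Sum>e=1..N div d. f e / real e) = (\<Sum>e<Suc (N div d). f e / real e)"
    by (rule sum_atLeast1_eq_lessThan) simp
  then have "\<bar>(\<Sum>e=1..N div d. f e / real e) - dirichlet_one f\<bar> \<le> 2 * C / real (Suc (N div d))"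
    using dirichlet_one_tail[OF C, of "Suc (N div d)"] by simp
  also have "\<dots> \<le> 2 * C * real d / real N"
  proof -
    have "2 * C * real N \<le> 2 * C * (real (Suc (N div d)) * real d)"
      using lt C0 by (intro mult_left_mono) auto
    then show ?thesis using d by (simp add: field_simps)
  qed
  finally show ?thesis .
qed

lemma unit_periodicD:
  assumes "unit_periodic n f"
  shows "f (m + n) = f m" "\<not> coprime m n \<Longrightarrow> f m = 0" "f (m mod n) = f m"
  using assms periodic_mod[of f n] by (auto simp: unit_periodic_def)

lemma unit_periodic_scale:
  assumes "unit_periodic n f" "coprime t n"
  shows "unit_periodic n (\<lambda>m. f (t * m))"
proof -
  have "f (t * (m + n)) = f (t * m)" for m
    using unit_periodicD(3)[OF assms(1), of "t * m + t * n"] unit_periodicD(3)[OF assms(1), of "t * m"]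
    by (simp add: distrib_left)
  moreover have "f (t * m) = 0" if "\<not> coprime m n" for m
    using that assms by (intro unit_periodicD(2)) auto
  ultimately show ?thesis by (simp add: unit_periodic_def)
qed

lemma bij_betw_mult_mod:
  fixes n t :: nat
  assumes n: "n > 0" and t: "coprime t n"
  shows "bij_betw (\<lambda>m. t * m mod n) {..<n} {..<n}"
proof -
  have "inj_on (\<lambda>m. t * m mod n) {..<n}"
  proof (rule inj_onI)
    fix x y assume xy: "x \<in> {..<n}" "y \<in> {..<n}" "t * x mod n = t * y mod n"
    then have "[t * x = t * y] (mod n)" by (simp add: cong_def)
    then have "[x = y] (mod n)" using t cong_mult_lcancel_nat by blast
    then show "x = y" using xy by (simp add: cong_def)
  qed
  moreover have "(\<lambda>m. t * m mod n) ` {..<n} \<subseteq> {..<n}" using n by auto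
  ultimately show ?thesis
    by (metis bij_betw_def endo_inj_surj finite_lessThan)
qed

lemma sum_periodic_scale:
  fixes f :: "nat \<Rightarrow> real"
  assumes per: "\<And>m. f (m + n) = f m" and n: "n > 0" and t: "coprime t n"
  shows "(\<Sum>m<n. f (t * m)) = (\<Sum>m<n. f m)"
proof -
  have "(\<Sum>m<n. f (t * m)) = (\<Sum>m<n. f (t * m mod n))"
    using periodic_mod[of f n] per by simp
  also have "\<dots> = (\<Sum>m<n. f m)"
    by (rule sum.reindex_bij_betw[OF bij_betw_mult_mod[OF n t]])
  finally show ?thesis .
qed

text \<open>The bound is the same for all units \<open>t\<close>; this allows it to be summed over
  scalings.\<close>

lemma unit_periodic_partial_sums:
  assumes f: "unit_periodic n f" and n: "n > 0" and zero: "(\<Sum>m<n. f m) = 0" and t: "coprime t n"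
  shows "\<bar>\<Sum>k<N. f (t * k)\<bar> \<le> n * (\<Sum>k<n. \<bar>f k\<bar>)"
proof (rule abs_sum_periodic_le[OF _ n])
  show "f (t * (m + n)) = f (t * m)" for m
    using unit_periodicD(1)[OF unit_periodic_scale[OF f t]] .
  show "(\<Sum>k<n. f (t * k)) = 0"
    using sum_periodic_scale[of f n t] unit_periodicD(1)[OF f] n t zero by simp
  show "\<bar>f (t * m)\<bar> \<le> (\<Sum>k<n. \<bar>f k\<bar>)" for m
    using periodic_bounded[of f n] unit_periodicD(1)[OF f] n by simp
qed

lemma sum_ln_div_le:
  assumes "N \<ge> 1"
  shows "(\<Sum>d=1..N. ln (real N / real d)) \<le> real N"
proof -
  have "(\<Sum>d=1..N. ln (real N / real d)) = (\<Sum>d=1..N. ln (real N) - ln (real d))"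
    by (rule sum.cong) (use assms in \<open>auto simp: ln_div\<close>)
  also have "\<dots> = real N * ln (real N) - ln (fact N)"
    by (subst fact_prod, subst of_nat_prod, subst ln_prod) (auto simp: sum_subtractf)
  finally show ?thesis using ln_fact_lower[of N] by simp
qed

text \<open>Character-free form of the fact that \<open>L(1, \<chi>) = 0\<close> makes the sum of
  \<open>\<chi>(m) mangoldt m / m\<close> equal to \<open>- ln N + O(1)\<close>. Replace
  \<open>mangoldt m\<close>, with \<open>ln N\<close> added at \<open>m = 1\<close>, by its Moebius
  sum and write \<open>m = d e\<close>: the inner sum over \<open>e\<close> is a partial sum of a
  vanishing series, hence \<open>O(d / N)\<close>, and the weights \<open>ln (N / d)\<close> add up
  to at most \<open>N\<close>.\<close>

lemma sum_mangoldt_of_dirichlet_one_eq_0: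
  assumes f: "unit_periodic n f" and n: "n > 0" and zero: "(\<Sum>m<n. f m) = 0"
    and L: "\<And>t. coprime t n \<Longrightarrow> dirichlet_one (\<lambda>m. f (t * m)) = 0"
  shows "\<exists>C. \<forall>N\<ge>1. \<bar>f 1 * ln (real N) + (\<Sum>m=1..N. f m * mangoldt m / real m)\<bar> \<le> C"
proof (intro exI allI impI)
  fix N :: nat assume N: "N \<ge> 1"
  define C where "C = n * (\<Sum>k<n. \<bar>f k\<bar>)"
  have C0: "C \<ge> 0" unfolding C_def by (intro mult_nonneg_nonneg sum_nonneg) auto
  have inner: "\<bar>\<Sum>e=1..N div d. f (d * e) / real e\<bar> \<le> 2 * C * real d / real N"
    if d: "d \<in> {1..N}" for d
  proof (cases "coprime d n")
    case True
    have "\<bar>\<Sum>k<N. f (d * k)\<bar> \<le> C" for N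
      unfolding C_def by (rule unit_periodic_partial_sums[OF f n zero True])
    from dirichlet_one_partial_sum[where f = "\<lambda>m. f (d * m)", OF this, of d N] show ?thesis
      using L[OF True] d by simp
  next
    case False
    then have "f (d * e) = 0" for e by (intro unit_periodicD(2)[OF f]) simp
    then show ?thesis using C0 by simp
  qed
  have "f 1 * ln (real N) + (\<Sum>m=1..N. f m * mangoldt m / real m) =
      (\<Sum>m=1..N. f m / m * (mangoldt m + (if m = 1 then ln (real N) else 0)))"
    using N by (simp add: distrib_left sum.distrib if_distrib[of "\<lambda>x. _ * x"] sum.delta cong: if_cong)
  also have "\<dots> = (\<Sum>m=1..N. \<Sum>d | d dvd m. f m / m * (moebius_mu d * ln (real N / d)))"
  proof (rule sum.cong)
    fix m assume m: "m \<in> {1..N}"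
    have "(\<Sum>d | d dvd m. moebius_mu d * ln (real N / d)) = mangoldt m + (if m = 1 then ln (real N) else 0)"
      by (rule sum_divisors_moebius_mu_ln) (use m N in auto)
    then show "f m / m * (mangoldt m + (if m = 1 then ln (real N) else 0)) =
        (\<Sum>d | d dvd m. f m / m * (moebius_mu d * ln (real N / d)))"
      by (simp only: sum_distrib_left[symmetric])
  qed simp
  also have "\<dots> = (\<Sum>m=1..N. \<Sum>d | d dvd m. f (d * (m div d)) / (real d * real (m div d))
      * (moebius_mu d * ln (real N / d)))"
    by (intro sum.cong) (auto elim!: dvdE)
  also have "\<dots> = (\<Sum>d=1..N. \<Sum>e=1..N div d. f (d * e) / (real d * real e)
      * (moebius_mu d * ln (real N / d)))"
    by (rule sum_sum_divisors)
  also have "\<dots> = (\<Sum>d=1..N. moebius_mu d * (ln (real N / d) / d) * (\<Sum>e=1..N div d. f (d * e) / e))"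
    unfolding sum_distrib_left by (intro sum.cong refl) (simp add: mult_ac)
  also have "\<bar>\<dots>\<bar> \<le> (\<Sum>d=1..N. ln (real N / d) * (2 * C / N))"
  proof (rule order_trans[OF sum_abs], rule sum_mono)
    fix d assume d: "d \<in> {1..N}"
    then have ln0: "ln (real N / d) \<ge> 0" by simp
    have "\<bar>moebius_mu d * (ln (real N / d) / d) * (\<Sum>e=1..N div d. f (d * e) / e)\<bar>
        \<le> 1 * (ln (real N / d) / d) * (2 * C * real d / real N)"
      unfolding abs_mult using inner[OF d] abs_moebius_mu_le[of d] ln0 d
      by (intro mult_mono) auto
    then show "\<bar>moebius_mu d * (ln (real N / d) / d) * (\<Sum>e=1..N div d. f (d * e) / e)\<bar>
        \<le> ln (real N / d) * (2 * C / N)"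
      using d by simp
  qed
  also have "\<dots> \<le> N * (2 * C / N)"
    unfolding sum_distrib_right[symmetric]
    using sum_ln_div_le[OF N] C0 by (intro mult_right_mono) auto
  also have "\<dots> = 2 * C" using N by simp
  finally show "\<bar>f 1 * ln (real N) + (\<Sum>m=1..N. f m * mangoldt m / real m)\<bar> \<le>
      2 * (n * (\<Sum>k<n. \<bar>f k\<bar>))"
    unfolding C_def .
qed

text \<open>Dirichlet's test again; \<open>ln m / m\<close> decreases only from \<open>exp 1\<close>
  on, hence the split at 3.\<close>

lemma sum_mult_ln_over_bounded:
  fixes f :: "nat \<Rightarrow> real"
  assumes C: "\<And>N. \<bar>\<Sum>k<N. f k\<bar> \<le> C"
  shows "\<exists>C'. \<forall>N. \<bar>\<Sum>m=1..N. f m * ln (real m) / real m\<bar> \<le> C'"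
proof (intro exI allI)
  fix N
  let ?a = "\<lambda>m. ln (real m) / real m"
  have eq: "(\<Sum>m=1..N. f m * ln (real m) / real m) = (\<Sum>m<Suc N. f m * ?a m)"
    by (subst sum_atLeast1_eq_lessThan) auto
  have C0: "C \<ge> 0" using C[of 0] by simp
  show "\<bar>\<Sum>m=1..N. f m * ln (real m) / real m\<bar> \<le> (\<Sum>m<3. \<bar>f m * ?a m\<bar>) + 2 * C * ?a 3"
  proof (cases "Suc N \<le> 3")
    case True
    have "\<bar>\<Sum>m<Suc N. f m * ?a m\<bar> \<le> (\<Sum>m<Suc N. \<bar>f m * ?a m\<bar>)" by (rule sum_abs)
    also have "\<dots> \<le> (\<Sum>m<3. \<bar>f m * ?a m\<bar>)" using True by (intro sum_mono2) auto
    also have "\<dots> \<le> (\<Sum>m<3. \<bar>f m * ?a m\<bar>) + 2 * C * ?a 3" using C0 by simp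
    finally show ?thesis unfolding eq .
  next
    case False
    then have "(\<Sum>m<Suc N. f m * ?a m) = (\<Sum>m<3. f m * ?a m) + (\<Sum>m=3..<Suc N. f m * ?a m)"
      by (simp only: lessThan_atLeast0) (subst sum.atLeastLessThan_concat, auto)
    moreover have "\<bar>\<Sum>m=3..<Suc N. f m * ?a m\<bar> \<le> 2 * C * ?a 3"
    proof (rule abs_sum_mult_decreasing_le[where a = ?a, OF C])
      fix m :: nat assume "3 \<le> m"
      moreover have "exp 1 \<le> (3 :: real)" by (rule exp_le)
      ultimately show "?a (Suc m) \<le> ?a m" by (intro ln_x_over_x_mono) auto
    qed (use False in auto)
    moreover have "\<bar>\<Sum>m<3. f m * ?a m\<bar> \<le> (\<Sum>m<3. \<bar>f m * ?a m\<bar>)" by (rule sum_abs)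
    ultimately show ?thesis unfolding eq by linarith
  qed
qed

text \<open>Here the series need not vanish: \<open>g d\<close> plays the part of
  \<open>\<chi>(d) L(1, \<chi>)\<close>. Writing \<open>ln m\<close> as a divisor sum of
  \<open>mangoldt\<close> compares the sum with that of \<open>f m ln m / m\<close>, which is
  bounded; the errors \<open>O(d / N)\<close>, weighted by \<open>mangoldt d / d\<close>, are
  absorbed by Chebyshev's bound.\<close>

lemma sum_dirichlet_one_mangoldt_bounded:
  assumes f: "unit_periodic n f" and n: "n > 0" and zero: "(\<Sum>m<n. f m) = 0"
  defines "g \<equiv> \<lambda>d. if coprime d n then dirichlet_one (\<lambda>m. f (d * m)) else 0"
  shows "\<exists>C. \<forall>N\<ge>1. \<bar>\<Sum>d=1..N. g d * mangoldt d / real d\<bar> \<le> C"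
proof -
  define C where "C = n * (\<Sum>k<n. \<bar>f k\<bar>)"
  have C0: "C \<ge> 0" unfolding C_def by (intro mult_nonneg_nonneg sum_nonneg) auto
  have ps: "\<bar>\<Sum>k<N. f (d * k)\<bar> \<le> C" if "coprime d n" for N d
    unfolding C_def by (rule unit_periodic_partial_sums[OF f n zero that])
  obtain C' where C': "\<And>N. \<bar>\<Sum>m=1..N. f m * ln (real m) / real m\<bar> \<le> C'"
    using sum_mult_ln_over_bounded[of f C] ps[of 1] by auto
  show ?thesis
  proof (intro exI allI impI)
    fix N :: nat assume N: "N \<ge> 1"
    have inner: "\<bar>(\<Sum>e=1..N div d. f (d * e) / real e) - g d\<bar> \<le> 2 * C * real d / real N"
      if d: "d \<in> {1..N}" for d
    proof (cases "coprime d n")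
      case True
      from dirichlet_one_partial_sum[where f = "\<lambda>m. f (d * m)", OF ps[OF True], of d N]
      show ?thesis using True d by (simp add: g_def)
    next
      case False
      then have "f (d * e) = 0" for e by (intro unit_periodicD(2)[OF f]) simp
      then show ?thesis using C0 False by (simp add: g_def)
    qed
    have "(\<Sum>m=1..N. f m * ln (real m) / real m) =
        (\<Sum>m=1..N. \<Sum>d | d dvd m. f m / m * mangoldt d)"
    proof (rule sum.cong)
      fix m assume m: "m \<in> {1..N}"
      then have "(\<Sum>d | d dvd m. mangoldt d) = ln (real m)"
        using mangoldt_sum[of m, where 'a = real] by simp
      then show "f m * ln (real m) / real m = (\<Sum>d | d dvd m. f m / m * mangoldt d)"
        by (simp only: sum_distrib_left[symmetric]) simp
    qed simp
    also have "\<dots> = (\<Sum>m=1..N. \<Sum>d | d dvd m. f (d * (m div d)) / (real d * real (m div d)) * mangoldt d)"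
      by (intro sum.cong) (auto elim!: dvdE)
    also have "\<dots> = (\<Sum>d=1..N. \<Sum>e=1..N div d. f (d * e) / (real d * real e) * mangoldt d)"
      by (rule sum_sum_divisors)
    also have "\<dots> = (\<Sum>d=1..N. mangoldt d / d * (\<Sum>e=1..N div d. f (d * e) / e))"
      unfolding sum_distrib_left by (intro sum.cong refl) (simp add: mult_ac)
    finally have eq: "(\<Sum>m=1..N. f m * ln (real m) / real m) =
      (\<Sum>d=1..N. mangoldt d / d * (\<Sum>e=1..N div d. f (d * e) / e))" .
    have "\<bar>(\<Sum>m=1..N. f m * ln (real m) / real m) - (\<Sum>d=1..N. g d * mangoldt d / real d)\<bar> =
        \<bar>\<Sum>d=1..N. mangoldt d / d * ((\<Sum>e=1..N div d. f (d * e) / e) - g d)\<bar>"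
      unfolding eq sum_subtractf[symmetric] by (simp add: algebra_simps)
    also have "\<dots> \<le> (\<Sum>d=1..N. mangoldt d * (2 * C / N))"
    proof (rule order_trans[OF sum_abs], rule sum_mono)
      fix d assume d: "d \<in> {1..N}"
      have "\<bar>mangoldt d / d * ((\<Sum>e=1..N div d. f (d * e) / e) - g d)\<bar> \<le>
          mangoldt d / d * (2 * C * real d / real N)"
        unfolding abs_mult using inner[OF d] by (intro mult_mono) (auto simp: mangoldt_nonneg)
      then show "\<bar>mangoldt d / d * ((\<Sum>e=1..N div d. f (d * e) / e) - g d)\<bar> \<le>
          mangoldt d * (2 * C / N)" using d by simp
    qed
    also have "\<dots> \<le> (4 * N) * (2 * C / N)"
      unfolding sum_distrib_right[symmetric]
      using sum_mangoldt_le[of N] C0 by (intro mult_right_mono) auto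
    also have "\<dots> = 8 * C" using N by simp
    finally show "\<bar>\<Sum>d=1..N. g d * mangoldt d / real d\<bar> \<le> 8 * C + C'"
      using C'[of N] by linarith
  qed
qed

section \<open>Reduction to real characters\<close>

abbreviation mangoldt_sum_upto :: "(nat \<Rightarrow> real) \<Rightarrow> nat \<Rightarrow> real" where
  "mangoldt_sum_upto f N \<equiv> (\<Sum>m=1..N. f m * mangoldt m / real m)"

lemma ln_bounded_imp_eq_0:
  assumes "a \<ge> 0" and "\<And>N::nat. N \<ge> 1 \<Longrightarrow> a * ln (real N) \<le> b"
  shows "a = (0::real)"
proof (rule ccontr)
  assume "a \<noteq> 0"
  then have a: "a > 0" using assms(1) by simp
  obtain N :: nat where N: "real N > exp (b / a)" using reals_Archimedean2 by blast
  then have N1: "N \<ge> 1" by (metis One_nat_def Suc_leI exp_gt_zero not_gr_zero of_nat_0 order_less_asym)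
  have "b / a < ln (real N)" using N N1 by (metis exp_less_cancel_iff exp_ln of_nat_0_less_iff less_eq_Suc_le One_nat_def)
  then have "b < a * ln (real N)" using a by (simp add: field_simps)
  then show False using assms(2)[OF N1] by simp
qed

text \<open>The autocorrelation \<open>R\<close> of \<open>H\<close> satisfies
  \<open>R 1 ln N + \<Sum> R(m) \<Lambda>(m)/m = O(1)\<close>, and \<open>\<bar>R\<bar> \<le> R 1\<close>; so up to \<open>O(1)\<close> all of the mass
  \<open>\<Lambda>(m)/m\<close> sits on the residues \<open>m\<close> with \<open>H(tm) = -H(t)\<close>, and every mean-zero function invariant
  under these vanishes. This applies to \<open>t \<mapsto> H(t) H(ts)\<close> minus its mean.\<close>

lemma dirichlet_one_eq_0_imp_character:
  assumes H: "unit_periodic n H" and n: "n > 0" and zero: "(\<Sum>m<n. H m) = 0"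
    and L: "\<And>t. coprime t n \<Longrightarrow> dirichlet_one (\<lambda>m. H (t * m)) = 0"
    and nz: "H a \<noteq> 0"
  shows "H 1 \<noteq> 0" and "coprime s n \<Longrightarrow> coprime t n \<Longrightarrow> H 1 * H (s * t) = H s * H t"
    and "coprime t n \<Longrightarrow> H t ^ 2 = H 1 ^ 2"
proof -
  let ?S = mangoldt_sum_upto
  define One :: "nat \<Rightarrow> real" where "One m = (if coprime m n then 1 else 0)" for m
  define R where "R b = (\<Sum>t<n. H t * H (t * b))" for b
  \<comment> \<open>At a unit \<open>m\<close>, \<open>D m\<close> is the squared distance of
    \<open>t -> H (t * m)\<close> from \<open>- H\<close>; expanding the square gives
    \<open>2 R 1 + 2 R m\<close>. \<open>P\<close> collects the units that act on \<open>H\<close>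
    as \<open>-1\<close>, and \<open>T N\<close> is their share of the mass
    \<open>mangoldt m / m\<close>.\<close>
  define D where "D m = (if coprime m n then (\<Sum>t<n. (H t + H (t * m))\<^sup>2) else 0)" for m
  define P where "P m \<longleftrightarrow> coprime m n \<and> D m = 0" for m
  define T where "T = ?S (\<lambda>m. if P m then 1 else 0)"
  have ps: "\<bar>\<Sum>k<N. f (t * k)\<bar> \<le> n * (\<Sum>k<n. \<bar>f k\<bar>)"
    if "unit_periodic n f" "(\<Sum>m<n. f m) = 0" "coprime t n" for f :: "nat \<Rightarrow> real" and t N
    by (rule unit_periodic_partial_sums[OF that(1) n that(2,3)])
  have sumS: "?S (\<lambda>m. f m + c * g m) N = ?S f N + c * ?S g N" for f g :: "nat \<Rightarrow> real" and c N
    by (simp add: distrib_right add_divide_distrib sum.distrib sum_distrib_left mult.assoc)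
  have cop_add: "coprime (m + n) n \<longleftrightarrow> coprime m n" for m
    by (simp only: coprime_iff_gcd_eq_1 gcd_add1)
  have Hadd: "H (t * (m + n)) = H (t * m)" for t m
    using unit_periodicD(3)[OF H, of "t * (m + n)"] unit_periodicD(3)[OF H, of "t * m"]
    by (simp add: distrib_left)
  have H0: "H (t * m) = 0" if "\<not> coprime t n \<or> \<not> coprime m n" for t m
    using that by (intro unit_periodicD(2)[OF H]) auto

  have R1: "R 1 > 0"
  proof -
    have "R 1 = (\<Sum>t<n. (H t)\<^sup>2)" by (simp add: R_def power2_eq_square)
    moreover have "(\<Sum>t<n. (H t)\<^sup>2) > 0"
    proof (rule sum_pos2[of _ "a mod n"])
      show "0 < (H (a mod n))\<^sup>2" using nz unit_periodicD(3)[OF H, of a] by simp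
    qed (use n in auto)
    ultimately show ?thesis by simp
  qed
  have R: "unit_periodic n R"
    using Hadd H0 by (auto simp: unit_periodic_def R_def intro!: sum.neutral)
  have sumH: "H t * (\<Sum>b<n. H (t * b)) = 0" for t
  proof (cases "coprime t n")
    case True
    then show ?thesis using sum_periodic_scale[of H n t] unit_periodicD(1)[OF H] n zero by simp
  qed (use unit_periodicD(2)[OF H] in simp)
  have Rzero: "(\<Sum>m<n. R m) = 0"
    unfolding R_def by (subst sum.swap) (simp add: sum_distrib_left[symmetric] sumH)
  have RL: "dirichlet_one (\<lambda>m. R (s * m)) = 0" if s: "coprime s n" for s
  proof -
    have sums0: "(\<lambda>m. H t * H (t * (s * m)) / real m) sums 0" for t
    proof (cases "coprime t n")
      case True
      then have ts: "coprime (t * s) n" using s by simp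
      have "summable (\<lambda>m. H (t * s * m) / real m)"
        by (rule summable_dirichlet_one[where f = "\<lambda>m. H (t * s * m)", OF ps[OF H zero ts]])
      then have "(\<lambda>m. H (t * s * m) / real m) sums 0"
        using L[OF ts] by (simp add: dirichlet_one_def sums_iff)
      then have "(\<lambda>m. H t * (H (t * s * m) / real m)) sums (H t * 0)" by (rule sums_mult)
      then show ?thesis by (simp add: mult.assoc)
    qed (use unit_periodicD(2)[OF H] in simp)
    have "(\<lambda>m. \<Sum>t<n. H t * H (t * (s * m)) / real m) sums (\<Sum>t<n. 0)"
      by (rule sums_sum) (rule sums0)
    then show ?thesis
      by (simp add: dirichlet_one_def R_def sum_divide_distrib sums_iff)
  qed
  obtain C1 where C1: "\<And>N. N \<ge> 1 \<Longrightarrow> \<bar>R 1 * ln (real N) + ?S R N\<bar> \<le> C1"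
    using sum_mangoldt_of_dirichlet_one_eq_0[OF R n Rzero RL] by blast

  have D_eq: "D m = 2 * R 1 * One m + 2 * R m" for m
  proof (cases "coprime m n")
    case True
    have "(\<Sum>t<n. (H (t * m))\<^sup>2) = (\<Sum>t<n. (H t)\<^sup>2)"
      using sum_periodic_scale[of "\<lambda>x. (H x)\<^sup>2" n m] unit_periodicD(1)[OF H] n True
      by (simp add: mult.commute)
    moreover have "D m = (\<Sum>t<n. (H t)\<^sup>2) + (\<Sum>t<n. (H (t * m))\<^sup>2) + 2 * R m"
      using True by (simp add: D_def R_def power2_sum sum.distrib sum_distrib_left mult.assoc)
    ultimately show ?thesis using True by (simp add: One_def R_def power2_eq_square)
  qed (use unit_periodicD(2)[OF R] in \<open>simp add: D_def One_def\<close>)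
  have D0: "D m \<ge> 0" for m by (simp add: D_def sum_nonneg)
  have Dper: "D (m mod n) = D m" for m
    by (rule periodic_mod) (auto simp: D_def Hadd cop_add)
  have S_One: "?S One N \<le> ln N + 4" if N: "N \<ge> 1" for N
  proof -
    have "?S One N \<le> (\<Sum>m=1..N. mangoldt m / m)"
      by (intro sum_mono divide_right_mono) (auto simp: One_def mangoldt_nonneg)
    then show ?thesis using sum_mangoldt_over_le[OF N] by simp
  qed
  \<comment> \<open>The terms \<open>2 R 1 ln N\<close>, one from Mertens' bound and one from
    \<open>C1\<close>, cancel.\<close>
  have S_D: "?S D N \<le> 8 * R 1 + 2 * C1" if N: "N \<ge> 1" for N
  proof -
    have "?S D N = 2 * R 1 * ?S One N + 2 * ?S R N"
      using sumS[of "\<lambda>m. 2 * R 1 * One m" 2 R N] sumS[of "\<lambda>_. 0" "2 * R 1" One N]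
      by (simp add: D_eq)
    moreover have "2 * R 1 * ?S One N \<le> 2 * R 1 * (ln N + 4)"
      using S_One[OF N] R1 by (intro mult_left_mono) auto
    ultimately show ?thesis using C1[OF N] by (simp add: algebra_simps)
  qed

  have bounded: "\<exists>C. \<forall>N\<ge>1. \<bar>?S F N\<bar> \<le> C"
    if F: "unit_periodic n F" and FP: "\<And>m. P m \<Longrightarrow> F m = 0" for F
  proof (intro exI allI impI)
    fix N :: nat assume N: "N \<ge> 1"
    \<comment> \<open>Where \<open>D k = 0\<close>, also \<open>F k = 0\<close>, so the summand
      \<open>0 / 0 = 0\<close> does no harm; elsewhere \<open>c\<close> dominates
      \<open>\<bar>F k\<bar> / D k\<close>.\<close>
    define c where "c = (\<Sum>k<n. \<bar>F k\<bar> / D k)"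
    have c0: "c \<ge> 0" unfolding c_def using D0 by (intro sum_nonneg) simp
    have le: "\<bar>F m\<bar> \<le> c * D m" for m
    proof (cases "D (m mod n) = 0")
      case True
      then have "F m = 0" using FP[of m] unit_periodicD(2)[OF F, of m] Dper[of m]
        by (auto simp: P_def)
      then show ?thesis using c0 D0[of m] by simp
    next
      case False
      have "\<bar>F (m mod n)\<bar> / D (m mod n) \<le> c"
        unfolding c_def by (rule member_le_sum) (use n D0 in auto)
      then have "\<bar>F (m mod n)\<bar> \<le> c * D (m mod n)"
        using False D0[of "m mod n"] by (simp add: divide_le_eq)
      then show ?thesis using Dper[of m] unit_periodicD(3)[OF F, of m] by simp
    qed
    have "\<bar>?S F N\<bar> \<le> (\<Sum>m=1..N. (c * D m) * mangoldt m / m)"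
      by (rule order_trans[OF sum_abs], rule sum_mono)
         (use le in \<open>auto simp: abs_mult mangoldt_nonneg intro!: divide_right_mono mult_right_mono\<close>)
    also have "\<dots> = c * ?S D N" by (simp add: sum_distrib_left mult.assoc)
    also have "\<dots> \<le> c * (8 * R 1 + 2 * C1)" using S_D[OF N] c0 by (rule mult_left_mono)
    finally show "\<bar>?S F N\<bar> \<le> c * (8 * R 1 + 2 * C1)" .
  qed
  have Pper: "P (m + n) \<longleftrightarrow> P m" for m
    using Dper[of m] Dper[of "m + n"] by (simp add: P_def cop_add)
  \<comment> \<open>Subtracting a multiple of the indicator of \<open>P\<close> reduces this to
    \<open>bounded\<close>. The sign \<open>c\<close> is \<open>-1\<close> for \<open>R\<close> and
    \<open>1\<close> for functions invariant under \<open>P\<close>.\<close>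
  have concentrated: "\<exists>C. \<forall>N\<ge>1. \<bar>?S F N - F 1 * c * T N\<bar> \<le> C"
    if F: "unit_periodic n F" and FP: "\<And>m. P m \<Longrightarrow> F m = F 1 * c" for F c
  proof -
    have "unit_periodic n (\<lambda>m. F m + (- (F 1 * c)) * (if P m then 1 else 0))"
      using F Pper by (auto simp: unit_periodic_def P_def)
    from bounded[OF this] obtain C where C: "\<And>N. N \<ge> 1 \<Longrightarrow>
        \<bar>?S (\<lambda>m. F m + (- (F 1 * c)) * (if P m then 1 else 0)) N\<bar> \<le> C"
      using FP by auto
    show ?thesis
    proof (intro exI allI impI)
      fix N :: nat assume "N \<ge> 1"
      from C[OF this] show "\<bar>?S F N - F 1 * c * T N\<bar> \<le> C"
        unfolding sumS T_def by simp
    qed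
  qed
  have T0: "T N \<ge> 0" for N
    unfolding T_def by (intro sum_nonneg) (auto simp: mangoldt_nonneg)
  have RP: "R m = R 1 * (- 1)" if "P m" for m
  proof -
    have "coprime m n" "D m = 0" using that by (simp_all add: P_def)
    then have "0 = 2 * R 1 + 2 * R m" using D_eq[of m] by (simp add: One_def)
    then show ?thesis by linarith
  qed
  obtain C2 where C2: "\<And>N. N \<ge> 1 \<Longrightarrow> \<bar>?S R N - R 1 * (- 1) * T N\<bar> \<le> C2"
    using concentrated[OF R RP] by blast
  \<comment> \<open>\<open>T N\<close> is at least \<open>ln N\<close> up to a constant, hence
    unbounded.\<close>
  have T_ge: "R 1 * ln (real N) \<le> R 1 * T N + (C1 + C2)" if "N \<ge> 1" for N
    using C1[OF that] C2[OF that] by linarith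

  have HP: "H (t * m) = - H t" if m: "P m" for t m
  proof -
    have "(\<Sum>t<n. (H t + H (t * m))\<^sup>2) = 0" using m by (auto simp: P_def D_def)
    then have "\<forall>t\<in>{..<n}. (H t + H (t * m))\<^sup>2 = 0" by (subst (asm) sum_nonneg_eq_0_iff) auto
    then have "(H (t mod n) + H (t mod n * m))\<^sup>2 = 0" using n by simp
    moreover have "H (t mod n * m) = H (t * m)"
      using unit_periodicD(3)[OF H, of "t mod n * m"] unit_periodicD(3)[OF H, of "t * m"]
      by (simp add: mod_mult_left_eq)
    ultimately show ?thesis using unit_periodicD(3)[OF H, of t] by (simp add: eq_neg_iff_add_eq_0 add.commute)
  qed

  define Pinv where "Pinv G \<longleftrightarrow> unit_periodic n G \<and> (\<Sum>m<n. G m) = 0 \<and>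
    (\<forall>t m. P m \<longrightarrow> G (t * m) = G t)" for G
  have inv_scale: "Pinv (\<lambda>m. G (t * m))" if G: "Pinv G" and t: "coprime t n" for G t
    using G t unit_periodic_scale[of n G t] sum_periodic_scale[of G n t] n
      unit_periodicD(1)[of n G] by (auto simp: Pinv_def mult.assoc[symmetric])
  \<comment> \<open>On \<open>P\<close> the function \<open>g\<close> is constantly
    \<open>g 1\<close>, so its bounded Mangoldt sum is \<open>g 1 * T N + O(1)\<close>; as
    \<open>T N\<close> is unbounded, \<open>g 1 = 0\<close>.\<close>
  have inv_L: "dirichlet_one G = 0" if G: "Pinv G" for G
  proof -
    define g where "g d = (if coprime d n then dirichlet_one (\<lambda>m. G (d * m)) else 0)" for d
    from G have G': "unit_periodic n G" "(\<Sum>m<n. G m) = 0" by (auto simp: Pinv_def)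
    obtain C3 where C3: "\<And>N. N \<ge> 1 \<Longrightarrow> \<bar>?S g N\<bar> \<le> C3"
      using sum_dirichlet_one_mangoldt_bounded[OF G'(1) n G'(2)] unfolding g_def by blast
    have "G ((m + n) * k) = G (m * k)" for m k
      using unit_periodicD(3)[OF G'(1), of "(m + n) * k"] unit_periodicD(3)[OF G'(1), of "m * k"]
      by (simp add: distrib_right)
    then have gper: "unit_periodic n g" by (simp add: unit_periodic_def g_def cop_add)
    have "g m = g 1 * 1" if m: "P m" for m
    proof -
      have "G (m * k) = G k" for k using G m by (simp add: Pinv_def mult.commute)
      then show ?thesis using m by (simp add: g_def P_def)
    qed
    from concentrated[OF gper this] obtain C4 where
      C4: "\<And>N. N \<ge> 1 \<Longrightarrow> \<bar>?S g N - g 1 * 1 * T N\<bar> \<le> C4" by blast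
    have "\<bar>g 1\<bar> * R 1 = 0"
    proof (rule ln_bounded_imp_eq_0[where b = "R 1 * (C3 + C4) + \<bar>g 1\<bar> * (C1 + C2)"])
      fix N :: nat assume N: "N \<ge> 1"
      have "\<bar>g 1\<bar> * T N = \<bar>g 1 * T N\<bar>" using T0[of N] by (simp add: abs_mult)
      also have "\<dots> \<le> C3 + C4" using C3[OF N] C4[OF N] by linarith
      finally have "R 1 * (\<bar>g 1\<bar> * T N) \<le> R 1 * (C3 + C4)" using R1 by simp
      moreover have "\<bar>g 1\<bar> * (R 1 * ln (real N)) \<le> \<bar>g 1\<bar> * (R 1 * T N + (C1 + C2))"
        using T_ge[OF N] by (intro mult_left_mono) auto
      ultimately show "\<bar>g 1\<bar> * R 1 * ln (real N) \<le> R 1 * (C3 + C4) + \<bar>g 1\<bar> * (C1 + C2)"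
        by (simp add: algebra_simps)
    qed (use R1 in simp)
    then show ?thesis using R1 by (simp add: g_def)
  qed
  \<comment> \<open>Now all scalings of \<open>G\<close> have series 0, and the estimate for such
    functions reads \<open>G 1 * (ln N + T N) = O(1)\<close>. Here the two terms reinforce each
    other, whereas for \<open>R\<close> they have opposite signs.\<close>
  have inv_1: "G 1 = 0" if G: "Pinv G" for G
  proof -
    from G have G': "unit_periodic n G" "(\<Sum>m<n. G m) = 0" by (auto simp: Pinv_def)
    obtain C3 where C3: "\<And>N. N \<ge> 1 \<Longrightarrow> \<bar>G 1 * ln (real N) + ?S G N\<bar> \<le> C3"
      using sum_mangoldt_of_dirichlet_one_eq_0[OF G'(1) n G'(2)] inv_L[OF inv_scale[OF G]] by blast
    have "G m = G 1 * 1" if "P m" for m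
      using G that mult_1[of m] unfolding Pinv_def by (metis mult_1_right)
    from concentrated[OF G'(1) this] obtain C4 where
      C4: "\<And>N. N \<ge> 1 \<Longrightarrow> \<bar>?S G N - G 1 * 1 * T N\<bar> \<le> C4" by blast
    have "\<bar>G 1\<bar> = 0"
    proof (rule ln_bounded_imp_eq_0[where b = "C3 + C4"])
      fix N :: nat assume N: "N \<ge> 1"
      have "\<bar>G 1\<bar> * ln (real N) \<le> \<bar>G 1\<bar> * (ln (real N) + T N)"
        using T0[of N] by (intro mult_left_mono) auto
      also have "\<dots> = \<bar>G 1 * ln (real N) + G 1 * T N\<bar>"
        using T0[of N] N by (simp add: abs_mult distrib_left[symmetric])
      also have "\<dots> \<le> C3 + C4" using C3[OF N] C4[OF N] by linarith
      finally show "\<bar>G 1\<bar> * ln (real N) \<le> C3 + C4" .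
    qed simp
    then show ?thesis by simp
  qed
  have inv_0: "G t = 0" if "Pinv G" "coprime t n" for G t
    using inv_1[OF inv_scale[OF that]] by simp

  have correl: "H t * H (t * s) = H 1 * H s" if s: "coprime s n" and t: "coprime t n" for s t
  proof -
    \<comment> \<open>\<open>c\<close> is the mean over the units. Multiplying \<open>t\<close> by
      an element of \<open>P\<close> changes the sign of both \<open>H t\<close> and
      \<open>H (t * s)\<close>, so the product minus its mean satisfies \<open>Pinv\<close>.\<close>
    define c where "c = (\<Sum>t<n. H t * H (t * s)) / (\<Sum>t<n. One t)"
    define G where "G t = H t * H (t * s) - c * One t" for t
    \<comment> \<open>The witness \<open>1 mod n\<close> also serves \<open>n = 1\<close>, where 0
      is the only residue and a unit.\<close>
    have "(\<Sum>t<n. One t) > 0"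
      by (rule sum_pos2[of _ "1 mod n"]) (use n in \<open>auto simp: One_def coprime_commute coprime_mod_right_iff\<close>)
    moreover have "(\<Sum>t<n. G t) = (\<Sum>t<n. H t * H (t * s)) - c * (\<Sum>t<n. One t)"
      by (simp add: G_def sum_subtractf sum_distrib_left)
    ultimately have "(\<Sum>t<n. G t) = 0" by (simp add: c_def)
    moreover have "unit_periodic n G"
      using unit_periodicD(1)[OF unit_periodic_scale[OF H s]] unit_periodicD(1)[OF H] H0
      by (auto simp: unit_periodic_def G_def One_def cop_add mult.commute)
    moreover have "G (t * m) = G t" if m: "P m" for t m
    proof -
      have "H (t * m * s) = - H (t * s)" using HP[OF m, of "t * s"] by (simp add: mult_ac)
      moreover have "One (t * m) = One t" using m by (simp add: One_def P_def)
      ultimately show ?thesis using HP[OF m, of t] by (simp add: G_def)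
    qed
    ultimately have "Pinv G" by (simp add: Pinv_def)
    then have "G t = 0" "G 1 = 0" using inv_0 t by auto
    then show ?thesis using t by (simp add: G_def One_def)
  qed
  have sq: "H t ^ 2 = H 1 ^ 2" if "coprime t n" for t
    using correl[of 1 t] that by (simp add: power2_eq_square)
  show H1: "H 1 \<noteq> 0"
  proof
    assume "H 1 = 0"
    then have "H a = 0" using sq[of a] unit_periodicD(2)[OF H, of a] by (cases "coprime a n") auto
    then show False using nz by simp
  qed
  show "coprime t n \<Longrightarrow> H t ^ 2 = H 1 ^ 2" by (rule sq)
  show "H 1 * H (s * t) = H s * H t" if "coprime s n" "coprime t n"
  proof -
    have "H 1 * (H 1 * H (s * t)) = H 1 ^ 2 * H (t * s)"
      by (simp add: power2_eq_square mult.commute)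
    also have "\<dots> = H t * (H t * H (t * s))"
      using sq[OF that(2)] by (simp only: power2_eq_square mult.assoc[symmetric])
    also have "\<dots> = H 1 * (H s * H t)" using correl[OF that] by simp
    finally have "H 1 * (H 1 * H (s * t)) = H 1 * (H s * H t)" .
    then show ?thesis using H1 by simp
  qed
qed

section \<open>Real characters\<close>

lemma power_sum_nonneg:
  fixes x :: real
  assumes x: "x \<in> {-1, 0, 1}"
  shows "0 \<le> (\<Sum>i\<le>k. x ^ i)" and "even k \<Longrightarrow> 1 \<le> (\<Sum>i\<le>k. x ^ i)"
proof -
  have "(\<Sum>i\<le>k. (- 1 :: real) ^ i) = (if even k then 1 else 0)" by (induction k) auto
  moreover have "(\<Sum>i\<le>k. (0 :: real) ^ i) = 1" by (induction k) auto
  ultimately show "0 \<le> (\<Sum>i\<le>k. x ^ i)" "even k \<Longrightarrow> 1 \<le> (\<Sum>i\<le>k. x ^ i)"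
    using x by auto
qed

text \<open>The divisors of \<open>p ^ Suc k * m\<close> that do not divide \<open>p ^ k * m\<close>
  are the \<open>p ^ Suc k * d\<close> with \<open>d dvd m\<close>.\<close>

lemma sum_divisors_prime_power_mult:
  fixes \<chi> :: "nat \<Rightarrow> real"
  assumes mult: "\<And>s t. \<chi> (s * t) = \<chi> s * \<chi> t" and one: "\<chi> 1 = 1"
    and p: "prime p" and np: "\<not> p dvd m" and m: "m > 0"
  shows "(\<Sum>d | d dvd p ^ k * m. \<chi> d) = (\<Sum>i\<le>k. \<chi> p ^ i) * (\<Sum>d | d dvd m. \<chi> d)"
proof (induction k)
  case (Suc k)
  have pow: "\<chi> (p ^ i) = \<chi> p ^ i" for i by (induction i) (simp_all add: mult one[simplified])
  let ?A = "{d. d dvd p ^ k * m}" and ?B = "(\<lambda>d. p ^ Suc k * d) ` {d. d dvd m}"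
  have fin: "finite {d. d dvd m}" "finite ?A" using m p by (auto simp: prime_gt_0_nat)
  have "{d. d dvd p ^ Suc k * m} = ?A \<union> ?B"
  proof (intro equalityI subsetI)
    fix d assume "d \<in> {d. d dvd p ^ Suc k * m}"
    then have d: "d dvd p ^ Suc k * m" by simp
    show "d \<in> ?A \<union> ?B"
    proof (cases "p ^ Suc k dvd d")
      case True
      then obtain e where e: "d = p ^ Suc k * e" by blast
      then have "e dvd m" using d p by (simp add: prime_gt_0_nat)
      then show ?thesis using e by blast
    next
      case False
      from d obtain a b where ab: "d = a * b" "a dvd p ^ Suc k" "b dvd m"
        using division_decomp by blast
      from ab(2) p obtain i where i: "i \<le> Suc k" "a = p ^ i"
        using divides_primepow_nat by blast
      have "i \<noteq> Suc k" using False ab i by auto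
      then have "a dvd p ^ k" using i by (simp add: le_imp_power_dvd)
      then show ?thesis using ab by (auto intro: mult_dvd_mono)
    qed
  next
    fix d assume "d \<in> ?A \<union> ?B"
    then show "d \<in> {d. d dvd p ^ Suc k * m}"
      by (auto intro: dvd_trans[of d "p ^ k * m"])
  qed
  moreover have "?A \<inter> ?B = {}"
  proof -
    have "\<not> p ^ Suc k * d dvd p ^ k * m" for d
    proof
      assume "p ^ Suc k * d dvd p ^ k * m"
      then have "p ^ k * p dvd p ^ k * m" by (metis dvd_mult_left power_Suc2)
      then show False using np p by (simp add: prime_gt_0_nat)
    qed
    then show ?thesis by auto
  qed
  ultimately have "(\<Sum>d | d dvd p ^ Suc k * m. \<chi> d) = (\<Sum>d\<in>?A. \<chi> d) + (\<Sum>d\<in>?B. \<chi> d)"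
    using fin by (simp add: sum.union_disjoint)
  also have "(\<Sum>d\<in>?B. \<chi> d) = \<chi> p ^ Suc k * (\<Sum>d | d dvd m. \<chi> d)"
    using p by (subst sum.reindex)
      (auto simp: inj_on_def prime_gt_0_nat mult pow sum_distrib_left simp del: power_Suc)
  finally show ?case using Suc by (simp add: distrib_right)
qed simp

lemma prime_power_split:
  fixes j :: nat
  assumes "j > 1"
  obtains p k m where "prime p" "j = p ^ k * m" "\<not> p dvd m" "0 < m" "m < j"
proof -
  obtain p where p: "prime p" "p dvd j" using assms prime_factor_nat[of j] by auto
  obtain m where m: "j = p ^ multiplicity p j * m" "\<not> p dvd m"
    using multiplicity_decompose'[of j p] assms prime_gt_1_nat[OF p(1)] by auto
  moreover have "m > 0" using m assms by (cases "m = 0") auto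
  moreover have "m < j"
  proof -
    have "multiplicity p j \<noteq> 0" using m p by (metis mult_1 power_0)
    then have "p ^ multiplicity p j > 1" using prime_gt_1_nat[OF p(1)] by (intro one_less_power) auto
    then show ?thesis using m(1) \<open>m > 0\<close> by (metis mult_strict_right_mono nat_mult_1)
  qed
  ultimately show ?thesis using that p by blast
qed

text \<open>Both sums are products over primes of factors
  \<open>1 + \<chi> p + ... + \<chi> p ^ k\<close>. Such a factor is nonnegative, and at least 1 for
  even \<open>k\<close>, the only exponents in a square.\<close>

lemma sum_divisors_real_character:
  fixes \<chi> :: "nat \<Rightarrow> real"
  assumes mult: "\<And>s t. \<chi> (s * t) = \<chi> s * \<chi> t" and one: "\<chi> 1 = 1"
    and val: "\<And>m. \<chi> m \<in> {-1, 0, 1}" and j: "j > 0"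
  shows "0 \<le> (\<Sum>d | d dvd j. \<chi> d)" and "1 \<le> (\<Sum>d | d dvd j\<^sup>2. \<chi> d)"
proof -
  show "0 \<le> (\<Sum>d | d dvd j. \<chi> d)"
    using j
  proof (induction j rule: less_induct)
    case (less j)
    show ?case
    proof (cases "j = 1")
      case False
      then have "j > 1" using less.prems by simp
      then obtain p k m where "prime p" "j = p ^ k * m" "\<not> p dvd m" "0 < m" "m < j"
        by (rule prime_power_split)
      then show ?thesis
        using sum_divisors_prime_power_mult[OF mult one, of p m k] power_sum_nonneg(1)[OF val]
          less.IH[of m] by simp
    qed (use one in simp)
  qed
  show "1 \<le> (\<Sum>d | d dvd j\<^sup>2. \<chi> d)"
    using j
  proof (induction j rule: less_induct)
    case (less j)
    show ?case
    proof (cases "j = 1")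
      case False
      then have "j > 1" using less.prems by simp
      then obtain p k m where *: "prime p" "j = p ^ k * m" "\<not> p dvd m" "0 < m" "m < j"
        by (rule prime_power_split)
      have "j\<^sup>2 = p ^ (2 * k) * m\<^sup>2"
        using *(2) by (simp add: power_mult_distrib power_mult[symmetric] mult.commute)
      moreover have "\<not> p dvd m\<^sup>2" using * prime_dvd_power by blast
      moreover have "1 * 1 \<le> (\<Sum>i\<le>2 * k. \<chi> p ^ i) * (\<Sum>d | d dvd m\<^sup>2. \<chi> d)"
        using * less.IH[of m] power_sum_nonneg[OF val[of p], of "2 * k"] by (intro mult_mono) auto
      ultimately show ?thesis
        using * sum_divisors_prime_power_mult[OF mult one, of p "m\<^sup>2" "2 * k"] by simp
    qed (use one in simp)
  qed
qed

text \<open>The first bound pairs the exponents \<open>i\<close> and \<open>m - 1 - i\<close> and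
  uses the inequality of arithmetic and geometric means; the ratio is a square so that the geometric
  mean is an integral power of \<open>u\<close>.\<close>

lemma geometric_sum_ge:
  fixes u :: real
  assumes u: "0 < u" "u < 1"
  shows "real m * u ^ (m - 1) \<le> (\<Sum>i<m. (u\<^sup>2) ^ i)" and "real m * (u\<^sup>2) ^ m \<le> (\<Sum>i<m. (u\<^sup>2) ^ i)"
proof -
  have rev: "(\<Sum>i<m. (u\<^sup>2) ^ i) = (\<Sum>i<m. (u\<^sup>2) ^ (m - Suc i))"
    by (rule sum.nat_diff_reindex[symmetric])
  have "(\<Sum>i<m. 2 * u ^ (m - 1)) \<le> (\<Sum>i<m. (u\<^sup>2) ^ i + (u\<^sup>2) ^ (m - Suc i))"
  proof (rule sum_mono)
    fix i assume "i \<in> {..<m}"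
    then have i: "i + (m - Suc i) = m - 1" "m > 0" by auto
    have "0 \<le> (u ^ i - u ^ (m - Suc i))\<^sup>2" by simp
    then have "2 * (u ^ i * u ^ (m - Suc i)) \<le> (u ^ i)\<^sup>2 + (u ^ (m - Suc i))\<^sup>2"
      by (simp add: power2_diff algebra_simps)
    also have "u ^ i * u ^ (m - Suc i) = u ^ (m - 1)" using i by (simp add: power_add[symmetric])
    also have "(u ^ i)\<^sup>2 + (u ^ (m - Suc i))\<^sup>2 = (u\<^sup>2) ^ i + (u\<^sup>2) ^ (m - Suc i)"
      by (simp add: power_mult[symmetric] mult.commute)
    finally show "2 * u ^ (m - 1) \<le> (u\<^sup>2) ^ i + (u\<^sup>2) ^ (m - Suc i)" .
  qed
  then show "real m * u ^ (m - 1) \<le> (\<Sum>i<m. (u\<^sup>2) ^ i)"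
    by (simp add: sum.distrib rev[symmetric])
  have "(\<Sum>i<m. (u\<^sup>2) ^ m) \<le> (\<Sum>i<m. (u\<^sup>2) ^ i)"
    using u by (intro sum_mono power_decreasing) (auto simp: power_le_one)
  then show "real m * (u\<^sup>2) ^ m \<le> (\<Sum>i<m. (u\<^sup>2) ^ i)" by simp
qed

text \<open>Let \<open>s m = 1 + t + ... + t ^ (m - 1)\<close>. Then
  \<open>(1 - t) * c m = 1 / m - t ^ m / s m\<close>, and the second fraction drops from
  \<open>m\<close> to \<open>Suc m\<close> by \<open>t ^ m / (s m * s (Suc m))\<close>. By
  \<open>geometric_sum_ge\<close> this is at most \<open>1 / (m * Suc m)\<close>, the drop of the
  first fraction.\<close>

lemma lambert_decreasing:
  fixes u :: real
  assumes u: "0 < u" "u < 1"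
  defines "t \<equiv> u\<^sup>2"
  defines "c \<equiv> \<lambda>m::nat. 1 / (real m * (1 - t)) - t ^ m / (1 - t ^ m)"
  assumes m: "m \<ge> 1"
  shows "c (Suc m) \<le> c m" and "0 \<le> c m"
proof -
  define s where "s m = (\<Sum>i<m. t ^ i)" for m
  have t: "0 < t" "t < 1" using u by (auto simp: t_def power_less_one_iff)
  have one: "1 - t ^ m = (1 - t) * s m" for m
    unfolding s_def using one_diff_power_eq[of t m] by simp
  have s_pos: "s m > 0" if "m \<ge> 1" for m
    unfolding s_def by (rule sum_pos2[of _ 0]) (use that t in auto)
  have s_ge: "real m * u ^ (m - 1) \<le> s m" "real m * t ^ m \<le> s m" for m
    using geometric_sum_ge[OF u, of m] by (simp_all add: s_def t_def)
  have c: "(1 - t) * c m = 1 / m - t ^ m / s m" if "m \<ge> 1" for m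
  proof -
    have "c m = (1 / m - t ^ m / s m) / (1 - t)"
      by (simp only: c_def one diff_divide_distrib divide_divide_eq_left mult.commute[of "1 - t"])
    then show ?thesis using t by simp
  qed
  have "t ^ m / s m \<le> 1 / m"
    using s_ge(2)[of m] s_pos[OF m] m by (simp add: field_simps)
  then have "(1 - t) * c m \<ge> 0" using c[OF m] by simp
  then show "0 \<le> c m" using t by (simp add: zero_le_mult_iff)
  have Suc: "s (Suc m) = 1 + t * s m"
    unfolding s_def by (simp add: sum.lessThan_Suc_shift sum_distrib_left del: sum.lessThan_Suc)
  have "t ^ m / s m - t ^ Suc m / s (Suc m) = t ^ m / (s m * s (Suc m))"
    using s_pos[OF m] s_pos[of "Suc m"] Suc by (simp add: field_simps)
  also have "\<dots> \<le> 1 / (real m * real (Suc m))"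
  proof -
    have "real m * real (Suc m) * t ^ m = (real m * u ^ (m - 1)) * (real (Suc m) * u ^ (Suc m - 1)) * u"
      using m by (cases m) (simp_all add: t_def power2_eq_square power_mult_distrib mult_ac)
    also have "\<dots> \<le> s m * s (Suc m) * 1"
      using s_ge(1)[of m] s_ge(1)[of "Suc m"] u s_pos[OF m] s_pos[of "Suc m"] by (intro mult_mono) auto
    finally show ?thesis
      using m s_pos[OF m] s_pos[of "Suc m"] by (simp add: field_simps del: of_nat_Suc)
  qed
  finally have "t ^ m / s m - t ^ Suc m / s (Suc m) \<le> 1 / m - 1 / Suc m"
    using m by (simp add: field_simps)
  then have "(1 - t) * c (Suc m) \<le> (1 - t) * c m"
    using c[OF m] c[of "Suc m"] by simp
  then show "c (Suc m) \<le> c m" using t by simp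
qed

text \<open>The Lambert series with terms \<open>\<chi> d * t ^ d / (1 - t ^ d)\<close> equals the
  power series with coefficients \<open>r j\<close>, which is at least
  \<open>M * t ^ (M\<^sup>2)\<close> by its terms at squares. If the value at 1 vanished, a multiple
  of that series could be subtracted freely, leaving the coefficients \<open>- c d\<close>; these
  shrink in absolute value from \<open>c 1 = 1\<close>, so the sum would stay below
  \<open>2 C\<close> however close \<open>t\<close> is to 1.\<close>

theorem dirichlet_one_real_character_neq_0:
  fixes \<chi> :: "nat \<Rightarrow> real"
  assumes mult: "\<And>s t. \<chi> (s * t) = \<chi> s * \<chi> t" and one: "\<chi> 1 = 1"
    and val: "\<And>m. \<chi> m \<in> {-1, 0, 1}" and zero: "\<chi> 0 = 0"
    and C: "\<And>N. \<bar>\<Sum>k<N. \<chi> k\<bar> \<le> C"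
  shows "dirichlet_one \<chi> \<noteq> 0"
proof
  assume L: "dirichlet_one \<chi> = 0"
  define r where "r j = (\<Sum>d | d dvd j. \<chi> d)" for j
  have key: "real M * t ^ (M\<^sup>2) \<le> 2 * C" if u: "0 < u" "u < 1" and t_def: "t = u\<^sup>2" for u t :: real and M
  proof -
    have t: "0 < t" "t < 1" using u by (auto simp: t_def power_less_one_iff)
    define c where "c m = 1 / (real m * (1 - t)) - t ^ m / (1 - t ^ m)" for m :: nat
    have upper: "real M * t ^ (M\<^sup>2) \<le> 2 * C + 2 * C / (1 - t) * inverse (real (Suc K)) + t / (1 - t) * (real K * t ^ K)"
      if K: "K \<ge> M\<^sup>2" for K
    proof -
      have "(\<lambda>i. i\<^sup>2) ` {1..M} \<subseteq> {1..K}"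
        using K by (auto simp: Suc_le_eq intro: order_trans[OF power_mono])
      then have "(\<Sum>j\<in>(\<lambda>i. i\<^sup>2) ` {1..M}. t ^ j * r j) \<le> (\<Sum>j=1..K. t ^ j * r j)"
        by (intro sum_mono2)
          (use t sum_divisors_real_character(1)[OF mult one val] in \<open>auto simp: r_def\<close>)
      moreover have "(\<Sum>j\<in>(\<lambda>i. i\<^sup>2) ` {1..M}. t ^ j * r j) = (\<Sum>i=1..M. t ^ i\<^sup>2 * r (i\<^sup>2))"
        by (subst sum.reindex) (auto simp: inj_on_def)
      moreover have "(\<Sum>i=1..M. t ^ M\<^sup>2) \<le> (\<Sum>i=1..M. t ^ i\<^sup>2 * r (i\<^sup>2))"
      proof (rule sum_mono)
        fix i assume i: "i \<in> {1..M}"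
        have "t ^ M\<^sup>2 \<le> t ^ i\<^sup>2" using t i by (intro power_decreasing power_mono) auto
        moreover have "1 \<le> r (i\<^sup>2)"
          unfolding r_def by (rule sum_divisors_real_character(2)[OF mult one val]) (use i in auto)
        ultimately show "t ^ M\<^sup>2 \<le> t ^ i\<^sup>2 * r (i\<^sup>2)"
          using mult_mono[of "t ^ M\<^sup>2" "t ^ i\<^sup>2" 1 "r (i\<^sup>2)"] t by simp
      qed
      ultimately have "real M * t ^ M\<^sup>2 \<le> (\<Sum>j=1..K. t ^ j * r j)" by simp
      also have "\<dots> = (\<Sum>j=1..K. \<Sum>d | d dvd j. \<chi> d * t ^ (d * (j div d)))"
        by (intro sum.cong) (auto simp: r_def sum_distrib_left mult.commute intro!: sum.cong)
      also have "\<dots> = (\<Sum>d=1..K. \<Sum>e=1..K div d. \<chi> d * t ^ (d * e))"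
        by (rule sum_sum_divisors)
      \<comment> \<open>Truncation at \<open>d * e \<le> K\<close> leaves the remainder of each
        geometric series. Its exponent \<open>d * (K div d) + d\<close> exceeds \<open>K\<close>, so
        the total remainder is at most \<open>K * t ^ Suc K / (1 - t)\<close> and tends to
        0.\<close>
      also have "\<dots> = (\<Sum>d=1..K. \<chi> d * (t ^ d / (1 - t ^ d)) - \<chi> d * (t ^ (d * (K div d) + d) / (1 - t ^ d)))"
      proof (rule sum.cong)
        fix d assume d: "d \<in> {1..K}"
        have td: "t ^ d < 1" using t d by (simp add: power_less_one_iff)
        have "(\<Sum>e=1..K div d. t ^ (d * e)) = (\<Sum>e=1..K div d. (t ^ d) ^ e)"
          by (simp add: power_mult)
        also have "\<dots> = (t ^ d - (t ^ d) ^ Suc (K div d)) / (1 - t ^ d)"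
          using td by (simp add: sum_gp)
        also have "\<dots> = t ^ d / (1 - t ^ d) - t ^ (d * (K div d) + d) / (1 - t ^ d)"
          by (simp add: diff_divide_distrib power_add power_mult mult.commute)
        finally show "(\<Sum>e=1..K div d. \<chi> d * t ^ (d * e)) =
            \<chi> d * (t ^ d / (1 - t ^ d)) - \<chi> d * (t ^ (d * (K div d) + d) / (1 - t ^ d))"
          by (simp only: sum_distrib_left[symmetric] right_diff_distrib)
      qed simp
      also have "\<dots> = (\<Sum>d=1..K. \<chi> d * (t ^ d / (1 - t ^ d))) - (\<Sum>d=1..K. \<chi> d * (t ^ (d * (K div d) + d) / (1 - t ^ d)))"
        by (rule sum_subtractf)
      also have "\<dots> \<le> (2 * C + 2 * C / (1 - t) * inverse (real (Suc K))) + (t / (1 - t) * (real K * t ^ K))"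
      proof -
        have "\<bar>\<Sum>d=1..K. \<chi> d * (t ^ (d * (K div d) + d) / (1 - t ^ d))\<bar> \<le> (\<Sum>d=1..K. t ^ Suc K / (1 - t))"
        proof (rule order_trans[OF sum_abs], rule sum_mono)
          fix d assume d: "d \<in> {1..K}"
          have le1: "\<bar>\<chi> d\<bar> \<le> 1" using val[of d] by auto
          have "K < d * (K div d) + d" using d dividend_less_times_div[of d K] by simp
          then have 1: "t ^ (d * (K div d) + d) \<le> t ^ Suc K" using t by (intro power_decreasing) auto
          have "t ^ d \<le> t ^ 1" using t d by (intro power_decreasing) auto
          then have 2: "1 - t \<le> 1 - t ^ d" by simp
          have "\<bar>\<chi> d\<bar> * (t ^ (d * (K div d) + d) / (1 - t ^ d)) \<le> 1 * (t ^ Suc K / (1 - t))"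
            using 1 2 le1 t by (intro mult_mono frac_le) auto
          then show "\<bar>\<chi> d * (t ^ (d * (K div d) + d) / (1 - t ^ d))\<bar> \<le> t ^ Suc K / (1 - t)"
            using 2 t by (simp add: abs_mult)
        qed
        moreover have "\<bar>\<Sum>d=1..K. \<chi> d * (t ^ d / (1 - t ^ d))\<bar> \<le> 2 * C + 2 * C / (1 - t) * inverse (real (Suc K))"
        proof -
          have c1: "c 1 = 1" using t by (simp add: c_def diff_divide_distrib[symmetric])
          have "\<bar>\<Sum>m=1..<Suc K. \<chi> m * c m\<bar> \<le> 2 * C * c 1"
            by (rule abs_sum_mult_decreasing_le[OF C])
               (use lambert_decreasing[OF u] in \<open>auto simp: c_def t_def\<close>)
          then have 1: "\<bar>\<Sum>m=1..K. \<chi> m * c m\<bar> \<le> 2 * C"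
            by (simp add: c1[simplified] atLeastLessThanSuc_atLeastAtMost del: sum.op_ivl_Suc)
          have "\<bar>(\<Sum>m<Suc K. \<chi> m / real m) - dirichlet_one \<chi>\<bar> \<le> 2 * C / real (Suc K)"
            by (rule dirichlet_one_tail[OF C]) simp
          then have 2: "\<bar>\<Sum>m=1..K. \<chi> m / real m\<bar> \<le> 2 * C / real (Suc K)"
            using L by (subst sum_atLeast1_eq_lessThan) (auto simp del: sum.lessThan_Suc)
          have "(\<Sum>m=1..K. \<chi> m * c m) = (\<Sum>m=1..K. \<chi> m / real m) / (1 - t) - (\<Sum>m=1..K. \<chi> m * (t ^ m / (1 - t ^ m)))"
            by (simp add: c_def right_diff_distrib sum_subtractf sum_divide_distrib)
          moreover have "\<bar>(\<Sum>m=1..K. \<chi> m / real m) / (1 - t)\<bar> \<le> 2 * C / (1 - t) * inverse (real (Suc K))"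
          proof -
            have "\<bar>(\<Sum>m=1..K. \<chi> m / real m) / (1 - t)\<bar> = \<bar>\<Sum>m=1..K. \<chi> m / real m\<bar> / (1 - t)"
              using t by (simp add: abs_divide)
            also have "\<dots> \<le> 2 * C / real (Suc K) / (1 - t)"
              using 2 t by (intro divide_right_mono) auto
            also have "\<dots> = 2 * C / (1 - t) * inverse (real (Suc K))"
              by (simp only: divide_inverse mult_ac)
            finally show ?thesis .
          qed
          ultimately show ?thesis using 1 by linarith
        qed
        moreover have "(\<Sum>d=1..K. t ^ Suc K / (1 - t)) = t / (1 - t) * (real K * t ^ K)" by simp
        ultimately show ?thesis by linarith
      qed
      finally show ?thesis by simp
    qed
    have "(\<lambda>K. 2 * C + 2 * C / (1 - t) * inverse (real (Suc K)) + t / (1 - t) * (real K * t ^ K))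
        \<longlonglongrightarrow> 2 * C + 2 * C / (1 - t) * 0 + t / (1 - t) * 0"
      using t by (intro tendsto_intros LIMSEQ_inverse_real_of_nat powser_times_n_limit_0) auto
    then have "real M * t ^ (M\<^sup>2) \<le> 2 * C + 2 * C / (1 - t) * 0 + t / (1 - t) * 0"
      by (rule LIMSEQ_le_const) (use upper in blast)
    then show ?thesis by simp
  qed
  have le: "real M \<le> 2 * C" for M
  proof -
    have "((\<lambda>u. real M * (u\<^sup>2) ^ (M\<^sup>2)) \<longlongrightarrow> real M * (1\<^sup>2) ^ (M\<^sup>2)) (at_left (1::real))"
      by (intro tendsto_intros)
    moreover have "eventually (\<lambda>u. real M * (u\<^sup>2) ^ (M\<^sup>2) \<le> 2 * C) (at_left (1::real))"
      using eventually_at_left_real[of 0 "1::real"]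
      by (rule eventually_mono) (auto intro: key)
    ultimately have "real M * (1\<^sup>2) ^ (M\<^sup>2) \<le> 2 * C"
      by (rule tendsto_upperbound) simp
    then show ?thesis by simp
  qed
  obtain M :: nat where "real M > 2 * C" using reals_Archimedean2 by blast
  then show False using le[of M] by simp
qed

section \<open>Nonvanishing and the sawtooth function\<close>

text \<open>A nonzero \<open>f\<close> would be \<open>f 1\<close> times a real character with
  vanishing series. Mean zero excludes the principal character: it keeps the partial sums
  bounded.\<close>

theorem unit_periodic_eq_0:
  assumes f: "unit_periodic n f" and n: "n > 0" and zero: "(\<Sum>m<n. f m) = 0"
    and L: "\<And>t. coprime t n \<Longrightarrow> dirichlet_one (\<lambda>m. f (t * m)) = 0"
  shows "f a = 0"
proof (rule ccontr)
  assume nz: "f a \<noteq> 0"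
  note char = dirichlet_one_eq_0_imp_character[OF f n zero L nz]
  define \<chi> where "\<chi> m = f m / f 1" for m
  have "dirichlet_one \<chi> \<noteq> 0"
  proof (rule dirichlet_one_real_character_neq_0)
    show "\<chi> (s * t) = \<chi> s * \<chi> t" for s t
    proof (cases "coprime s n \<and> coprime t n")
      case True
      then have "f (s * t) = f s * f t / f 1" using char(1,2) by (simp add: field_simps)
      then show ?thesis by (simp add: \<chi>_def)
    next
      case False
      then have "f (s * t) = 0" "f s = 0 \<or> f t = 0" using unit_periodicD(2)[OF f] by auto
      then show ?thesis by (auto simp: \<chi>_def)
    qed
    show "\<chi> 1 = 1" using char(1) by (simp add: \<chi>_def)
    show "\<chi> m \<in> {-1, 0, 1}" for m
    proof (cases "coprime m n")
      case True
      then have "(f m / f 1)\<^sup>2 = 1" using char(1) char(3)[of m] by (simp add: power_divide)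
      then show ?thesis by (auto simp: \<chi>_def power2_eq_1_iff)
    qed (use unit_periodicD(2)[OF f] in \<open>simp add: \<chi>_def\<close>)
    \<comment> \<open>If 0 is a unit, then \<open>n = 1\<close>, and mean zero reads
      \<open>f 0 = 0\<close>.\<close>
    show "\<chi> 0 = 0"
    proof (cases "coprime 0 n")
      case True
      then have "n = 1" by simp
      then show ?thesis using zero by (simp add: \<chi>_def)
    qed (use unit_periodicD(2)[OF f] in \<open>simp add: \<chi>_def\<close>)
    show "\<bar>\<Sum>k<N. \<chi> k\<bar> \<le> n * (\<Sum>k<n. \<bar>f k\<bar>) / \<bar>f 1\<bar>" for N
      using unit_periodic_partial_sums[OF f n zero, of 1 N] char(1)
      by (simp add: \<chi>_def sum_divide_distrib[symmetric] abs_divide divide_right_mono)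
  qed
  moreover have "(\<lambda>m. f m / real m) sums 0"
  proof -
    have "\<bar>\<Sum>k<N. f k\<bar> \<le> n * (\<Sum>k<n. \<bar>f k\<bar>)" for N
      using unit_periodic_partial_sums[OF f n zero, of 1 N] by simp
    from summable_dirichlet_one[where f = f, OF this] show ?thesis
      using L[of 1] by (simp add: dirichlet_one_def sums_iff)
  qed
  then have "(\<lambda>m. f m / real m / f 1) sums (0 / f 1)" by (rule sums_divide)
  then have "dirichlet_one \<chi> = 0"
    by (simp add: dirichlet_one_def \<chi>_def sums_iff mult.commute)
  ultimately show False by simp
qed

section \<open>The Fourier series of the sawtooth function\<close>

lemma dirichlet_kernel:
  fixes x :: real
  assumes "sin (x / 2) \<noteq> 0"
  shows "(\<Sum>m=1..N. cos (real m * x)) + 1 / 2 = sin ((real N + 1 / 2) * x) / (2 * sin (x / 2))"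
proof -
  have "(\<Sum>m=1..N. 2 * sin (x / 2) * cos (real m * x)) + sin (x / 2) = sin ((real N + 1 / 2) * x)"
  proof (induction N)
    case (Suc N)
    have "sin ((real (Suc N) + 1 / 2) * x) = sin (real (Suc N) * x + x / 2)"
      "sin ((real N + 1 / 2) * x) = sin (real (Suc N) * x - x / 2)"
      by (simp_all add: algebra_simps add_divide_distrib)
    then have "sin ((real (Suc N) + 1 / 2) * x) =
        sin ((real N + 1 / 2) * x) + 2 * sin (x / 2) * cos (real (Suc N) * x)"
      by (simp only: sin_add sin_diff) simp
    then show ?case using Suc by simp
  qed simp
  then show ?thesis using assms by (simp add: field_simps sum_distrib_left)
qed

text \<open>Integrating the Dirichlet kernel by parts suggests the cosine term added in
  \<open>f\<close>: its derivative cancels the kernel in the derivative of the error and leaves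
  \<open>f'\<close>, of order \<open>1 / N\<close>. As \<open>f pi = 0\<close>, the mean value
  theorem on the interval from \<open>x\<close> to \<open>pi\<close> bounds
  \<open>f x\<close>.\<close>

lemma sawtooth_partial_sum:
  fixes x :: real
  assumes x: "0 < x" "x < pi"
  shows "\<bar>(\<Sum>m=1..N. sin (real m * x) / real m) - (pi - x) / 2\<bar> \<le>
    (pi / (2 * (sin (x / 2))\<^sup>2) + 1 / sin (x / 2)) / real (2 * N + 1)"
proof -
  define s where "s = sin (x / 2)"
  have s: "s > 0" unfolding s_def using x by (intro sin_gt_zero) auto
  define f where "f y = (\<Sum>m=1..N. sin (real m * y) / real m) - (pi - y) / 2
    + cos ((real N + 1 / 2) * y) / (real (2 * N + 1) * sin (y / 2))" for y
  define f' where "f' y = - cos ((real N + 1 / 2) * y) * cos (y / 2) /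
    (2 * real (2 * N + 1) * (sin (y / 2))\<^sup>2)" for y
  have deriv: "(f has_real_derivative f' y) (at y)" if y: "x \<le> y" "y \<le> pi" for y
  proof -
    have sy: "sin (y / 2) \<noteq> 0" using x y sin_gt_zero[of "y / 2"] by force
    have N1: "real N + 1 / 2 = real (2 * N + 1) / 2" by simp
    have "(f has_real_derivative (\<Sum>m=1..N. cos (real m * y)) + 1 / 2 +
        (- sin ((real N + 1 / 2) * y) * (real N + 1 / 2) * (real (2 * N + 1) * sin (y / 2))
         - cos ((real N + 1 / 2) * y) * (real (2 * N + 1) * (cos (y / 2) * (1 / 2)))) /
        (real (2 * N + 1) * sin (y / 2) * (real (2 * N + 1) * sin (y / 2)))) (at y)"
      unfolding f_def
      by (rule derivative_eq_intros refl | use sy in force)+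
    also have "(\<Sum>m=1..N. cos (real m * y)) + 1 / 2 = sin ((real N + 1 / 2) * y) / (2 * sin (y / 2))"
      by (rule dirichlet_kernel[OF sy])
    also have "\<dots> + (- sin ((real N + 1 / 2) * y) * (real N + 1 / 2) * (real (2 * N + 1) * sin (y / 2))
         - cos ((real N + 1 / 2) * y) * (real (2 * N + 1) * (cos (y / 2) * (1 / 2)))) /
        (real (2 * N + 1) * sin (y / 2) * (real (2 * N + 1) * sin (y / 2))) = f' y"
    proof -
      have "S / (2 * z) + (- S * (M / 2) * (M * z) - C * (M * (D * (1 / 2)))) / (M * z * (M * z))
          = - C * D / (2 * M * z\<^sup>2)" if "M \<noteq> 0" "z \<noteq> 0" for S C D M z :: real
        using that by (simp add: field_simps power2_eq_square)
      from this[of "real (2 * N + 1)" "sin (y / 2)"] show ?thesis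
        unfolding f'_def N1 using sy by simp
    qed
    finally show ?thesis .
  qed
  obtain z where z: "x < z" "z < pi" "f pi - f x = (pi - x) * f' z"
    using MVT2[OF x(2), of f f'] deriv by auto
  have "sin (real m * pi) = 0" for m by simp
  moreover have "cos ((real N + 1 / 2) * pi) = 0"
  proof -
    have "(real N + 1 / 2) * pi = real N * pi + pi / 2" by (simp add: algebra_simps)
    then show ?thesis by (simp only: cos_add) simp
  qed
  ultimately have fpi: "f pi = 0" unfolding f_def by (simp only: sum.neutral_const div_0) simp
  have sz: "s \<le> sin (z / 2)"
    unfolding s_def using x z by (intro sin_monotone_2pi_le) auto
  have "\<bar>f' z\<bar> \<le> 1 / (2 * real (2 * N + 1) * s\<^sup>2)"
  proof -
    have "\<bar>cos ((real N + 1 / 2) * z) * cos (z / 2)\<bar> \<le> 1 * 1"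
      unfolding abs_mult by (intro mult_mono) auto
    moreover have "s\<^sup>2 \<le> (sin (z / 2))\<^sup>2" using s sz by (intro power_mono) auto
    ultimately show ?thesis
      unfolding f'_def abs_divide using s by (intro frac_le) auto
  qed
  then have "\<bar>f x\<bar> \<le> pi * (1 / (2 * real (2 * N + 1) * s\<^sup>2))"
  proof -
    have "f x = - ((pi - x) * f' z)" using z(3) fpi by linarith
    then have "\<bar>f x\<bar> = (pi - x) * \<bar>f' z\<bar>" using x by (simp only: abs_minus_cancel abs_mult)
    also have "\<dots> \<le> pi * (1 / (2 * real (2 * N + 1) * s\<^sup>2))"
      using x \<open>\<bar>f' z\<bar> \<le> _\<close> by (intro mult_mono) auto
    finally show ?thesis .
  qed
  moreover have "\<bar>cos ((real N + 1 / 2) * x) / (real (2 * N + 1) * s)\<bar> \<le> 1 / (real (2 * N + 1) * s)"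
    unfolding abs_divide using s by (intro frac_le) auto
  ultimately have "\<bar>(\<Sum>m=1..N. sin (real m * x) / real m) - (pi - x) / 2\<bar> \<le>
      pi * (1 / (2 * real (2 * N + 1) * s\<^sup>2)) + 1 / (real (2 * N + 1) * s)"
    unfolding f_def s_def[symmetric] by linarith
  also have "\<dots> = (pi / (2 * s\<^sup>2) + 1 / s) / real (2 * N + 1)"
    by (simp add: add_divide_distrib mult_ac)
  finally show ?thesis unfolding s_def .
qed

lemma sawtooth_sums:
  fixes x :: real
  assumes x: "0 < x" "x < 2 * pi"
  shows "(\<lambda>m. sin (real m * x) / real m) sums ((pi - x) / 2)"
proof -
  have less: "(\<lambda>m. sin (real m * x) / real m) sums ((pi - x) / 2)" if x: "0 < x" "x < pi" for x :: real
  proof -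
    define C where "C = pi / (2 * (sin (x / 2))\<^sup>2) + 1 / sin (x / 2)"
    have C0: "C \<ge> 0" unfolding C_def using x sin_gt_zero[of "x / 2"] by simp
    have "(\<lambda>N. (\<Sum>m\<le>N. sin (real m * x) / real m) - (pi - x) / 2) \<longlonglongrightarrow> 0"
    proof (rule tendsto_0_le[OF LIMSEQ_inverse_real_of_nat])
      show "\<forall>\<^sub>F N in sequentially.
          norm ((\<Sum>m\<le>N. sin (real m * x) / real m) - (pi - x) / 2) \<le> norm (inverse (real (Suc N))) * C"
      proof (rule always_eventually, rule allI)
        fix N
        have "(\<Sum>m\<le>N. sin (real m * x) / real m) = (\<Sum>m=1..N. sin (real m * x) / real m)"
          by (subst sum_atLeast1_eq_lessThan) (auto simp: lessThan_Suc_atMost)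
        then have "norm ((\<Sum>m\<le>N. sin (real m * x) / real m) - (pi - x) / 2) \<le> C / real (2 * N + 1)"
          using sawtooth_partial_sum[OF x, of N] by (simp add: C_def)
        also have "\<dots> \<le> C / real (Suc N)" using C0 by (intro divide_left_mono) auto
        also have "\<dots> = norm (inverse (real (Suc N))) * C"
          by (simp add: field_simps del: of_nat_Suc)
        finally show "norm ((\<Sum>m\<le>N. sin (real m * x) / real m) - (pi - x) / 2) \<le>
            norm (inverse (real (Suc N))) * C" .
      qed
    qed
    then show ?thesis unfolding sums_def_le by (rule LIM_zero_cancel)
  qed
  consider "x < pi" | "x = pi" | "x > pi" by linarith
  then show ?thesis
  proof cases
    case 3
    have reflect: "sin (real m * (2 * pi - x)) = - sin (real m * x)" for m
    proof -
      have "real m * (2 * pi - x) = real m * (2 * pi) - real m * x" by (simp add: algebra_simps)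
      then show ?thesis
        using sin_npi[of "2 * m"] cos_npi[of "2 * m"]
        by (simp only: sin_diff) (simp add: mult_ac)
    qed
    have "(\<lambda>m. sin (real m * (2 * pi - x)) / real m) sums ((pi - (2 * pi - x)) / 2)"
      by (rule less) (use 3 x in auto)
    then have "(\<lambda>m. - (sin (real m * (2 * pi - x)) / real m)) sums (- ((pi - (2 * pi - x)) / 2))"
      by (rule sums_minus)
    moreover have eq: "- ((pi - (2 * pi - x)) / 2) = (pi - x) / 2" by (simp add: field_simps)
    ultimately show ?thesis by (simp only: eq reflect minus_divide_left minus_minus)
  qed (use less x in simp_all)
qed

section \<open>Odd periodic functions and Euler factors\<close>

text \<open>Oddness modulo \<open>n\<close>, with \<open>n - 1\<close> in the role of
  \<open>-1\<close>. Nothing is required at non-units, so the class is closed under scaling by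
  \<open>p\<close> and \<open>q\<close>.\<close>

definition odd_periodic :: "nat \<Rightarrow> (nat \<Rightarrow> real) \<Rightarrow> bool" where
  "odd_periodic n f \<longleftrightarrow> (\<forall>m. f (m + n) = f m) \<and> (\<forall>m. f ((n - 1) * m) = - f m)"

lemma odd_periodicD:
  assumes "odd_periodic n f"
  shows "f (m + n) = f m" "f (m mod n) = f m" "f ((n - 1) * m) = - f m" "f (m + k * n) = f m"
proof -
  show *: "f (m mod n) = f m" for m
    using assms periodic_mod[of f n] by (auto simp: odd_periodic_def)
  show "f (m + k * n) = f m" using *[of "m + k * n"] *[of m] by simp
qed (use assms in \<open>auto simp: odd_periodic_def\<close>)

lemma odd_periodic_scale:
  assumes "odd_periodic n f"
  shows "odd_periodic n (\<lambda>m. f (d * m))"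
  using odd_periodicD(3)[OF assms, of "d * _"] odd_periodicD(4)[OF assms, of "d * _" d]
  by (simp add: odd_periodic_def distrib_left mult.left_commute)

lemma odd_periodic_sum_0:
  assumes f: "odd_periodic n f" and n: "n > 0"
  shows "(\<Sum>m<n. f m) = 0"
proof -
  have "coprime (n - 1) n" using n coprime_diff_one_left_nat[of n] by simp
  then have "(\<Sum>m<n. f ((n - 1) * m)) = (\<Sum>m<n. f m)"
    using sum_periodic_scale[of f n "n - 1"] odd_periodicD(1)[OF f] n by simp
  moreover have "(\<Sum>m<n. f ((n - 1) * m)) = - (\<Sum>m<n. f m)"
    by (simp only: odd_periodicD(3)[OF f] sum_negf)
  ultimately show ?thesis by linarith
qed

lemma odd_periodic_bounded:
  assumes f: "odd_periodic n f" and n: "n > 0"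
  shows "\<bar>f m\<bar> \<le> (\<Sum>k<n. \<bar>f k\<bar>)"
  by (rule periodic_bounded) (use odd_periodicD(1)[OF f] n in auto)

lemma odd_periodic_summable:
  assumes f: "odd_periodic n f" and n: "n > 0"
  shows "summable (\<lambda>m. f m / real m)"
proof (rule summable_dirichlet_one)
  show "\<bar>\<Sum>k<N. f k\<bar> \<le> n * (\<Sum>k<n. \<bar>f k\<bar>)" for N
    by (rule abs_sum_periodic_le)
      (use odd_periodicD(1)[OF f] n odd_periodic_sum_0[OF f n] odd_periodic_bounded[OF f n] in auto)
qed

text \<open>A Neumann series: with \<open>(M f)(m) = f (p * m)\<close>, the sum of
  \<open>M ^ i f / p ^ i\<close> inverts \<open>1 - M / p\<close>; it converges because
  \<open>f\<close> is bounded.\<close>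

lemma odd_periodic_geometric:
  assumes f: "odd_periodic n f" and n: "n > 0" and p: "p > 1"
  obtains g where "odd_periodic n g" "\<And>m. f m = g m - g (p * m) / real p"
proof
  define g where "g m = (\<Sum>i. f (p ^ i * m) / real p ^ i)" for m
  have sm: "summable (\<lambda>i. f (p ^ i * m) / real p ^ i)" for m
  proof (rule summable_comparison_test)
    show "\<exists>N. \<forall>i\<ge>N. norm (f (p ^ i * m) / real p ^ i) \<le> (\<Sum>k<n. \<bar>f k\<bar>) * (1 / real p) ^ i"
      using odd_periodic_bounded[OF f n] p
      by (intro exI[of _ 0]) (auto simp: power_divide abs_divide divide_right_mono)
    show "summable (\<lambda>i. (\<Sum>k<n. \<bar>f k\<bar>) * (1 / real p) ^ i)"
      using p by (intro summable_mult summable_geometric) auto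
  qed
  have "g (m + n) = g m" for m
    using odd_periodicD(1)[OF odd_periodic_scale[OF f]] by (simp add: g_def)
  moreover have "g ((n - 1) * m) = - g m" for m
    using odd_periodicD(3)[OF odd_periodic_scale[OF f]] suminf_minus[OF sm[of m]]
    by (simp add: g_def)
  ultimately show "odd_periodic n g" by (simp add: odd_periodic_def)
  show "f m = g m - g (p * m) / real p" for m
  proof -
    have "g m = f m + (\<Sum>i. f (p ^ Suc i * m) / real p ^ Suc i)"
      using suminf_split_head[OF sm[of m]] by (simp add: g_def)
    also have "(\<Sum>i. f (p ^ Suc i * m) / real p ^ Suc i) = (\<Sum>i. f (p ^ i * (p * m)) / real p ^ i / real p)"
      by (simp add: mult_ac)
    also have "\<dots> = g (p * m) / real p"
      unfolding g_def by (rule suminf_divide[OF sm])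
    finally show ?thesis by simp
  qed
qed

lemma sums_multiples:
  assumes f: "odd_periodic n f" and n: "n > 0" and r: "r > 0"
  shows "(\<lambda>m. (if r dvd m then f m else 0) / real m) sums (dirichlet_one (\<lambda>m. f (r * m)) / real r)"
proof -
  let ?F = "\<lambda>m. (if r dvd m then f m else 0) / real m"
  have "(\<lambda>m. f (r * m) / real m / real r) sums (dirichlet_one (\<lambda>m. f (r * m)) / real r)"
    unfolding dirichlet_one_def
    by (intro sums_divide summable_sums odd_periodic_summable[OF odd_periodic_scale[OF f] n])
  moreover have "(\<lambda>m. f (r * m) / real m / real r) = (\<lambda>m. ?F (r * m))"
    by (auto simp: mult.commute)
  ultimately have "(\<lambda>m. ?F (r * m)) sums (dirichlet_one (\<lambda>m. f (r * m)) / real r)" by simp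
  moreover have "strict_mono (\<lambda>m. r * m)" using r by (simp add: strict_mono_def)
  ultimately show ?thesis
    by (subst (asm) sums_mono_reindex) auto
qed

text \<open>With \<open>(M\<^sub>p K)(m) = K(pm)\<close>, \<open>H\<close> is the image of \<open>K\<close> under \<open>(1 - M\<^sub>p / p) (1 - M\<^sub>q / q)\<close>;
  the series of \<open>H\<close> at \<open>1\<close> is then that of the restriction of \<open>K\<close> to the units.\<close>

lemma euler_factor_removal:
  assumes H: "odd_periodic n H" and n: "n > 0"
    and pq: "prime p" "prime q" "p \<noteq> q"
    and cop: "\<And>m. coprime m n \<longleftrightarrow> \<not> p dvd m \<and> \<not> q dvd m"
    and L: "\<And>t. coprime t n \<Longrightarrow> dirichlet_one (\<lambda>m. H (t * m)) = 0"
  obtains K where "odd_periodic n K"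
    "\<And>m. H m = K m - K (p * m) / p - K (q * m) / q + K (p * q * m) / (p * q)"
    "\<And>m. coprime m n \<Longrightarrow> K m = 0"
proof -
  have p1: "p > 1" "q > 1" using pq prime_gt_1_nat by auto
  obtain g where g: "odd_periodic n g" "\<And>m. H m = g m - g (p * m) / real p"
    using odd_periodic_geometric[OF H n p1(1)] by blast
  obtain K where K: "odd_periodic n K" "\<And>m. g m = K m - K (q * m) / real q"
    using odd_periodic_geometric[OF g(1) n p1(2)] by blast
  have HK: "H m = K m - K (p * m) / p - K (q * m) / q + K (p * q * m) / (p * q)" for m
    unfolding g(2) K(2) by (simp add: diff_divide_distrib mult_ac)
  define f where "f m = (if coprime m n then K m else 0)" for m
  have cop_add: "coprime (m + n) n \<longleftrightarrow> coprime m n" for m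
    by (simp only: coprime_iff_gcd_eq_1 gcd_add1)
  have f: "unit_periodic n f"
    using odd_periodicD(1)[OF K(1)] by (simp add: unit_periodic_def f_def cop_add)
  have n1: "coprime (n - 1) n" using n coprime_diff_one_left_nat[of n] by simp
  have "odd_periodic n f"
    using odd_periodicD(1)[OF K(1)] odd_periodicD(3)[OF K(1)] n1
    by (auto simp: odd_periodic_def f_def cop_add)
  then have zero: "(\<Sum>m<n. f m) = 0" using odd_periodic_sum_0 n by blast
  have "f m = 0" for m
  proof (rule unit_periodic_eq_0[OF f n zero])
    fix t assume t: "coprime t n"
    let ?K = "\<lambda>d m. K (t * (d * m))"
    have Kt: "odd_periodic n (\<lambda>m. K (t * m))" by (rule odd_periodic_scale[OF K(1)])
    have s1: "(\<lambda>m. K (t * m) / real m) sums dirichlet_one (?K 1)"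
      using odd_periodic_summable[OF Kt n] by (simp add: dirichlet_one_def summable_sums)
    have sums_d: "(\<lambda>m. (if d dvd m then K (t * m) else 0) / real m) sums (dirichlet_one (?K d) / real d)"
      if "d > 0" for d
      by (rule sums_multiples[OF Kt n that])
    \<comment> \<open>Inclusion-exclusion over \<open>p\<close> and \<open>q\<close> describes the
      restriction to units. Each sum over the multiples of \<open>d\<close> rescales to
      \<open>dirichlet_one (?K d) / d\<close>, and these four values are also the contributions of
      the terms in \<open>HK\<close>.\<close>
    have "p * q dvd m \<longleftrightarrow> p dvd m \<and> q dvd m" for m
      using primes_coprime[OF pq] by (auto intro: divides_mult dvd_mult_left dvd_mult_right)
    then have decomp: "f (t * m) / m = K (t * m) / m - (if p dvd m then K (t * m) else 0) / m
      - (if q dvd m then K (t * m) else 0) / m + (if p * q dvd m then K (t * m) else 0) / m" for m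
      using t by (simp add: f_def cop prime_dvd_mult_iff pq(1,2))
    have pq0: "p > 0" "q > 0" "p * q > 0" using p1 by auto
    have "(\<lambda>m. f (t * m) / m) sums (dirichlet_one (?K 1) - dirichlet_one (?K p) / p
        - dirichlet_one (?K q) / q + dirichlet_one (?K (p * q)) / real (p * q))"
      unfolding decomp
      by (intro sums_add sums_diff s1 sums_d pq0)
    moreover have "(\<lambda>m. H (t * m) / m) sums (dirichlet_one (?K 1) - dirichlet_one (?K p) / p
        - dirichlet_one (?K q) / q + dirichlet_one (?K (p * q)) / real (p * q))"
    proof -
      have sumK: "(\<lambda>m. ?K d m / m) sums dirichlet_one (?K d)" for d
        unfolding dirichlet_one_def
        by (intro summable_sums odd_periodic_summable[OF odd_periodic_scale[OF Kt] n])
      have "H (t * m) / m = ?K 1 m / m - ?K p m / m / p - ?K q m / m / q + ?K (p * q) m / m / real (p * q)" for m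
        unfolding HK by (simp add: add_divide_distrib diff_divide_distrib mult_ac)
      then show ?thesis by (simp only:) (intro sums_add sums_diff sums_divide sumK)
    qed
    ultimately show "dirichlet_one (\<lambda>m. f (t * m)) = 0"
      using L[OF t] by (simp add: dirichlet_one_def sums_iff)
  qed
  then have "K m = 0" if "coprime m n" for m using that by (metis f_def)
  with K(1) HK show ?thesis by (rule that)
qed

section \<open>Sine transforms modulo \<open>n\<close> and the rectangle identity\<close>

lemma cis_eq_1_iff_dvd:
  assumes n: "n > 0"
  shows "cis (2 * pi * of_int k / real n) = 1 \<longleftrightarrow> int n dvd k"
proof
  assume "cis (2 * pi * of_int k / real n) = 1"
  then have "cos (2 * pi * of_int k / real n) = 1" by (simp add: complex_eq_iff)
  then obtain j :: int where "2 * pi * of_int k / real n = of_int j * 2 * pi"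
    using cos_one_2pi_int by blast
  then have "real_of_int k = of_int (j * int n)" using n by (simp add: field_simps)
  then have "k = j * int n" by (simp only: of_int_eq_iff)
  then show "int n dvd k" by simp
next
  assume "int n dvd k"
  then obtain j where "k = int n * j" by blast
  then have "2 * pi * of_int k / real n = 2 * pi * of_int j" using n by simp
  then show "cis (2 * pi * of_int k / real n) = 1" by (simp add: cis_multiple_2pi)
qed

lemma sum_cos_multiple:
  assumes n: "n > 0"
  shows "(\<Sum>m<n. cos (2 * pi * real m * of_int k / real n)) = (if int n dvd k then real n else 0)"
proof -
  define z where "z = cis (2 * pi * of_int k / real n)"
  have zpow: "cis (2 * pi * real m * of_int k / real n) = z ^ m" for m
    by (simp add: z_def DeMoivre mult_ac)
  have "z ^ n = 1"
    using n cis_multiple_2pi[of "of_int k"] by (simp add: z_def DeMoivre mult_ac)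
  then have "(\<Sum>m<n. z ^ m) = (if z = 1 then of_nat n else 0)"
    by (simp add: sum_gp_strict)
  then have "(\<Sum>m<n. cis (2 * pi * real m * of_int k / real n)) = (if int n dvd k then of_nat n else 0)"
    by (simp add: zpow z_def cis_eq_1_iff_dvd[OF n])
  then have "Re (\<Sum>m<n. cis (2 * pi * real m * of_int k / real n)) = (if int n dvd k then real n else 0)"
    by simp
  then show ?thesis by simp
qed

lemma sum_periodic_shift:
  fixes g :: "nat \<Rightarrow> complex"
  assumes per: "\<And>m. g (m + n) = g m"
  shows "(\<Sum>m<n. g (m + s)) = (\<Sum>m<n. g m)"
proof (induction s)
  case (Suc s)
  have "(\<Sum>m<n. g (m + Suc s)) + g s = (\<Sum>m<Suc n. g (m + s))"
    by (subst sum.lessThan_Suc_shift) (simp add: add.commute)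
  also have "\<dots> = (\<Sum>m<n. g (m + s)) + g s" using per[of s] by (simp add: add.commute)
  finally show ?case using Suc by simp
qed simp

lemma sin_eq_of_cong:
  assumes n: "n > 0" and cong: "[k = l] (mod int n)"
  shows "sin (2 * pi * of_int k / real n) = sin (2 * pi * of_int l / real n)"
proof -
  obtain j where "k = l + int n * j" using cong by (metis cong_iff_lin cong_sym)
  then have "2 * pi * of_int k / real n = 2 * pi * of_int l / real n + (2 * pi) * of_int j"
    using n by (simp add: field_simps)
  then show ?thesis by (simp add: sin_add sin_int_2pin cos_int_2pin)
qed

text \<open>\<open>K (r * m)\<close> has period \<open>n / r\<close> in \<open>m\<close>, whereas
  shifting \<open>m\<close> by \<open>n / r\<close> multiplies the exponential by \<open>w\<close>,
  an \<open>r\<close>-th root of unity other than 1 because \<open>x\<close> is a unit. So the sum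
  \<open>Z\<close> satisfies \<open>Z = w * Z\<close>.\<close>

lemma sum_odd_periodic_multiple_sin:
  assumes K: "odd_periodic n K" and n: "n > 0" and r: "r > 1" "r dvd n" and x: "coprime x n"
  shows "(\<Sum>m<n. K (r * m) * sin (2 * pi * of_int (int m * int x) / real n)) = 0"
proof -
  define w where "w = cis (2 * pi * of_int (int x) / real r)"
  define e where "e m = cis (2 * pi * of_int (int m * int x) / real n)" for m
  define Z where "Z = (\<Sum>m<n. complex_of_real (K (r * m)) * e m)"
  obtain s where s: "n = r * s" using r by blast
  have s0: "s > 0" using s n by (cases s) auto
  have e_add: "e (m + s) = w * e m" for m
  proof -
    have "2 * pi * of_int (int (m + s) * int x) / real n =
        2 * pi * of_int (int x) / real r + 2 * pi * of_int (int m * int x) / real n"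
      using r s0 by (simp add: s field_simps)
    then show ?thesis by (simp only: e_def w_def cis_mult)
  qed
  have "e (m + n) = e m" for m
  proof -
    have "2 * pi * of_int (int (m + n) * int x) / real n =
        2 * pi * of_int (int m * int x) / real n + 2 * pi * of_int (int x)"
      using n by (simp add: field_simps)
    then have "e (m + n) = e m * cis (2 * pi * of_int (int x))" by (simp only: e_def cis_mult)
    then show ?thesis using cis_multiple_2pi[of "of_int (int x)"] by simp
  qed
  moreover have "K (r * (m + n)) = K (r * m)" for m
    using odd_periodicD(4)[OF K, of "r * m" r] by (simp add: distrib_left)
  ultimately have "Z = (\<Sum>m<n. complex_of_real (K (r * (m + s))) * e (m + s))"
    unfolding Z_def by (intro sum_periodic_shift[symmetric]) simp
  also have "\<dots> = (\<Sum>m<n. w * (complex_of_real (K (r * m)) * e m))"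
    using odd_periodicD(1)[OF K, of "r * _"] by (simp add: e_add distrib_left s[symmetric] mult_ac)
  also have "\<dots> = w * Z" by (simp add: Z_def sum_distrib_left)
  finally have "Z * (1 - w) = 0" by (simp add: algebra_simps)
  moreover have "w \<noteq> 1"
  proof
    assume "w = 1"
    then have "int r dvd int x" unfolding w_def using cis_eq_1_iff_dvd[of r "int x"] r by simp
    then have "r dvd x" by simp
    then show False using x r by (metis coprime_common_divisor_nat nat_less_le)
  qed
  ultimately have "Z = 0" by simp
  then have "Im Z = 0" by simp
  then show ?thesis by (simp add: Z_def e_def)
qed

text \<open>Only frequencies divisible by \<open>p\<close> or \<open>q\<close> occur in the Fourier transform \<open>\<kappa>\<close> of \<open>K\<close>, and each
  of them is annihilated by the mixed difference with steps \<open>n/p\<close> and \<open>n/q\<close>.\<close>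

theorem count_rectangle:
  fixes a :: "'i \<Rightarrow> nat"
  assumes I: "finite I" and n: "n > 0"
    and pq: "prime p" "prime q" "p \<noteq> q" "p dvd n" "q dvd n"
    and cop: "\<And>m. coprime m n \<longleftrightarrow> \<not> p dvd m \<and> \<not> q dvd m"
    and a: "\<And>i. i \<in> I \<Longrightarrow> \<not> n dvd a i"
    and avg: "\<And>t. coprime t n \<Longrightarrow> (\<Sum>i\<in>I. 2 * real (t * a i mod n)) = real (card I) * real n"
  defines "h \<equiv> \<lambda>x. (\<Sum>i\<in>I. of_bool (int n dvd int (a i) - int x) - of_bool (int n dvd int (a i) + int x)) :: real"
  assumes unit: "coprime x n" "coprime (x + i * (n div p)) n" "coprime (x + j * (n div q)) n"
    "coprime (x + i * (n div p) + j * (n div q)) n"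
  shows "h x + h (x + i * (n div p) + j * (n div q)) = h (x + i * (n div p)) + h (x + j * (n div q))"
proof -
  define s where "s k = sin (2 * pi * of_int k / real n)" for k :: int
  have s_cong: "s k = s l" if "[k = l] (mod int n)" for k l
    unfolding s_def by (rule sin_eq_of_cong[OF n that])
  define H where "H m = (\<Sum>i\<in>I. s (int (a i) * int m))" for m
  have H: "odd_periodic n H"
    unfolding odd_periodic_def
  proof (intro conjI allI)
    fix m
    have "s (int (a i) * int (m + n)) = s (int (a i) * int m)" for i
      by (rule s_cong) (simp add: cong_iff_dvd_diff algebra_simps)
    then show "H (m + n) = H m" by (simp add: H_def)
    have "s (int (a i) * int ((n - 1) * m)) = s (- (int (a i) * int m))" for i
      by (rule s_cong) (use n in \<open>simp add: cong_iff_dvd_diff algebra_simps of_nat_diff\<close>)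
    then show "H ((n - 1) * m) = - H m" by (simp add: H_def s_def sum_negf)
  qed
  have HL: "dirichlet_one (\<lambda>m. H (t * m)) = 0" if t: "coprime t n" for t
  proof -
    have "(\<lambda>m. s (int (a i) * int (t * m)) / real m) sums (pi / 2 * (1 - 2 * real (t * a i mod n) / real n))"
      if i: "i \<in> I" for i
    proof -
      define r where "r = t * a i mod n"
      \<comment> \<open>At residue 0 the sine series has sum 0 and not the value
        \<open>pi / 2\<close> of the formula.\<close>
      have "r \<noteq> 0"
      proof
        assume "r = 0"
        then have "n dvd t * a i" by (simp add: r_def mod_eq_0_iff_dvd)
        then show False using a[OF i] t by (simp add: coprime_dvd_mult_right_iff coprime_commute)
      qed
      then have r: "0 < r" "r < n" using n by (auto simp: r_def)
      have "s (int (a i) * int (t * m)) = sin (real m * (2 * pi * real r / real n))" for m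
      proof -
        have "[int m * int r = int (a i) * int (t * m)] (mod int n)"
          by (simp add: r_def cong_def zmod_int mod_mult_right_eq mult_ac)
        from s_cong[OF this] show ?thesis by (simp add: s_def mult_ac)
      qed
      moreover have "(\<lambda>m. sin (real m * (2 * pi * real r / real n)) / real m) sums
          ((pi - 2 * pi * real r / real n) / 2)"
        by (rule sawtooth_sums) (use r in \<open>auto simp: field_simps\<close>)
      moreover have "(pi - 2 * pi * real r / real n) / 2 = pi / 2 * (1 - 2 * real r / real n)"
        by (simp add: field_simps)
      ultimately show ?thesis by (simp only: r_def)
    qed
    then have "(\<lambda>m. \<Sum>i\<in>I. s (int (a i) * int (t * m)) / real m) sums
        (\<Sum>i\<in>I. pi / 2 * (1 - 2 * real (t * a i mod n) / real n))"
      by (rule sums_sum)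
    moreover have "(\<Sum>i\<in>I. pi / 2 * (1 - 2 * real (t * a i mod n) / real n)) =
        pi / 2 * (real (card I) - (\<Sum>i\<in>I. 2 * real (t * a i mod n)) / real n)"
    proof -
      have "(\<Sum>i\<in>I. pi / 2 * (1 - 2 * real (t * a i mod n) / real n)) =
          pi / 2 * (\<Sum>i\<in>I. 1 - 2 * real (t * a i mod n) / real n)"
        by (rule sum_distrib_left[symmetric])
      then show ?thesis by (simp only: sum_subtractf sum_divide_distrib) simp
    qed
    ultimately show ?thesis
      using avg[OF t] n by (simp add: dirichlet_one_def H_def sum_divide_distrib sums_iff)
  qed
  obtain K where K: "odd_periodic n K"
    and HK: "\<And>m. H m = K m - K (p * m) / p - K (q * m) / q + K (p * q * m) / (p * q)"
    and K0: "\<And>m. coprime m n \<Longrightarrow> K m = 0"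
    using euler_factor_removal[OF H n pq(1-3) cop HL] by blast
  define \<kappa> where "\<kappa> x = (\<Sum>m<n. K m * s (int m * int x))" for x

  \<comment> \<open>At a unit the three scaled terms of \<open>HK\<close> have sine transform 0, so
    \<open>\<kappa> x\<close> is the transform of \<open>H\<close>; the product formula for sines
    and the orthogonality of cosines turn the latter into the signed count.\<close>
  have kappa_h: "\<kappa> x = real n / 2 * h x" if x: "coprime x n" for x
  proof -
    have pqn: "p * q dvd n" using primes_coprime[OF pq(1-3)] pq by (simp add: divides_mult)
    have zero: "(\<Sum>m<n. K (r * m) * s (int m * int x)) = 0" if "r > 1" "r dvd n" for r
      unfolding s_def by (rule sum_odd_periodic_multiple_sin[OF K n that x])
    have "(\<Sum>m<n. H m * s (int m * int x)) = \<kappa> x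
        - (\<Sum>m<n. K (p * m) * s (int m * int x)) / p
        - (\<Sum>m<n. K (q * m) * s (int m * int x)) / q
        + (\<Sum>m<n. K (p * q * m) * s (int m * int x)) / (p * q)"
      unfolding HK \<kappa>_def
      by (simp add: sum.distrib sum_subtractf sum_divide_distrib left_diff_distrib distrib_right)
    also have "\<dots> = \<kappa> x"
      using zero[of p] zero[of q] zero[of "p * q"] pq(4,5) pqn
        prime_gt_1_nat[OF pq(1)] prime_gt_1_nat[OF pq(2)] less_1_mult[of p q] by simp
    finally have "\<kappa> x = (\<Sum>m<n. \<Sum>i\<in>I. s (int (a i) * int m) * s (int m * int x))"
      by (simp add: H_def sum_distrib_right)
    also have "\<dots> = (\<Sum>i\<in>I. \<Sum>m<n. s (int (a i) * int m) * s (int m * int x))"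
      by (rule sum.swap)
    also have "\<dots> = (\<Sum>i\<in>I. real n / 2 * (of_bool (int n dvd int (a i) - int x) - of_bool (int n dvd int (a i) + int x)))"
    proof (rule sum.cong)
      fix i
      have "s (int (a i) * int m) * s (int m * int x) =
          (cos (2 * pi * real m * of_int (int (a i) - int x) / real n) -
           cos (2 * pi * real m * of_int (int (a i) + int x) / real n)) / 2" for m
      proof -
        have "2 * pi * real m * of_int (int (a i) - int x) / real n =
            2 * pi * of_int (int (a i) * int m) / real n - 2 * pi * of_int (int m * int x) / real n"
          "2 * pi * real m * of_int (int (a i) + int x) / real n =
            2 * pi * of_int (int (a i) * int m) / real n + 2 * pi * of_int (int m * int x) / real n"
          by (simp_all add: algebra_simps diff_divide_distrib add_divide_distrib)
        then show ?thesis by (simp only: s_def cos_diff cos_add) simp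
      qed
      then have "(\<Sum>m<n. s (int (a i) * int m) * s (int m * int x)) =
          ((\<Sum>m<n. cos (2 * pi * real m * of_int (int (a i) - int x) / real n)) -
           (\<Sum>m<n. cos (2 * pi * real m * of_int (int (a i) + int x) / real n))) / 2"
        by (simp only: sum_divide_distrib[symmetric] sum_subtractf)
      also have "\<dots> = real n / 2 * (of_bool (int n dvd int (a i) - int x) - of_bool (int n dvd int (a i) + int x))"
        unfolding sum_cos_multiple[OF n] by simp
      finally show "(\<Sum>m<n. s (int (a i) * int m) * s (int m * int x)) =
        real n / 2 * (of_bool (int n dvd int (a i) - int x) - of_bool (int n dvd int (a i) + int x))" .
    qed simp
    also have "\<dots> = real n / 2 * h x" by (simp only: h_def sum_distrib_left)
    finally show ?thesis .
  qed

  have shift: "s (int m * int (y + i * (n div r))) = s (int m * int y)"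
    if "r dvd m" "r dvd n" for m y i r
  proof (rule s_cong)
    from that obtain k l where kl: "m = r * k" "n = r * l" by (auto elim!: dvdE)
    have "int m * int (y + i * (n div r)) - int m * int y = int n * (int k * int i)"
    proof (cases "r = 0")
      case False
      then show ?thesis by (simp add: kl algebra_simps)
    qed (simp add: kl)
    then show "[int m * int (y + i * (n div r)) = int m * int y] (mod int n)"
      by (simp add: cong_iff_dvd_diff)
  qed
  have term0: "K m * (s (int m * int x) + s (int m * int (x + i * (n div p) + j * (n div q)))
      - s (int m * int (x + i * (n div p))) - s (int m * int (x + j * (n div q)))) = 0" for m
  proof -
    consider "coprime m n" | "p dvd m" | "q dvd m" using cop by blast
    then show ?thesis
    proof cases
      case 2
      have "x + i * (n div p) + j * (n div q) = x + j * (n div q) + i * (n div p)" by simp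
      then show ?thesis using shift[OF 2 pq(4)] by (simp only:) simp
    next
      case 3
      show ?thesis by (simp only: shift[OF 3 pq(5)]) simp
    qed (simp add: K0)
  qed
  have "\<kappa> x + \<kappa> (x + i * (n div p) + j * (n div q)) - \<kappa> (x + i * (n div p)) - \<kappa> (x + j * (n div q)) =
      (\<Sum>m<n. K m * (s (int m * int x) + s (int m * int (x + i * (n div p) + j * (n div q)))
      - s (int m * int (x + i * (n div p))) - s (int m * int (x + j * (n div q)))))"
    by (simp only: \<kappa>_def right_diff_distrib distrib_left sum_subtractf sum.distrib)
  also have "\<dots> = 0" by (simp only: term0 sum.neutral_const)
  finally have "real n / 2 * h x + real n / 2 * h (x + i * (n div p) + j * (n div q))
      - real n / 2 * h (x + i * (n div p)) - real n / 2 * h (x + j * (n div q)) = 0"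
    unfolding kappa_h[OF unit(1)] kappa_h[OF unit(2)] kappa_h[OF unit(3)] kappa_h[OF unit(4)] .
  then have "real n / 2 * (h x + h (x + i * (n div p) + j * (n div q))) =
      real n / 2 * (h (x + i * (n div p)) + h (x + j * (n div q)))"
    by (simp only: distrib_left)
  then show ?thesis using n by simp
qed

section \<open>Four terms on a grid\<close>

lemma eq_of_int_dvd_diff:
  assumes "int q dvd int j - int j'" "j < q" "j' < q"
  shows "j = j'"
  using assms by (metis cong_iff_dvd_diff cong_int_iff cong_less_modulus_unique_nat)

text \<open>The hypotheses are symmetric in \<open>p\<close> and \<open>q\<close> up to the order of
  summands in \<open>rect\<close>, so \<open>swap\<close> transfers every fact about
  \<open>p\<close> to \<open>q\<close>. The signed count is spelled out in \<open>rect\<close>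
  because \<open>h\<close> is defined only inside the locale.\<close>

locale four_terms =
  fixes p q n :: nat and a :: "nat \<Rightarrow> nat"
  assumes p: "prime p" "5 \<le> p" and q: "prime q" "5 \<le> q" and neq: "p \<noteq> q"
    and pn: "p dvd n" and qn: "q dvd n" and n0: "n > 0"
    and p_nq: "p dvd n div q" and q_np: "q dvd n div p"
    and cop: "\<And>m. coprime m n \<longleftrightarrow> \<not> p dvd m \<and> \<not> q dvd m"
    and a0: "a 0 = 1"
    and sum0: "n dvd (\<Sum>k<4. a k)"
    and pairs: "\<And>k l. k < 4 \<Longrightarrow> l < 4 \<Longrightarrow> k \<noteq> l \<Longrightarrow> \<not> n dvd a k + a l"
    and rect: "\<And>x i j. coprime x n \<Longrightarrow> coprime (x + i * (n div p)) n \<Longrightarrow>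
      coprime (x + j * (n div q)) n \<Longrightarrow> coprime (x + i * (n div p) + j * (n div q)) n \<Longrightarrow>
      (\<Sum>k<4. of_bool (int n dvd int (a k) - int x) - of_bool (int n dvd int (a k) + int x)) +
      (\<Sum>k<4. of_bool (int n dvd int (a k) - int (x + i * (n div p) + j * (n div q)))
        - of_bool (int n dvd int (a k) + int (x + i * (n div p) + j * (n div q)))) =
      (\<Sum>k<4. of_bool (int n dvd int (a k) - int (x + i * (n div p)))
        - of_bool (int n dvd int (a k) + int (x + i * (n div p)))) +
      (\<Sum>k<4. of_bool (int n dvd int (a k) - int (x + j * (n div q)))
        - of_bool (int n dvd int (a k) + int (x + j * (n div q))) :: real)"
begin

definition h :: "nat \<Rightarrow> real" where
  "h x = (\<Sum>k<4. of_bool (int n dvd int (a k) - int x) - of_bool (int n dvd int (a k) + int x))"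

lemma rectangle:
  assumes "coprime x n" "coprime (x + i * (n div p)) n" "coprime (x + j * (n div q)) n"
    "coprime (x + i * (n div p) + j * (n div q)) n"
  shows "h x + h (x + i * (n div p) + j * (n div q)) = h (x + i * (n div p)) + h (x + j * (n div q))"
  using rect[OF assms] unfolding h_def .

lemma swap: "four_terms q p n a"
proof unfold_locales
  fix x i j
  assume *: "coprime x n" "coprime (x + i * (n div q)) n" "coprime (x + j * (n div p)) n"
    "coprime (x + i * (n div q) + j * (n div p)) n"
  have eq: "x + i * (n div q) + j * (n div p) = x + j * (n div p) + i * (n div q)" by simp
  show "(\<Sum>k<4. of_bool (int n dvd int (a k) - int x) - of_bool (int n dvd int (a k) + int x)) +
      (\<Sum>k<4. of_bool (int n dvd int (a k) - int (x + i * (n div q) + j * (n div p)))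
        - of_bool (int n dvd int (a k) + int (x + i * (n div q) + j * (n div p)))) =
      (\<Sum>k<4. of_bool (int n dvd int (a k) - int (x + i * (n div q)))
        - of_bool (int n dvd int (a k) + int (x + i * (n div q)))) +
      (\<Sum>k<4. of_bool (int n dvd int (a k) - int (x + j * (n div p)))
        - of_bool (int n dvd int (a k) + int (x + j * (n div p))) :: real)"
    using rectangle[OF *(1,3,2)] *(4) unfolding eq h_def[symmetric] by simp
qed (use p q neq pn qn n0 p_nq q_np cop a0 sum0 pairs in auto)

text \<open>A step \<open>n div p\<close> keeps the residue modulo \<open>q\<close>, and a step
  \<open>n div q\<close> keeps that modulo \<open>p\<close>: the row alone decides divisibility by
  \<open>p\<close>, the column that by \<open>q\<close>.\<close>

lemma coprime_row_col:
  "coprime (x + i * (n div p) + j * (n div q)) n \<longleftrightarrow>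
    \<not> p dvd x + i * (n div p) \<and> \<not> q dvd x + j * (n div q)"
proof -
  have "p dvd j * (n div q)" "q dvd i * (n div p)" using p_nq q_np by simp_all
  then have "p dvd x + i * (n div p) + j * (n div q) \<longleftrightarrow> p dvd x + i * (n div p)"
    "q dvd x + j * (n div q) + i * (n div p) \<longleftrightarrow> q dvd x + j * (n div q)"
    by (simp_all add: dvd_add_left_iff)
  then show ?thesis by (simp add: cop add_ac)
qed

lemma coprime_row: "coprime (x + i * (n div p)) n \<longleftrightarrow> \<not> p dvd x + i * (n div p) \<and> \<not> q dvd x"
  using coprime_row_col[of x i 0] by simp

lemma coprime_col: "coprime (x + j * (n div q)) n \<longleftrightarrow> \<not> p dvd x \<and> \<not> q dvd x + j * (n div q)"
  using coprime_row_col[of x 0 j] by simp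

lemma p_le_n: "p \<le> n" using pn n0 by (rule dvd_imp_le)

text \<open>The term \<open>a 0 = 1\<close> contributes 1, and no term is \<open>-1\<close> modulo
  \<open>n\<close>: for \<open>k \<noteq> 0\<close> this is \<open>pairs\<close> with
  \<open>a 0\<close>, and for \<open>k = 0\<close> it would mean \<open>n dvd 2\<close>.\<close>

lemma h_1: "h 1 \<ge> 1"
proof -
  have "\<not> int n dvd int (a k) + int 1" if "k < 4" for k
  proof (cases "k = 0")
    case True
    have "\<not> n dvd 2" using p_le_n p by (auto dest!: dvd_imp_le)
    then show ?thesis using True a0 int_dvd_int_iff[of n 2] by simp
  next
    case False
    then have "\<not> n dvd a k + a 0" using that pairs by simp
    then show ?thesis using a0 int_dvd_int_iff[of n "a k + 1"] by (simp add: add.commute)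
  qed
  then have "h 1 = (\<Sum>k<4. of_bool (int n dvd int (a k) - int 1))"
    unfolding h_def by (intro sum.cong) auto
  also have "\<dots> \<ge> of_bool (int n dvd int (a 0) - int 1)"
    by (rule member_le_sum) auto
  finally show ?thesis using a0 by simp
qed

lemma h_nonzeroD:
  assumes "h x \<noteq> 0"
  obtains k where "k < 4" "int n dvd int (a k) - int x \<or> int n dvd int (a k) + int x"
proof -
  have "\<exists>k<4. int n dvd int (a k) - int x \<or> int n dvd int (a k) + int x"
  proof (rule ccontr)
    assume "\<not> ?thesis"
    then have "h x = 0" unfolding h_def by (intro sum.neutral) auto
    then show False using assms by simp
  qed
  then show ?thesis using that by blast
qed

lemma h_posD:
  assumes "h x > 0"
  obtains k where "k < 4" "int n dvd int (a k) - int x"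
proof -
  have "\<exists>k<4. int n dvd int (a k) - int x"
  proof (rule ccontr)
    assume "\<not> ?thesis"
    then have "h x \<le> 0" unfolding h_def by (intro sum_nonpos) auto
    then show False using assms by simp
  qed
  then show ?thesis using that by blast
qed

lemma dvd_mult_div_iff: "int n dvd c * int (n div q) \<longleftrightarrow> int q dvd c"
proof -
  obtain l where l: "n = q * l" using qn by blast
  then have "l > 0" using n0 by (cases l) auto
  then show ?thesis using l q by (auto simp: mult.commute prime_gt_0_nat)
qed

text \<open>At most one \<open>j < q\<close> solves \<open>q dvd 1 + j * (n div q)\<close>, so at
  least \<open>q - 1\<close> columns remain.\<close>

lemma card_unit_columns: "card {j. j < q \<and> \<not> q dvd 1 + j * (n div q)} \<ge> 4"
proof -
  let ?B = "{j. j < q \<and> q dvd 1 + j * (n div q)}"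
  have "j = j'" if "j \<in> ?B" "j' \<in> ?B" for j j'
  proof -
    from that have *: "int q dvd 1 + int j * int (n div q)" "int q dvd 1 + int j' * int (n div q)"
      by (simp_all flip: int_dvd_int_iff)
    then have "int q dvd (int j - int j') * int (n div q)"
      using dvd_diff[OF *] by (simp add: left_diff_distrib)
    moreover have "\<not> int q dvd int (n div q)"
    proof
      assume "int q dvd int (n div q)"
      then have "int q dvd 1" using *(1) dvd_add_left_iff[of "int q" "int j * int (n div q)" 1] by simp
      then show False using q by simp
    qed
    moreover have "prime (int q)" using q by simp
    ultimately have "int q dvd int j - int j'" using prime_dvd_mult_iff by blast
    then show "j = j'" using that by (intro eq_of_int_dvd_diff) auto
  qed
  then have "card ?B \<le> 1" by (simp add: card_le_Suc0_iff_eq)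
  moreover have "{j. j < q \<and> \<not> q dvd 1 + j * (n div q)} = {..<q} - ?B" by auto
  moreover have "card ({..<q} - ?B) \<ge> card {..<q} - card ?B" by (rule diff_card_le_card_Diff) simp
  ultimately show ?thesis using q by simp
qed

text \<open>If the row is empty, the rectangles with a corner at 1 give
  \<open>h (1 + j * (n div q)) = h 1 > 0\<close> in every unit column. There are at least four such
  columns, and each needs a different \<open>a k\<close>; so all four \<open>a k\<close> are 1
  modulo \<open>p\<close>, and \<open>p\<close> divides both their sum and that sum minus 4.\<close>

lemma row_nonempty:
  assumes i: "\<not> p dvd 1 + i * (n div p)"
  obtains j k where "coprime (1 + i * (n div p) + j * (n div q)) n" "k < 4"
    "int n dvd int (a k) - int (1 + i * (n div p) + j * (n div q)) \<or>
     int n dvd int (a k) + int (1 + i * (n div p) + j * (n div q))"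
proof -
  let ?y = "\<lambda>j. 1 + i * (n div p) + j * (n div q)"
  have "\<exists>j. coprime (?y j) n \<and> h (?y j) \<noteq> 0"
  proof (rule ccontr)
    assume "\<not> ?thesis"
    then have empty: "h (?y j) = 0" if "coprime (?y j) n" for j using that by blast
    have q1: "\<not> q dvd 1" "\<not> p dvd 1" using p q by auto
    let ?J = "{j. j < q \<and> \<not> q dvd 1 + j * (n div q)}"
    have "\<exists>k<4. int n dvd int (a k) - int (1 + j * (n div q))" if j: "j \<in> ?J" for j
    proof -
      have "h 1 + h (?y j) = h (1 + i * (n div p)) + h (1 + j * (n div q))"
      proof (rule rectangle)
        show "coprime (1 + i * (n div p)) n" unfolding coprime_row using i q1 by blast
        show "coprime (1 + j * (n div q)) n" unfolding coprime_col using j q1 by blast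
        show "coprime (?y j) n" unfolding coprime_row_col using i j by blast
      qed simp
      moreover have "h (?y j) = 0"
        by (rule empty, unfold coprime_row_col) (use i j in blast)
      moreover have "h (1 + i * (n div p)) = 0" using empty[of 0] i q1 coprime_row[of 1 i] by simp
      ultimately have "h (1 + j * (n div q)) > 0" using h_1 by simp
      then show ?thesis by (metis h_posD)
    qed
    then obtain f where f: "\<And>j. j \<in> ?J \<Longrightarrow> f j < 4 \<and> int n dvd int (a (f j)) - int (1 + j * (n div q))"
      by metis
    have "inj_on f ?J"
    proof (rule inj_onI)
      fix j j' assume jj: "j \<in> ?J" "j' \<in> ?J" "f j = f j'"
      have "int n dvd int (a (f j)) - int (1 + j * (n div q))"
        using f[OF jj(1)] by (rule conjunct2)
      moreover have "int n dvd int (a (f j)) - int (1 + j' * (n div q))"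
        unfolding jj(3) using f[OF jj(2)] by (rule conjunct2)
      ultimately have "int n dvd int (a (f j)) - int (1 + j * (n div q)) - (int (a (f j)) - int (1 + j' * (n div q)))"
        by (rule dvd_diff)
      also have "int (a (f j)) - int (1 + j * (n div q)) - (int (a (f j)) - int (1 + j' * (n div q))) =
          (int j' - int j) * int (n div q)" by (simp add: algebra_simps)
      finally have "int q dvd int j' - int j" by (simp only: dvd_mult_div_iff)
      then have "j' = j" by (rule eq_of_int_dvd_diff) (use jj in auto)
      then show "j = j'" ..
    qed
    then have "card (f ` ?J) \<ge> 4" using card_unit_columns by (simp add: card_image)
    moreover have "f ` ?J \<subseteq> {..<4}" using f by auto
    ultimately have "f ` ?J = {..<4}" by (intro card_subset_eq) (auto dest: card_mono[rotated])
    have "int p dvd int (a k) - 1" if "k < 4" for k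
    proof -
      from that \<open>f ` ?J = {..<4}\<close> obtain j where j: "j \<in> ?J" "k = f j" by auto
      have "int n dvd int (a k) - int (1 + j * (n div q))" using f[OF j(1)] j(2) by simp
      then have "int p dvd int (a k) - int (1 + j * (n div q))" using pn by (meson dvd_trans int_dvd_int_iff)
      moreover have "int p dvd int (j * (n div q))" using p_nq by simp
      ultimately have "int p dvd int (a k) - int (1 + j * (n div q)) + int (j * (n div q))" by (rule dvd_add)
      then show ?thesis by simp
    qed
    then have "int p dvd (\<Sum>k<4. int (a k) - 1)" by (intro dvd_sum) auto
    moreover have "int p dvd (\<Sum>k<4. int (a k))"
      using dvd_trans[OF pn sum0] by (simp flip: int_dvd_int_iff)
    ultimately have "int p dvd (\<Sum>k<4. int (a k)) - (\<Sum>k<4. int (a k) - 1)" by (rule dvd_diff[rotated])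
    then have "int p dvd 4" by (simp add: sum_subtractf)
    then show False using p zdvd_imp_le[of "int p" 4] by simp
  qed
  then obtain j where j: "coprime (?y j) n" "h (?y j) \<noteq> 0" by blast
  from j(2) obtain k where "k < 4" "int n dvd int (a k) - int (?y j) \<or> int n dvd int (a k) + int (?y j)"
    by (rule h_nonzeroD)
  with j(1) show ?thesis by (rule that)
qed

lemma prime_int_p: "prime (int p)" and not_dvd_small: "0 < m \<Longrightarrow> m < 5 \<Longrightarrow> \<not> int p dvd m"
  using p zdvd_imp_le[of "int p" m] by auto

lemma int_dvd_trans: "int n dvd c \<Longrightarrow> int p dvd c" "int n dvd c \<Longrightarrow> int q dvd c"
  using pn qn by (meson dvd_trans int_dvd_int_iff)+

text \<open>Otherwise every point of the grid is 1 modulo \<open>p\<close>, and each of the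
  \<open>p\<close> rows contains some \<open>a k\<close> or \<open>- a k\<close>. Two rows cannot
  share \<open>k\<close>: opposite signs would give two points with sum 0 modulo \<open>n\<close>
  but 2 modulo \<open>p\<close>, and equal signs identify the rows. So \<open>p \<le> 4\<close>. The
  result makes the rows run through all residues modulo \<open>p\<close>.\<close>

lemma not_p_dvd_n_div_p: "\<not> p dvd n div p"
proof
  assume pp: "p dvd n div p"
  have row: "p dvd i * (n div p)" for i using pp by simp
  have mod_p: "int p dvd int (1 + i * (n div p) + j * (n div q)) - 1" for i j
    using pp p_nq by simp
  have "\<exists>j k. k < 4 \<and> (int n dvd int (a k) - int (1 + i * (n div p) + j * (n div q)) \<or>
      int n dvd int (a k) + int (1 + i * (n div p) + j * (n div q)))" for i
  proof -
    have "\<not> p dvd 1 + i * (n div p)" using dvd_add_left_iff[OF row[of i], of 1] p by simp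
    then show ?thesis by (rule row_nonempty) blast
  qed
  then obtain f g where fg: "\<And>i. g i < 4" "\<And>i. int n dvd int (a (g i)) - int (1 + i * (n div p) + f i * (n div q)) \<or>
      int n dvd int (a (g i)) + int (1 + i * (n div p) + f i * (n div q))" by metis
  define y where "y i = int (1 + i * (n div p) + f i * (n div q))" for i
  have y: "int p dvd y i - 1" "int n dvd int (a (g i)) - y i \<or> int n dvd int (a (g i)) + y i" for i
    using mod_p fg(2) by (auto simp: y_def)
  have "inj_on g {..<p}"
  proof (rule inj_onI)
    fix i i' assume ii: "i \<in> {..<p}" "i' \<in> {..<p}" "g i = g i'"
    let ?b = "int (a (g i))"
    have no_sum: "\<not> int n dvd y i + y i'"
    proof
      assume "int n dvd y i + y i'"
      from dvd_diff[OF int_dvd_trans(1)[OF this] dvd_add[OF y(1)[of i] y(1)[of i']]]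
      have "int p dvd y i + y i' - ((y i - 1) + (y i' - 1))" .
      then show False using not_dvd_small[of 2] by simp
    qed
    have "int n dvd y i - y i'"
    proof -
      have eq: "(?b + y i) - (?b - y i') = y i + y i'" "(?b + y i') - (?b - y i) = y i + y i'"
        "(?b + y i) - (?b + y i') = y i - y i'" "(?b - y i') - (?b - y i) = y i - y i'" by simp_all
      have "int n dvd ?b - y i \<or> int n dvd ?b + y i" "int n dvd ?b - y i' \<or> int n dvd ?b + y i'"
        using y(2)[of i] y(2)[of i'] ii(3) by simp_all
      then show ?thesis using no_sum dvd_diff eq by metis
    qed
    \<comment> \<open>The factor \<open>q\<close> turns the column steps \<open>n div q\<close> into
      multiples of \<open>n\<close>, so that only the rows are compared.\<close>
    then have "int n dvd int q * (y i - y i')" by simp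
    also have "int q * (y i - y i') =
        int q * (int i - int i') * int (n div p) + (int (f i) - int (f i')) * int n"
    proof -
      obtain l where "n = q * l" using qn by blast
      then have "int n = int q * int (n div q)" using q(2) by simp
      then show ?thesis by (simp only: y_def) (simp add: algebra_simps)
    qed
    finally have "int n dvd int q * (int i - int i') * int (n div p)"
      by (simp add: dvd_add_left_iff)
    then have "int p dvd int q * (int i - int i')"
      by (simp only: four_terms.dvd_mult_div_iff[OF swap])
    moreover have "\<not> int p dvd int q" using primes_dvd_imp_eq[OF p(1) q(1)] neq by auto
    ultimately have "int p dvd int i - int i'" using prime_int_p prime_dvd_mult_iff by blast
    then show "i = i'" by (rule eq_of_int_dvd_diff) (use ii in auto)
  qed
  then have "card {..<p} \<le> card {..<4::nat}" by (rule card_inj_on_le) (use fg(1) in auto)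
  then show False using p by simp
qed

lemma row_exists:
  "\<exists>i. int p dvd int (x + i * (n div p)) - r"
proof -
  have "coprime (int (n div p)) (int p)"
    using not_p_dvd_n_div_p p prime_imp_coprime[of p "n div p"] by (simp add: coprime_commute)
  then obtain u where u: "[int (n div p) * u = 1] (mod int p)" using cong_solve_coprime_int by blast
  define i where "i = nat ((r - int x) * u mod int p)"
  have p0: "int p > 0" using p by simp
  then have "int i = (r - int x) * u mod int p" by (simp add: i_def)
  then have "[int i = (r - int x) * u] (mod int p)" by (simp add: cong_def)
  then have "[int i * int (n div p) = (r - int x) * u * int (n div p)] (mod int p)" by (rule cong_scalar_right)
  also have "(r - int x) * u * int (n div p) = (r - int x) * (int (n div p) * u)" by simp
  also have "[\<dots> = (r - int x) * 1] (mod int p)" using u by (rule cong_scalar_left)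
  finally have "int p dvd int i * int (n div p) - (r - int x)" by (simp add: cong_iff_dvd_diff)
  then show ?thesis by (intro exI[of _ i]) (simp add: algebra_simps)
qed

text \<open>If \<open>a k\<close> were the only unit term congruent to \<open>\<plusminus>a k\<close> modulo \<open>p\<close>, then in the rectangle with
  corners \<open>(r, s)\<close> and \<open>(-r, 2s)\<close>, where \<open>(r, s)\<close> is \<open>a k\<close> modulo \<open>p\<close> and \<open>q\<close>, only the first
  corner would be nonzero.\<close>

lemma partner_exists:
  assumes k: "k < 4" "coprime (a k) n"
  shows "\<exists>l<4. l \<noteq> k \<and> coprime (a l) n \<and> (int p dvd int (a l) - int (a k) \<or> int p dvd int (a l) + int (a k))"
proof (rule ccontr)
  assume "\<not> ?thesis"
  then have alone: "l = k" if "l < 4" "coprime (a l) n"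
    "int p dvd int (a l) - int (a k) \<or> int p dvd int (a l) + int (a k)" for l
    using that by blast
  let ?x = "a k"
  \<comment> \<open>The row of \<open>- a k\<close> keeps all corners in the classes where
    \<open>a k\<close> is the only unit term. The column of \<open>2 * a k\<close> differs from
    those of \<open>a k\<close> and \<open>- a k\<close>, because \<open>q \<ge> 5\<close> divides
    neither 1 nor 3.\<close>
  obtain i where i: "int p dvd int (?x + i * (n div p)) - (- int ?x)" using row_exists by blast
  obtain j where j: "int q dvd int (?x + j * (n div q)) - (2 * int ?x)"
    using four_terms.row_exists[OF swap] by blast
  have x: "\<not> int p dvd int ?x" "\<not> int q dvd int ?x" using k(2) cop by simp_all
  have mult: "\<not> int p dvd m * int ?x" "\<not> int q dvd m * int ?x" if "0 < m" "m < 5" for m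
    using that x prime_int_p not_dvd_small[of m] four_terms.prime_int_p[OF swap]
      four_terms.not_dvd_small[OF swap, of m] by (auto simp: prime_dvd_mult_iff)
  have row: "\<not> p dvd ?x + i * (n div p)"
  proof
    assume "p dvd ?x + i * (n div p)"
    then have "int p dvd int (?x + i * (n div p))" by (simp only: int_dvd_int_iff)
    from dvd_diff[OF i this] show False using x by simp
  qed
  have col: "\<not> q dvd ?x + j * (n div q)"
  proof
    assume "q dvd ?x + j * (n div q)"
    then have "int q dvd int (?x + j * (n div q))" by (simp only: int_dvd_int_iff)
    from dvd_diff[OF this j] show False using mult(2)[of 2] by simp
  qed
  have xnat: "\<not> p dvd ?x" "\<not> q dvd ?x" using k(2) cop by auto
  \<comment> \<open>Any other term equal to \<open>X\<close> or \<open>- X\<close> modulo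
    \<open>n\<close> would be a unit, as \<open>X\<close> is, and congruent to
    \<open>\<plusminus>a k\<close> modulo \<open>p\<close>.\<close>
  have h_eq: "h X = of_bool (int n dvd int ?x - int X) - of_bool (int n dvd int ?x + int X)"
    if X: "coprime X n" "int p dvd int X - int ?x \<or> int p dvd int X + int ?x" for X
  proof -
    have "of_bool (int n dvd int (a l) - int X) - of_bool (int n dvd int (a l) + int X) = (0::real)"
      if l: "l < 4" "l \<noteq> k" for l
    proof -
      have False if n_dvd: "int n dvd int (a l) - int X \<or> int n dvd int (a l) + int X"
      proof -
        have "coprime (a l) n"
        proof -
          have "int p dvd int (a l) - int X \<or> int p dvd int (a l) + int X"
            "int q dvd int (a l) - int X \<or> int q dvd int (a l) + int X"
            using n_dvd int_dvd_trans by blast+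
          moreover have "\<not> int p dvd int X" "\<not> int q dvd int X" using X cop by simp_all
          ultimately have "\<not> int p dvd int (a l)" "\<not> int q dvd int (a l)"
            by (meson dvd_diff_right_iff dvd_add_right_iff)+
          then show ?thesis by (simp add: cop)
        qed
        moreover have "int p dvd int (a l) - int ?x \<or> int p dvd int (a l) + int ?x"
        proof -
          have eq: "(int (a l) - int X) + (int X - int ?x) = int (a l) - int ?x"
            "(int (a l) - int X) + (int X + int ?x) = int (a l) + int ?x"
            "(int (a l) + int X) - (int X - int ?x) = int (a l) + int ?x"
            "(int (a l) + int X) - (int X + int ?x) = int (a l) - int ?x" by simp_all
          have "int p dvd int (a l) - int X \<or> int p dvd int (a l) + int X"
            using n_dvd int_dvd_trans by blast
          then show ?thesis using X(2) dvd_add dvd_diff eq by metis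
        qed
        ultimately show False using alone l by blast
      qed
      then show ?thesis by auto
    qed
    then have "h X = (\<Sum>l\<in>{k}. of_bool (int n dvd int (a l) - int X) - of_bool (int n dvd int (a l) + int X))"
      unfolding h_def by (intro sum.mono_neutral_right) (use k in auto)
    then show ?thesis by simp
  qed
  have p_col: "int p dvd int (j * (n div q))" "int q dvd int (i * (n div p))"
    using p_nq q_np by simp_all
  let ?X2 = "?x + i * (n div p)" and ?X3 = "?x + j * (n div q)" and ?X4 = "?x + i * (n div p) + j * (n div q)"
  have cops: "coprime ?X2 n" "coprime ?X3 n" "coprime ?X4 n"
    subgoal unfolding coprime_row using row xnat by blast
    subgoal unfolding coprime_col using col xnat by blast
    subgoal unfolding coprime_row_col using row col by blast
    done
  have X4p: "int p dvd int ?X4 + int ?x" using dvd_add[OF i p_col(1)] by (simp add: algebra_simps)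
  have X4q: "int q dvd int ?X4 - 2 * int ?x" using dvd_add[OF j p_col(2)] by (simp add: algebra_simps)
  have X2p: "int p dvd int ?X2 + int ?x" using i by simp
  have X3q: "int q dvd int ?X3 - 2 * int ?x" using j by simp
  have X2q: "int q dvd int ?X2 - int ?x" using p_col by simp
  have X3p: "int p dvd int ?X3 - int ?x" using p_col by simp
  have no: "\<not> int n dvd int ?x - Y" "\<not> int n dvd int ?x + Y"
    if "int p dvd Y + int ?x" "int q dvd Y - int ?x \<or> int q dvd Y - 2 * int ?x" for Y
  proof -
    show "\<not> int n dvd int ?x - Y"
    proof
      assume "int n dvd int ?x - Y"
      from dvd_add[OF int_dvd_trans(1)[OF this] that(1)] show False using mult(1)[of 2] by simp
    qed
    show "\<not> int n dvd int ?x + Y"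
    proof
      assume "int n dvd int ?x + Y"
      then have "int q dvd int ?x + Y" by (rule int_dvd_trans)
      then have "int q dvd (int ?x + Y) - (Y - int ?x) \<or> int q dvd (int ?x + Y) - (Y - 2 * int ?x)"
        using that(2) dvd_diff by blast
      then show False using mult(2)[of 2] mult(2)[of 3] by simp
    qed
  qed
  have "h ?x = 1"
  proof -
    have "\<not> int n dvd int ?x + int ?x"
    proof
      assume "int n dvd int ?x + int ?x"
      from int_dvd_trans(1)[OF this] show False using mult(1)[of 2] by simp
    qed
    then show ?thesis using h_eq[OF k(2)] by simp
  qed
  moreover have "h ?X2 = 0" using h_eq[OF cops(1)] X2p no[of "int ?X2"] X2q by simp
  moreover have "h ?X4 = 0" using h_eq[OF cops(3)] X4p no[of "int ?X4"] X4q by simp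
  moreover have "h ?X3 = 0"
  proof -
    have "\<not> int n dvd int ?x - int ?X3"
    proof
      assume "int n dvd int ?x - int ?X3"
      from dvd_add[OF int_dvd_trans(2)[OF this] X3q] show False using x by simp
    qed
    moreover have "\<not> int n dvd int ?x + int ?X3"
    proof
      assume "int n dvd int ?x + int ?X3"
      from dvd_diff[OF int_dvd_trans(1)[OF this] X3p] show False using mult(1)[of 2] by simp
    qed
    ultimately show ?thesis using h_eq[OF cops(2)] X3p by simp
  qed
  ultimately show False using rectangle[OF k(2) cops(1,2,3)] by simp
qed

text \<open>For \<open>p \<ge> 7\<close> the classes of \<open>\<plusminus>1\<close>,
  \<open>\<plusminus>2\<close>, \<open>\<plusminus>3\<close> modulo \<open>p\<close> are disjoint.
  Each contains a unit term by \<open>row_nonempty\<close> and a second term by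
  \<open>partner_exists\<close>, which makes six terms out of four.\<close>

lemma p_eq_5: "p = 5"
proof (rule ccontr)
  assume "p \<noteq> 5"
  moreover have "p \<noteq> 6"
  proof
    assume "p = 6"
    then have "2 dvd p" by simp
    then show False using primes_dvd_imp_eq[of 2 p] p \<open>p = 6\<close> by simp
  qed
  ultimately have p7: "p \<ge> 7" using p(2) by linarith
  define C where "C r = {k\<in>{..<4}. int p dvd int (a k) - r \<or> int p dvd int (a k) + r}" for r :: int
  have two: "card (C r) \<ge> 2" if r: "r \<in> {1, 2, 3}" for r
  proof -
    obtain i where i: "int p dvd int (1 + i * (n div p)) - r" using row_exists by blast
    have "\<not> p dvd 1 + i * (n div p)"
    proof
      assume "p dvd 1 + i * (n div p)"
      then have "int p dvd int (1 + i * (n div p))" by (simp only: int_dvd_int_iff)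
      from dvd_diff[OF this i] show False using not_dvd_small[of r] r by auto
    qed
    then obtain j k where jk: "coprime (1 + i * (n div p) + j * (n div q)) n" "k < 4"
      "int n dvd int (a k) - int (1 + i * (n div p) + j * (n div q)) \<or>
       int n dvd int (a k) + int (1 + i * (n div p) + j * (n div q))" by (rule row_nonempty)
    define y where "y = int (1 + i * (n div p) + j * (n div q))"
    have n_dvd: "int n dvd int (a k) - y \<or> int n dvd int (a k) + y" using jk(3) by (simp only: y_def)
    have yr: "int p dvd y - r" using dvd_add[OF i, of "int (j * (n div q))"] p_nq by (simp add: y_def algebra_simps)
    have "\<not> int p dvd y" "\<not> int q dvd y"
      using jk(1)[unfolded cop] unfolding y_def int_dvd_int_iff by blast+
    moreover have dvds: "int p dvd int (a k) - y \<or> int p dvd int (a k) + y"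
      "int q dvd int (a k) - y \<or> int q dvd int (a k) + y" using n_dvd int_dvd_trans by blast+
    ultimately have "\<not> int p dvd int (a k)" "\<not> int q dvd int (a k)"
      by (meson dvd_diff_right_iff dvd_add_right_iff)+
    then have unit: "coprime (a k) n" by (simp add: cop)
    have kr: "int p dvd int (a k) - r \<or> int p dvd int (a k) + r"
    proof -
      have "(int (a k) - y) + (y - r) = int (a k) - r" "(int (a k) + y) - (y - r) = int (a k) + r" by simp_all
      then show ?thesis using dvds(1) yr dvd_add dvd_diff by metis
    qed
    obtain l where l: "l < 4" "l \<noteq> k" "int p dvd int (a l) - int (a k) \<or> int p dvd int (a l) + int (a k)"
      using partner_exists[OF jk(2) unit] by blast
    have "int p dvd int (a l) - r \<or> int p dvd int (a l) + r"
    proof -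
      have "(int (a l) - int (a k)) + (int (a k) - r) = int (a l) - r"
        "(int (a l) - int (a k)) + (int (a k) + r) = int (a l) + r"
        "(int (a l) + int (a k)) - (int (a k) - r) = int (a l) + r"
        "(int (a l) + int (a k)) - (int (a k) + r) = int (a l) - r" by simp_all
      then show ?thesis using l(3) kr dvd_add dvd_diff by metis
    qed
    then have "{k, l} \<subseteq> C r" using jk(2) kr l(1) by (auto simp: C_def)
    then have "card {k, l} \<le> card (C r)" by (rule card_mono[rotated]) (simp add: C_def)
    then show ?thesis using l(2) by simp
  qed
  have disj: "C r \<inter> C s = {}" if "r \<in> {1, 2, 3}" "s \<in> {1, 2, 3}" "r < s" for r s
  proof -
    have small: "\<not> int p dvd m" if "0 < m" "m < 7" for m
      using that p7 zdvd_imp_le[of "int p" m] by auto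
    have False if "k \<in> C r" "k \<in> C s" for k
    proof -
      have "(int (a k) - r) - (int (a k) - s) = s - r" "(int (a k) + s) - (int (a k) - r) = s + r"
        "(int (a k) + r) - (int (a k) - s) = s + r" "(int (a k) + s) - (int (a k) + r) = s - r" by simp_all
      then have "int p dvd s - r \<or> int p dvd s + r" using that dvd_diff unfolding C_def mem_Collect_eq by metis
      then show False using small[of "s - r"] small[of "s + r"]
        \<open>r \<in> {1, 2, 3}\<close> \<open>s \<in> {1, 2, 3}\<close> \<open>r < s\<close> by auto
    qed
    then show ?thesis by auto
  qed
  have fin: "finite (C r)" for r by (simp add: C_def)
  have "card (C 1 \<union> C 2 \<union> C 3) = card (C 1) + card (C 2) + card (C 3)"
    using disj[of 1 2] disj[of 1 3] disj[of 2 3] fin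
    by (subst card_Un_disjoint, auto)+
  moreover have "card (C 1 \<union> C 2 \<union> C 3) \<le> card {..<4::nat}" by (rule card_mono) (auto simp: C_def)
  ultimately show False using two[of 1] two[of 2] two[of 3] by simp
qed

lemma contradiction: False
  using p_eq_5 four_terms.p_eq_5[OF swap] neq by simp

end

section \<open>The index\<close>

text \<open>Changing the generator multiplies all coefficients by a unit \<open>t\<close>, so the
  sum is \<open>n\<close> times a norm. Minimality appears as \<open>single\<close> and
  \<open>pairs\<close>; a sum of three terms is minus the fourth modulo \<open>n\<close>.\<close>

theorem exists_unit_sum_mod_eq:
  fixes a :: "nat \<Rightarrow> nat"
  assumes p: "prime p" and q: "prime q" and neq: "p \<noteq> q"
    and \<alpha>: "\<alpha> \<ge> 1" and \<beta>: "\<beta> \<ge> 1" and n_eq: "n = p ^ \<alpha> * q ^ \<beta>" and n6: "gcd n 6 = 1"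
    and a0: "a 0 = 1" and sum0: "n dvd (\<Sum>k<4. a k)"
    and single: "\<And>k. k < 4 \<Longrightarrow> \<not> n dvd a k"
    and pairs: "\<And>k l. k < 4 \<Longrightarrow> l < 4 \<Longrightarrow> k \<noteq> l \<Longrightarrow> \<not> n dvd a k + a l"
  shows "\<exists>t. coprime t n \<and> (\<Sum>k<4. t * a k mod n) = n"
proof (rule ccontr)
  assume none: "\<not> ?thesis"
  have n0: "n > 0" using p q by (simp add: n_eq prime_gt_0_nat)
  have pn: "p dvd n" and qn: "q dvd n" using \<alpha> \<beta> by (simp_all add: n_eq dvd_power)
  have ge5: "5 \<le> r" if "prime r" "r dvd n" for r :: nat
  proof (rule ccontr)
    assume "\<not> 5 \<le> r"
    then have "r \<in> {2, 3, 4}" using prime_ge_2_nat[OF that(1)] by auto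
    moreover have "r \<noteq> 4" using that(1) primes_dvd_imp_eq[of 2 4] by auto
    ultimately have "r dvd 6" by auto
    then have "r dvd 1" using that(2) n6 by (metis gcd_greatest)
    then show False using that(1) by simp
  qed
  have cop: "coprime m n \<longleftrightarrow> \<not> p dvd m \<and> \<not> q dvd m" for m
    using \<alpha> \<beta> p q by (auto simp: n_eq coprime_commute[of m] prime_imp_coprime
        coprime_absorb_left dest: coprime_common_divisor)
  have p_nq: "p dvd n div q" and q_np: "q dvd n div p"
  proof -
    have "n = q * (p ^ \<alpha> * q ^ (\<beta> - 1))" "n = p * (q ^ \<beta> * p ^ (\<alpha> - 1))"
      using \<alpha> \<beta> by (simp_all add: n_eq power_eq_if)
    then have "n div q = p ^ \<alpha> * q ^ (\<beta> - 1)" "n div p = q ^ \<beta> * p ^ (\<alpha> - 1)"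
      using p q by (metis nonzero_mult_div_cancel_left not_prime_0)+
    then show "p dvd n div q" "q dvd n div p" using \<alpha> \<beta> by (simp_all add: dvd_power)
  qed
  define S where "S t = (\<Sum>k<4. t * a k mod n)" for t
  have residue: "0 < t * a k mod n" if "coprime t n" "k < 4" for t k
  proof (rule ccontr)
    assume "\<not> 0 < t * a k mod n"
    then have "n dvd t * a k" by (simp add: mod_eq_0_iff_dvd)
    then show False using single[OF that(2)] that(1)
      by (simp add: coprime_dvd_mult_right_iff coprime_commute)
  qed
  have S_dvd: "n dvd S t" for t
  proof -
    have "S t mod n = (\<Sum>k<4. t * a k) mod n" unfolding S_def by (rule mod_sum_eq)
    also have "\<dots> = 0" using sum0 by (simp add: sum_distrib_left[symmetric])
    finally show ?thesis by (simp add: mod_eq_0_iff_dvd)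
  qed
  have S_bounds: "0 < S t" "S t < 4 * n" if t: "coprime t n" for t
  proof -
    show "0 < S t" unfolding S_def by (rule sum_pos2[of _ 0]) (use residue[OF t, of 0] in auto)
    have "S t < (\<Sum>k<4::nat. n)"
      unfolding S_def by (rule sum_strict_mono) (use n0 in \<open>auto simp: lessThan_empty_iff\<close>)
    then show "S t < 4 * n" by simp
  qed
  have n1: "coprime (n - 1) n" using n0 coprime_diff_one_left_nat[of n] by simp
  have S_compl: "S t + S ((n - 1) * t) = 4 * n" if t: "coprime t n" for t
  proof -
    have "t * a k mod n + (n - 1) * t * a k mod n = n" if k: "k < 4" for k
    proof -
      let ?r = "t * a k mod n"
      have "((n - 1) * t * a k + t * a k) mod n = 0"
      proof -
        have "(n - 1) * t * a k + t * a k = n * (t * a k)"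
          using n0 by (cases n) (simp_all add: algebra_simps)
        then show ?thesis by simp
      qed
      then have "n dvd (n - 1) * t * a k mod n + ?r" by (simp add: mod_add_eq mod_eq_0_iff_dvd[symmetric])
      moreover have "(n - 1) * t * a k mod n + ?r < 2 * n" using n0 by (simp add: add_strict_mono mult_2)
      moreover have "0 < (n - 1) * t * a k mod n + ?r" using residue[OF t k] by simp
      ultimately have "(n - 1) * t * a k mod n + ?r = n"
        by (auto elim!: dvdE simp: less_2_cases_iff)
      then show ?thesis by simp
    qed
    then show ?thesis by (simp add: S_def sum.distrib[symmetric])
  qed
  have S_eq: "S t = 2 * n" if t: "coprime t n" for t
  proof -
    obtain c where c: "S t = n * c" using S_dvd by blast
    have "0 < c" "c < 4" using S_bounds[OF t] c n0 by auto
    moreover have "c \<noteq> 1" using none t c by (auto simp: S_def)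
    moreover have "c \<noteq> 3"
    proof
      assume "c = 3"
      then have "S ((n - 1) * t) = n" using S_compl[OF t] c by simp
      then show False using none n1 t by (auto simp: S_def)
    qed
    ultimately have "c = 2" by linarith
    then show ?thesis using c by simp
  qed
  have avg: "(\<Sum>k<4. 2 * real (t * a k mod n)) = real (card {..<4::nat}) * real n" if "coprime t n" for t
  proof -
    have "(\<Sum>k<4. 2 * real (t * a k mod n)) = 2 * real (S t)"
      by (simp add: S_def sum_distrib_left)
    then show ?thesis using S_eq[OF that] by simp
  qed
  have "four_terms p q n a"
  proof unfold_locales
    show "5 \<le> p" "5 \<le> q" using ge5 p q pn qn by auto
    fix x i j
    assume "coprime x n" "coprime (x + i * (n div p)) n" "coprime (x + j * (n div q)) n"
      "coprime (x + i * (n div p) + j * (n div q)) n"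
    then show "(\<Sum>k<4. of_bool (int n dvd int (a k) - int x) - of_bool (int n dvd int (a k) + int x)) +
      (\<Sum>k<4. of_bool (int n dvd int (a k) - int (x + i * (n div p) + j * (n div q)))
        - of_bool (int n dvd int (a k) + int (x + i * (n div p) + j * (n div q)))) =
      (\<Sum>k<4. of_bool (int n dvd int (a k) - int (x + i * (n div p)))
        - of_bool (int n dvd int (a k) + int (x + i * (n div p)))) +
      (\<Sum>k<4. of_bool (int n dvd int (a k) - int (x + j * (n div q)))
        - of_bool (int n dvd int (a k) + int (x + j * (n div q))) :: real)"
      by (intro count_rectangle) (use n0 p q neq pn qn cop single avg in auto)
  qed (use p q neq pn qn n0 p_nq q_np cop a0 sum0 pairs in auto)
  then show False by (rule four_terms.contradiction)
qed

section \<open>Transfer to sequences over a cyclic group\<close>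

context group
begin

lemma generators_iff_ord:
  assumes "finite (carrier G)" and "h \<in> carrier G"
  shows "h \<in> generators G \<longleftrightarrow> ord h = order G"
proof -
  have "generate G {h} \<subseteq> carrier G" using assms(2) by (intro generate_incl) simp
  then show ?thesis
    using assms generate_pow_card[OF assms(2)] card_subset_eq[OF assms(1)]
    by (auto simp: generators_def order_def)
qed

lemma seq_coeff_eqI:
  assumes "finite (carrier G)" "h \<in> generators G" "1 \<le> m" "m \<le> order G"
  shows "seq_coeff G h (h [^] m) = m"
proof -
  have "h \<in> carrier G" using assms(2) by (simp add: generators_def)
  then show ?thesis
    unfolding seq_coeff_def
    by (intro the1_equality seq_coeff_ex1[OF assms(1,2)]) (use assms in auto)
qed

lemma seq_coeffD:
  assumes "finite (carrier G)" "h \<in> generators G" "x \<in> carrier G"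
  shows "1 \<le> seq_coeff G h x" "h [^] seq_coeff G h x = x"
  using theI'[OF seq_coeff_ex1[OF assms]] unfolding seq_coeff_def by auto

end

lemma (in comm_group) seq_sum_image_pow:
  assumes "g \<in> carrier G"
  shows "seq_sum G (image_mset (\<lambda>k. g [^] (f k :: nat)) M) = g [^] (\<Sum>k\<in>#M. f k)"
proof (induction M)
  case (add k M)
  then show ?case using assms by (simp add: seq_sum_add_mset nat_pow_mult image_subset_iff)
qed (simp add: seq_sum_empty)

lemma (in comm_group) index_eq_1:
  assumes fin: "finite (carrier G)" and g: "g \<in> carrier G" and ord: "ord g = order G"
    and n: "order G = p ^ \<alpha> * q ^ \<beta>" and pq: "prime p" "prime q" "p \<noteq> q" "\<alpha> \<ge> 1" "\<beta> \<ge> 1"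
    and n6: "gcd (order G) 6 = 1"
    and a: "a 0 = 1" "\<And>k. k < 4 \<Longrightarrow> 1 \<le> a k \<and> a k < order G"
    and min: "minimal_zero_sum G (image_mset (\<lambda>k. g [^] (a k :: nat)) (mset_set {..<4}))"
  shows "seq_index G (image_mset (\<lambda>k. g [^] a k) (mset_set {..<4::nat})) = 1"
proof -
  let ?n = "order G"
  let ?S = "image_mset (\<lambda>k. g [^] a k) (mset_set {..<4::nat})"
  have n0: "?n > 0" using fin by (simp add: order_gt_0_iff_finite)
  have zero_iff: "zero_sum G (image_mset (\<lambda>k. g [^] a k) (mset_set A)) \<longleftrightarrow> ?n dvd (\<Sum>k\<in>A. a k)"
    if "finite A" for A
    using g ord pow_eq_id[OF g]
    by (auto simp: zero_sum_def seq_sum_image_pow sum_unfold_sum_mset)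
  have "?n dvd (\<Sum>k<4. a k)" using min zero_iff[of "{..<4}"] by (simp add: minimal_zero_sum_def)
  moreover have "\<not> ?n dvd a k" if "k < 4" for k
    using a(2)[OF that] by (auto dest: dvd_imp_le)
  moreover have "\<not> ?n dvd a k + a l" if kl: "k < 4" "l < 4" "k \<noteq> l" for k l
  proof
    assume "?n dvd a k + a l"
    then have "zero_sum G (image_mset (\<lambda>k. g [^] a k) (mset_set {k, l}))"
      using kl zero_iff[of "{k, l}"] by simp
    \<comment> \<open>Proper inclusion is shown for the indices, since different indices may give
      the same group element; multiset images preserve it.\<close>
    moreover have "mset_set {k, l} \<subset># mset_set {..<4}"
    proof -
      have "card {k, l} < card {..<4::nat}" using kl by simp
      moreover have "{k, l} \<subseteq> {..<4}" using kl by simp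
      ultimately have "{k, l} \<subset> {..<4}" by (metis less_irrefl psubsetI)
      then have "mset_set {k, l} \<subseteq># mset_set {..<4}" "mset_set {k, l} \<noteq> mset_set {..<4}"
        by (auto simp: subset_imp_msubset_mset_set)
      then show ?thesis by (simp add: subset_mset.less_le)
    qed
    then have "image_mset (\<lambda>k. g [^] a k) (mset_set {k, l}) \<subset># ?S" by (rule image_mset_subset_mono)
    moreover have "image_mset (\<lambda>k. g [^] a k) (mset_set {k, l}) \<noteq> {#}" using kl by simp
    ultimately show False using min by (auto simp: minimal_zero_sum_def)
  qed
  ultimately obtain t where t: "coprime t ?n" "(\<Sum>k<4. t * a k mod ?n) = ?n"
    using exists_unit_sum_mod_eq[where a = a, OF pq n n6 a(1)] by blast

  \<comment> \<open>The coefficients with respect to any generator have a positive sum, divisible by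
    the order because the sequence is zero-sum.\<close>
  have lower: "seq_norm G h ?S \<ge> 1" if h: "h \<in> generators G" for h
  proof -
    have hG: "h \<in> carrier G" using h by (simp add: generators_def)
    define c where "c k = seq_coeff G h (g [^] a k)" for k
    have c: "1 \<le> c k" "h [^] c k = g [^] a k" for k
      using seq_coeffD[OF fin h, of "g [^] a k"] g by (simp_all add: c_def)
    have "h [^] (\<Sum>k\<in>#mset_set {..<4::nat}. c k) = seq_sum G (image_mset (\<lambda>k. h [^] c k) (mset_set {..<4::nat}))"
      by (rule seq_sum_image_pow[OF hG, symmetric])
    also have "\<dots> = \<one>" using min by (simp add: c(2) minimal_zero_sum_def zero_sum_def)
    finally have "?n dvd (\<Sum>k\<in>#mset_set {..<4::nat}. c k)"
      using pow_eq_id[OF hG] generators_iff_ord[OF fin hG] h by simp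
    moreover have "0 < (\<Sum>k\<in>#mset_set {..<4::nat}. c k)"
      using c(1)[of 0] by (simp add: sum_unfold_sum_mset[symmetric] sum_pos2[of _ 0])
    ultimately have "?n \<le> (\<Sum>k\<in>#mset_set {..<4::nat}. c k)" by (rule dvd_imp_le)
    then have "real ?n \<le> real (\<Sum>k\<in>#mset_set {..<4::nat}. c k)" by (simp only: of_nat_le_iff)
    then show ?thesis using n0 by (simp add: seq_norm_def c_def image_mset.compositionality comp_def)
  qed
  obtain u where "[t * u = 1] (mod ?n)" using cong_solve_coprime_nat[OF t(1)] by auto
  then have ut: "[u * t = 1] (mod ?n)" by (simp add: mult.commute)
  \<comment> \<open>As \<open>u\<close> inverts \<open>t\<close> modulo the order, \<open>g\<close>
    is the \<open>t\<close>-th power of \<open>h\<close>, and \<open>g [^] a k\<close> gets the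
    coefficient \<open>t * a k\<close> reduced modulo the order.\<close>
  define h where "h = g [^] u"
  have hG: "h \<in> carrier G" using g by (simp add: h_def)
  have pow_cong: "g [^] x = g [^] y" if "[x = y] (mod ?n)" for x y :: nat
  proof -
    have "g [^] (x mod ?n) = g [^] x" for x
    proof -
      have "g [^] (x div ?n * ?n) = \<one>" using pow_eq_id[OF g, of "x div ?n * ?n"] ord by simp
      then have "g [^] (x div ?n * ?n + x mod ?n) = g [^] (x mod ?n)"
        using nat_pow_mult[OF g, of "x div ?n * ?n" "x mod ?n", symmetric] g by simp
      then show ?thesis by simp
    qed
    then show ?thesis using that by (metis cong_def)
  qed
  have "coprime u ?n" using cong_imp_coprime[OF cong_sym[OF ut]] by simp
  then have "ord h = ?n"
    unfolding h_def ord_unique[OF nat_pow_closed[OF g]]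
    using g ord by (simp add: nat_pow_pow pow_eq_id coprime_dvd_mult_right_iff coprime_commute)
  then have h: "h \<in> generators G" using generators_iff_ord[OF fin hG] by simp
  have coeff: "seq_coeff G h (g [^] a k) = t * a k mod ?n" if k: "k < 4" for k
  proof -
    let ?m = "t * a k mod ?n"
    have "\<not> ?n dvd t * a k"
      using t(1) a(2)[OF k] by (auto simp: coprime_dvd_mult_right_iff coprime_commute dest: dvd_imp_le)
    \<comment> \<open>The residue is nonzero and thus lies in the range from 1 to the order that
      \<open>seq_coeff\<close> uses.\<close>
    then have m: "1 \<le> ?m" "?m \<le> ?n" using n0 by (simp_all add: Suc_le_eq mod_eq_0_iff_dvd[symmetric])
    have "[u * ?m = u * (t * a k)] (mod ?n)" by (simp add: cong_def mod_mult_right_eq)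
    also have "u * (t * a k) = u * t * a k" by simp
    also have "[u * t * a k = 1 * a k] (mod ?n)" using ut by (rule cong_scalar_right)
    finally have "g [^] (u * ?m) = g [^] (1 * a k)" by (rule pow_cong)
    then have "h [^] ?m = g [^] a k" using g by (simp add: h_def nat_pow_pow)
    then show ?thesis using seq_coeff_eqI[OF fin h m] by simp
  qed
  have "(\<Sum>k<4. seq_coeff G h (g [^] a k)) = (\<Sum>k<4. t * a k mod ?n)"
    by (rule sum.cong) (use coeff in auto)
  then have norm: "seq_norm G h ?S = 1"
    using t(2) n0
    by (simp add: seq_norm_def image_mset.compositionality comp_def sum_unfold_sum_mset[symmetric])
  show ?thesis
    unfolding seq_index_def
  proof (rule Min_eqI)
    show "finite ((\<lambda>h. seq_norm G h ?S) ` generators G)"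
      using fin by (auto simp: generators_def)
    show "1 \<in> (\<lambda>h. seq_norm G h ?S) ` generators G" using h norm by force
  qed (use lower in auto)
qed

theorem theorem1p3:
  fixes G :: "('a, 'b) monoid_scheme" (structure)
    and p1 p2 \<alpha> \<beta> n x2 x3 x4 :: nat
    and g :: 'a
  assumes "prime p1" and "prime p2" and "p1 \<noteq> p2"
    and "\<alpha> \<ge> 1" and "\<beta> \<ge> 1"
    and "n = p1 ^ \<alpha> * p2 ^ \<beta>"
    and "gcd n 6 = 1"
    and "group G" and "cyclic_group G" and "finite (carrier G)" and "order G = n"
    and "g \<in> carrier G" and "group.ord G g = n"
    and "1 \<le> x2" and "x2 \<le> n - 1"
    and "1 \<le> x3" and "x3 \<le> n - 1"
    and "1 \<le> x4" and "x4 \<le> n - 1"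
    and "minimal_zero_sum G {#g, g [^] x2, g [^] x3, g [^] x4#}"
  shows "seq_index G {#g, g [^] x2, g [^] x3, g [^] x4#} = 1"
proof -
  interpret comm_group G
    using group.cyclic_imp_abelian_group[OF \<open>group G\<close> \<open>cyclic_group G\<close>] .
  define a where "a k = [1, x2, x3, x4] ! k" for k
  have "{..<4::nat} = {0, 1, 2, 3}" by auto
  then have S: "image_mset (\<lambda>k. g [^] a k) (mset_set {..<4::nat}) = {#g, g [^] x2, g [^] x3, g [^] x4#}"
    using \<open>g \<in> carrier G\<close> by (simp add: a_def numeral_3_eq_3 numeral_2_eq_2)
  have "1 \<le> a k \<and> a k < order G" if "k < 4" for k
  proof -
    have "k \<in> {0, 1, 2, 3}" using that by auto
    then show ?thesis using assms by (auto simp: a_def)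
  qed
  then have "seq_index G (image_mset (\<lambda>k. g [^] a k) (mset_set {..<4::nat})) = 1"
  proof (rule index_eq_1[of g p1 \<alpha> p2 \<beta>, rotated -2])
    show "minimal_zero_sum G (image_mset (\<lambda>k. g [^] a k) (mset_set {..<4::nat}))"
      unfolding S by (rule assms)
  qed (use assms in \<open>simp_all add: a_def\<close>)
  then show ?thesis by (simp only: S)
qed

end
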